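(* There exists a reflexive space $Z\in\mathrm{SB}$ with a Schauder basis such that every operator $A:X\to Y$ coded by an element of $\mathcal{W}_{\mathrm{SB},L_1}$ factors through $Z$, i.e. there are bounded operators $B:X\to Z$ and $C:Z\to Y$ with $A=C\circ B$.
   Context: All Banach spaces are real. $\Delta$ is the Cantor set and $C(\Delta)$ is the space of continuous real functions on $\Delta$ with the sup norm. $\mathrm{SB}$ is the set of closed linear subspaces of $C(\Delta)$, with the Effros–Borel structure. Fix Borel maps $d_n:\mathrm{SB}\to C(\Delta)$ such that $\{d_n(X)\}_n$ is dense in $X$ and the family is closed under rational linear combinations (for all $k,m$, $r,q\in\mathbb{Q}$ there is $n$ with $d_n(X)=rd_k(X)+qd_m(X)$ for all $X$). $\mathcal{L}$ is the set of triples $(X,Y,\hat A)\in\mathrm{SB}\times\mathrm{SB}\times C(\Delta)^{\mathbb{N}}$ for which $d_n(X)\mapsto\hat A(n)$ extends to a bounded linear operator $A:X\to Y$ (the triple is identified with $A$). $\mathcal{W}_{\mathrm{SB},L_1}$ is the set of $(X,Y,\hat A)\in\mathcal{L}$ such that $A$ is weakly compact and $Y$ is isomorphic to $L_1=L_1[0,1]$. *)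

theory Defs
  imports "HOL-Analysis.Analysis"
begin

type_synonym cfun = "real \<Rightarrow> real"

definition cantor :: "real set" where
  "cantor = {x. \<exists>b::nat \<Rightarrow> bool. x = (\<Sum>n. (if b n then 2 else 0) / 3 ^ Suc n)}"

text \<open>C(Delta): continuous real functions on Delta, represented extensionally (value 0 off Delta).\<close>
definition CD :: "cfun set" where
  "CD = {f. continuous_on cantor f \<and> (\<forall>x. x \<notin> cantor \<longrightarrow> f x = 0)}"

definition supnorm :: "cfun \<Rightarrow> real" where
  "supnorm f = (SUP x\<in>cantor. \<bar>f x\<bar>)"

definition fadd :: "cfun \<Rightarrow> cfun \<Rightarrow> cfun" where
  "fadd f g = (\<lambda>t. f t + g t)"

definition fscale :: "real \<Rightarrow> cfun \<Rightarrow> cfun" where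
  "fscale c f = (\<lambda>t. c * f t)"

definition fdiff :: "cfun \<Rightarrow> cfun \<Rightarrow> cfun" where
  "fdiff f g = (\<lambda>t. f t - g t)"

definition cd_converges :: "(nat \<Rightarrow> cfun) \<Rightarrow> cfun \<Rightarrow> bool" where
  "cd_converges s f \<longleftrightarrow> (\<lambda>n. supnorm (fdiff (s n) f)) \<longlonglongrightarrow> 0"

definition cd_open :: "cfun set \<Rightarrow> bool" where
  "cd_open U \<longleftrightarrow> U \<subseteq> CD \<and>
     (\<forall>f\<in>U. \<exists>e>0. \<forall>g\<in>CD. supnorm (fdiff g f) < e \<longrightarrow> g \<in> U)"

definition linear_subspace :: "cfun set \<Rightarrow> bool" where
  "linear_subspace X \<longleftrightarrow> X \<subseteq> CD \<and> (\<lambda>t. 0) \<in> X \<and>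
     (\<forall>f\<in>X. \<forall>g\<in>X. fadd f g \<in> X) \<and> (\<forall>c. \<forall>f\<in>X. fscale c f \<in> X)"

definition closed_subspace :: "cfun set \<Rightarrow> bool" where
  "closed_subspace X \<longleftrightarrow> linear_subspace X \<and>
     (\<forall>s f. (\<forall>n. s n \<in> X) \<and> f \<in> CD \<and> cd_converges s f \<longrightarrow> f \<in> X)"

definition SB :: "cfun set set" where
  "SB = {X. closed_subspace X}"

definition effros_borel :: "cfun set set set" where
  "effros_borel = sigma_sets SB {{F \<in> SB. F \<inter> U \<noteq> {}} | U. cd_open U}"

definition bounded_op :: "cfun set \<Rightarrow> cfun set \<Rightarrow> (cfun \<Rightarrow> cfun) \<Rightarrow> bool" where
  "bounded_op X Y A \<longleftrightarrow> (\<forall>x\<in>X. A x \<in> Y) \<and>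
     (\<forall>x\<in>X. \<forall>y\<in>X. A (fadd x y) = fadd (A x) (A y)) \<and>
     (\<forall>c. \<forall>x\<in>X. A (fscale c x) = fscale c (A x)) \<and>
     (\<exists>K. \<forall>x\<in>X. supnorm (A x) \<le> K * supnorm x)"

definition dual :: "cfun set \<Rightarrow> (cfun \<Rightarrow> real) set" where
  "dual X = {\<phi>. (\<forall>x\<in>X. \<forall>y\<in>X. \<phi> (fadd x y) = \<phi> x + \<phi> y) \<and>
                 (\<forall>c. \<forall>x\<in>X. \<phi> (fscale c x) = c * \<phi> x) \<and>
                 (\<exists>K. \<forall>x\<in>X. \<bar>\<phi> x\<bar> \<le> K * supnorm x) \<and>
                 (\<forall>x. x \<notin> X \<longrightarrow> \<phi> x = 0)}"

definition dual_norm :: "cfun set \<Rightarrow> (cfun \<Rightarrow> real) \<Rightarrow> real" where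
  "dual_norm X \<phi> = (SUP x\<in>{x\<in>X. supnorm x \<le> 1}. \<bar>\<phi> x\<bar>)"

definition bidual :: "cfun set \<Rightarrow> ((cfun \<Rightarrow> real) \<Rightarrow> real) set" where
  "bidual X = {\<Phi>. (\<forall>\<phi>\<in>dual X. \<forall>\<psi>\<in>dual X. \<Phi> (\<lambda>x. \<phi> x + \<psi> x) = \<Phi> \<phi> + \<Phi> \<psi>) \<and>
                   (\<forall>c. \<forall>\<phi>\<in>dual X. \<Phi> (\<lambda>x. c * \<phi> x) = c * \<Phi> \<phi>) \<and>
                   (\<exists>K. \<forall>\<phi>\<in>dual X. \<bar>\<Phi> \<phi>\<bar> \<le> K * dual_norm X \<phi>)}"

definition reflexive_space :: "cfun set \<Rightarrow> bool" where
  "reflexive_space X \<longleftrightarrow> (\<forall>\<Phi>\<in>bidual X. \<exists>x\<in>X. \<forall>\<phi>\<in>dual X. \<Phi> \<phi> = \<phi> x)"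

definition has_schauder_basis :: "cfun set \<Rightarrow> bool" where
  "has_schauder_basis X \<longleftrightarrow> (\<exists>e::nat \<Rightarrow> cfun. (\<forall>n. e n \<in> X) \<and>
     (\<forall>x\<in>X. \<exists>!a::nat \<Rightarrow> real.
        cd_converges (\<lambda>N. (\<lambda>t. \<Sum>n<N. a n * e n t)) x))"

definition weak_topology :: "cfun set \<Rightarrow> cfun topology" where
  "weak_topology X = topology_generated_by
     {{x \<in> X. \<phi> x \<in> U} | \<phi> U. \<phi> \<in> dual X \<and> open U}"

definition weakly_compact_op :: "cfun set \<Rightarrow> cfun set \<Rightarrow> (cfun \<Rightarrow> cfun) \<Rightarrow> bool" where
  "weakly_compact_op X Y A \<longleftrightarrow>
     (\<exists>K. K \<subseteq> Y \<and> compactin (weak_topology Y) K \<and>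
          A ` {x \<in> X. supnorm x \<le> 1} \<subseteq> K)"

text \<open>Y is isomorphic to L1[0,1]: a linear (modulo a.e.) bijection onto L1 classes,
  bounded above and below.\<close>
definition isomorphic_L1 :: "cfun set \<Rightarrow> bool" where
  "isomorphic_L1 Y \<longleftrightarrow> (\<exists>(T :: cfun \<Rightarrow> real \<Rightarrow> real) c C. 0 < c \<and>
     (\<forall>y\<in>Y. set_integrable lborel {0..1} (T y) \<and>
        c * supnorm y \<le> (LBINT t:{0..1}. \<bar>T y t\<bar>) \<and>
        (LBINT t:{0..1}. \<bar>T y t\<bar>) \<le> C * supnorm y) \<and>
     (\<forall>y\<in>Y. \<forall>z\<in>Y. AE t in lborel. t \<in> {0..1} \<longrightarrow> T (fadd y z) t = T y t + T z t) \<and>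
     (\<forall>a. \<forall>y\<in>Y. AE t in lborel. t \<in> {0..1} \<longrightarrow> T (fscale a y) t = a * T y t) \<and>
     (\<forall>f. set_integrable lborel {0..1} f \<longrightarrow>
        (\<exists>y\<in>Y. AE t in lborel. t \<in> {0..1} \<longrightarrow> T y t = f t)))"

definition admissible_coding :: "(nat \<Rightarrow> cfun set \<Rightarrow> cfun) \<Rightarrow> bool" where
  "admissible_coding d \<longleftrightarrow>
     (\<forall>n. \<forall>U. cd_open U \<longrightarrow> {F \<in> SB. d n F \<in> U} \<in> effros_borel) \<and>
     (\<forall>n. \<forall>X\<in>SB. d n X \<in> X) \<and>
     (\<forall>X\<in>SB. \<forall>f\<in>X. \<forall>e>0. \<exists>n. supnorm (fdiff (d n X) f) < e) \<and>
     (\<forall>k m r q. r \<in> \<rat> \<and> q \<in> \<rat> \<longrightarrow>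
        (\<exists>n. \<forall>X\<in>SB. d n X = fadd (fscale r (d k X)) (fscale q (d m X))))"

definition codes :: "(nat \<Rightarrow> cfun set \<Rightarrow> cfun) \<Rightarrow> cfun set \<Rightarrow> cfun set \<Rightarrow> (nat \<Rightarrow> cfun)
    \<Rightarrow> (cfun \<Rightarrow> cfun) \<Rightarrow> bool" where
  "codes d X Y Ahat A \<longleftrightarrow> bounded_op X Y A \<and> (\<forall>n. A (d n X) = Ahat n)"

definition Lcal :: "(nat \<Rightarrow> cfun set \<Rightarrow> cfun) \<Rightarrow> (cfun set \<times> cfun set \<times> (nat \<Rightarrow> cfun)) set" where
  "Lcal d = {(X, Y, Ahat). X \<in> SB \<and> Y \<in> SB \<and> (\<forall>n. Ahat n \<in> CD) \<and>
                          (\<exists>A. codes d X Y Ahat A)}"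

definition W_SB_L1 :: "(nat \<Rightarrow> cfun set \<Rightarrow> cfun) \<Rightarrow> (cfun set \<times> cfun set \<times> (nat \<Rightarrow> cfun)) set" where
  "W_SB_L1 d = {(X, Y, Ahat). (X, Y, Ahat) \<in> Lcal d \<and> isomorphic_L1 Y \<and>
      (\<exists>A. codes d X Y Ahat A \<and> weakly_compact_op X Y A)}"

end

theory Submission
  imports Defs "HOL-Library.Nat_Bijection" "HOL-Library.Discrete_Functions"
begin

text \<open>
  A weakly compact subset of \<open>L1\<close> is uniformly integrable, so for suitable integers \<open>m n\<close> it lies, for
  every \<open>n\<close>, in \<open>m n\<close> times the unit ball of \<open>L2\<close> plus \<open>1 / 4 ^ n\<close> times the unit ball of \<open>L1\<close>. The
  Davis-Figiel-Johnson-Pelczynski interpolation space built from these data is reflexive and an operator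
  with that range factors through it, but it depends on the sequence \<open>m\<close>. If its \<open>n\<close>-th interpolation
  norm is applied only to the tail from \<open>n\<close> on of the Haar expansion, then the norm of a vector in the
  span of the first \<open>k\<close> Haar functions depends only on \<open>m 0, \<dots>, m (k - 1)\<close>. Hence these
  spaces are the branches of one space \<open>Z\<close> of functions on the tree of finite sequences of naturals,
  whose norm is an \<open>l2\<close> sum over the nodes of interpolation norms of the restrictions to the subtrees.

  \<open>Z\<close> is reflexive because its unit vectors are a monotone, shrinking and boundedly complete basis. For both
  properties, the parallelogram law in the outer \<open>l2\<close> sum shows that, up to a small error, finitely many
  nodes matter; at each of those, the interpolation norm splits a vector into a part bounded in a Hilbert space
  and a small one. \<open>Z\<close> is put into the continuous functions on the Cantor set by parametrising
  the unit ball of its dual, a compact subset of a product of intervals, by the Cantor set.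
\<close>

text \<open>No countable family of sequences \<open>m\<close> dominates all the others, so a
  countable sum of interpolation spaces prepared in advance cannot receive every operator. A tree
  offers uncountably many branches with countably many coordinates, and it works because the norm at
  a node uses only the label of that node, which all branches through it share. The Haar system is
  chosen because its partial sums are averages: they contract the \<open>L1\<close> and the sup
  norm. Hence cutting a segment out of a branch costs at most a factor 2 in \<open>L1\<close>, and a
  function bounded by \<open>m n\<close> has coefficients of Hilbert norm at most
  \<open>m n\<close>. The error \<open>1 / 4 ^ n\<close> beats the weight \<open>2 ^ n\<close> that
  the interpolation puts on the \<open>L1\<close> part, and the label \<open>m n * 2 ^ n\<close>
  makes the Hilbert part equally small, so the contributions of the nodes of the branch are
  summable. All norms are defined on finitely supported sequences; the completion is formed only as
  a closed subspace of the continuous functions.\<close>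

definition c00 :: "(nat \<Rightarrow> real) set" where
  "c00 = {x. \<exists>n. \<forall>k\<ge>n. x k = 0}"

definition trunc :: "nat \<Rightarrow> (nat \<Rightarrow> real) \<Rightarrow> nat \<Rightarrow> real" where
  "trunc n x = (\<lambda>k. if k < n then x k else 0)"

definition unit_seq :: "nat \<Rightarrow> nat \<Rightarrow> real" where
  "unit_seq v = (\<lambda>k. if k = v then 1 else 0)"

text \<open>Every linear functional on \<open>c00\<close> has this form, with \<open>\<phi>\<close>
  the sequence of its values at the unit vectors; functionals are therefore handled as
  sequences.\<close>

definition pair :: "(nat \<Rightarrow> real) \<Rightarrow> (nat \<Rightarrow> real) \<Rightarrow> real" where
  "pair \<phi> x = (\<Sum>k | x k \<noteq> 0. \<phi> k * x k)"

lemma c00I: "(\<And>k. n \<le> k \<Longrightarrow> x k = 0) \<Longrightarrow> x \<in> c00"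
  by (auto simp: c00_def)

lemma c00E:
  assumes "x \<in> c00"
  obtains n where "\<forall>k\<ge>n. x k = 0"
  using assms by (auto simp: c00_def)

lemma c00_add [intro, simp]:
  assumes "x \<in> c00" "y \<in> c00" shows "(\<lambda>k. x k + y k) \<in> c00"
proof -
  obtain m where m: "\<forall>k\<ge>m. x k = 0" using assms(1) by (rule c00E)
  obtain n where n: "\<forall>k\<ge>n. y k = 0" using assms(2) by (rule c00E)
  show ?thesis by (rule c00I[of "max m n"]) (auto simp: m n)
qed

lemma c00_mult [intro, simp]: "x \<in> c00 \<Longrightarrow> (\<lambda>k. a k * x k) \<in> c00"
  by (auto simp: c00_def)

lemma c00_diff [intro, simp]:
  assumes "x \<in> c00" "y \<in> c00" shows "(\<lambda>k. x k - y k) \<in> c00"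
  using c00_add[OF assms(1) c00_mult[OF assms(2), of "\<lambda>_. -1"]] by simp

lemma c00_divide [intro, simp]: "x \<in> c00 \<Longrightarrow> (\<lambda>k. x k / c) \<in> c00"
  by (auto simp: c00_def)

lemma c00_minus [intro, simp]: "x \<in> c00 \<Longrightarrow> (\<lambda>k. - x k) \<in> c00"
  by (auto simp: c00_def)

lemma c00_zero [simp]: "(\<lambda>_. 0) \<in> c00"
  by (auto simp: c00_def)

lemma c00_trunc [simp]: "trunc n x \<in> c00"
  by (auto simp: c00_def trunc_def intro!: exI[of _ n])

lemma c00_unit_seq [simp]: "unit_seq v \<in> c00"
  by (auto simp: c00_def unit_seq_def intro!: exI[of _ "Suc v"])

lemma c00_if [intro, simp]: "x \<in> c00 \<Longrightarrow> (\<lambda>k. if P k then x k else 0) \<in> c00"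
  by (auto simp: c00_def)

lemma c00_sum [intro, simp]:
  "(\<And>i. i \<in> I \<Longrightarrow> x i \<in> c00) \<Longrightarrow> (\<lambda>k. \<Sum>i\<in>I. x i k) \<in> c00"
  by (induction I rule: infinite_finite_induct) auto

lemma trunc_eq: "(\<And>k. n \<le> k \<Longrightarrow> x k = 0) \<Longrightarrow> trunc n x = x"
  by (auto simp: trunc_def fun_eq_iff)

lemma trunc_Suc: "trunc (Suc n) x = (\<lambda>k. trunc n x k + x n * unit_seq n k)"
  by (auto simp: trunc_def unit_seq_def fun_eq_iff less_Suc_eq)

lemma pair_eq:
  assumes "\<And>k. n \<le> k \<Longrightarrow> x k = 0"
  shows "pair \<phi> x = (\<Sum>k<n. \<phi> k * x k)"
  unfolding pair_def
  by (rule sum.mono_neutral_left) (use assms in \<open>auto, meson not_less\<close>)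

lemma pair_trunc: "pair \<phi> (trunc n x) = (\<Sum>k<n. \<phi> k * x k)"
proof -
  have "pair \<phi> (trunc n x) = (\<Sum>k<n. \<phi> k * trunc n x k)"
    by (rule pair_eq) (auto simp: trunc_def)
  then show ?thesis by (simp add: trunc_def)
qed

lemma pair_add:
  assumes "x \<in> c00" "y \<in> c00"
  shows "pair \<phi> (\<lambda>k. x k + y k) = pair \<phi> x + pair \<phi> y"
proof -
  obtain m where m: "\<forall>k\<ge>m. x k = 0" using assms(1) by (rule c00E)
  obtain n where n: "\<forall>k\<ge>n. y k = 0" using assms(2) by (rule c00E)
  note * = m n
  let ?n = "max m n"
  have "pair \<phi> x = (\<Sum>k<?n. \<phi> k * x k)" "pair \<phi> y = (\<Sum>k<?n. \<phi> k * y k)"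
    "pair \<phi> (\<lambda>k. x k + y k) = (\<Sum>k<?n. \<phi> k * (x k + y k))"
    by (rule pair_eq; use * in auto)+
  then show ?thesis by (simp add: sum.distrib distrib_left)
qed

lemma pair_scale:
  assumes "x \<in> c00"
  shows "pair \<phi> (\<lambda>k. c * x k) = c * pair \<phi> x"
proof -
  obtain n where *: "\<forall>k\<ge>n. x k = 0"
    using assms by (rule c00E)
  have "pair \<phi> x = (\<Sum>k<n. \<phi> k * x k)"
    "pair \<phi> (\<lambda>k. c * x k) = (\<Sum>k<n. \<phi> k * (c * x k))"
    by (rule pair_eq; use * in auto)+
  then show ?thesis by (simp add: sum_distrib_left mult_ac)
qed

lemma pair_unit_seq [simp]: "pair \<phi> (unit_seq v) = \<phi> v"
  by (subst pair_eq[of "Suc v"]) (auto simp: unit_seq_def)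

section \<open>Seminorms and the Hahn-Banach theorem on finitely supported sequences\<close>

definition seminorm00 :: "((nat \<Rightarrow> real) \<Rightarrow> real) \<Rightarrow> bool" where
  "seminorm00 p \<longleftrightarrow>
     (\<forall>x\<in>c00. \<forall>y\<in>c00. p (\<lambda>k. x k + y k) \<le> p x + p y) \<and>
     (\<forall>c. \<forall>x\<in>c00. p (\<lambda>k. c * x k) = \<bar>c\<bar> * p x)"

lemma seminorm00_add: "seminorm00 p \<Longrightarrow> x \<in> c00 \<Longrightarrow> y \<in> c00 \<Longrightarrow> p (\<lambda>k. x k + y k) \<le> p x + p y"
  by (simp add: seminorm00_def)

lemma seminorm00_scale: "seminorm00 p \<Longrightarrow> x \<in> c00 \<Longrightarrow> p (\<lambda>k. c * x k) = \<bar>c\<bar> * p x"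
  by (simp add: seminorm00_def)

lemma seminorm00_zero: "seminorm00 p \<Longrightarrow> p (\<lambda>_. 0) = 0"
  using seminorm00_scale[of p "\<lambda>_. 0" 0] by simp

lemma seminorm00_minus: "seminorm00 p \<Longrightarrow> x \<in> c00 \<Longrightarrow> p (\<lambda>k. - x k) = p x"
  using seminorm00_scale[of p x "-1"] by simp

lemma seminorm00_diff:
  assumes "seminorm00 p" "x \<in> c00" "y \<in> c00"
  shows "p (\<lambda>k. x k - y k) \<le> p x + p y"
  using seminorm00_add[OF assms(1,2), of "\<lambda>k. - y k"] seminorm00_minus[OF assms(1,3)] assms(3)
  by simp

lemma seminorm00_nonneg:
  assumes "seminorm00 p" "x \<in> c00" shows "0 \<le> p x"
  using seminorm00_diff[OF assms(1,2,2)] seminorm00_zero[OF assms(1)] by simp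

lemma seminorm00_sum:
  assumes p: "seminorm00 p" and "\<And>i. i \<in> I \<Longrightarrow> x i \<in> c00"
  shows "p (\<lambda>k. \<Sum>i\<in>I. x i k) \<le> (\<Sum>i\<in>I. p (x i))"
  using assms(2)
proof (induction I rule: infinite_finite_induct)
  case (insert i I)
  have "p (\<lambda>k. x i k + (\<Sum>j\<in>I. x j k)) \<le> p (x i) + p (\<lambda>k. \<Sum>j\<in>I. x j k)"
    using insert.prems by (intro seminorm00_add[OF p] c00_sum) auto
  also have "\<dots> \<le> p (x i) + (\<Sum>j\<in>I. p (x j))"
    using insert.IH insert.prems by simp
  finally show ?case using insert.hyps by simp
qed (simp_all add: seminorm00_zero[OF p])

definition sublinear00 :: "((nat \<Rightarrow> real) \<Rightarrow> real) \<Rightarrow> bool" where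
  "sublinear00 q \<longleftrightarrow>
     (\<forall>x\<in>c00. \<forall>y\<in>c00. q (\<lambda>k. x k + y k) \<le> q x + q y) \<and>
     (\<forall>c\<ge>0. \<forall>x\<in>c00. q (\<lambda>k. c * x k) = c * q x)"

text \<open>Among the sublinear functionals below \<open>q\<close> with the value \<open>q z\<close> at \<open>z\<close>, the largest one that is linear
  on the line through \<open>z\<close>.\<close>
definition linearize :: "((nat \<Rightarrow> real) \<Rightarrow> real) \<Rightarrow> (nat \<Rightarrow> real) \<Rightarrow> (nat \<Rightarrow> real) \<Rightarrow> real" where
  "linearize q z y = (INF t\<in>{0..}. q (\<lambda>k. y k + t * z k) - t * q z)"

context
  fixes q z assumes q: "sublinear00 q" and z: "z \<in> c00"
begin

private lemma add: "x \<in> c00 \<Longrightarrow> y \<in> c00 \<Longrightarrow> q (\<lambda>k. x k + y k) \<le> q x + q y"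
  and scale: "0 \<le> c \<Longrightarrow> x \<in> c00 \<Longrightarrow> q (\<lambda>k. c * x k) = c * q x"
  using q by (auto simp: sublinear00_def)

private lemma bdd: "y \<in> c00 \<Longrightarrow> 0 \<le> t \<Longrightarrow> - q (\<lambda>k. - y k) \<le> q (\<lambda>k. y k + t * z k) - t * q z"
  using add[of "\<lambda>k. y k + t * z k" "\<lambda>k. - y k"] scale[of t z] z by simp

private lemma lin_le: "y \<in> c00 \<Longrightarrow> 0 \<le> t \<Longrightarrow> linearize q z y \<le> q (\<lambda>k. y k + t * z k) - t * q z"
  unfolding linearize_def by (rule cINF_lower) (auto intro!: bdd_belowI2 bdd)

lemma linearize_le: "y \<in> c00 \<Longrightarrow> linearize q z y \<le> q y"
  using lin_le[of y 0] by simp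

lemma linearize_minus_le: "linearize q z (\<lambda>k. - z k) \<le> - q z"
  using lin_le[of "\<lambda>k. - z k" 1] scale[of 0 z] z by simp

private lemma lin_ge: "(\<And>t. 0 \<le> t \<Longrightarrow> c \<le> q (\<lambda>k. y k + t * z k) - t * q z) \<Longrightarrow> c \<le> linearize q z y"
  unfolding linearize_def by (rule cINF_greatest) auto

lemma sublinear00_linearize: "sublinear00 (linearize q z)"
  unfolding sublinear00_def
proof (intro conjI ballI allI impI)
  fix x y :: "nat \<Rightarrow> real" assume x: "x \<in> c00" and y: "y \<in> c00"
  have *: "linearize q z (\<lambda>k. x k + y k) \<le>
      (q (\<lambda>k. x k + s * z k) - s * q z) + (q (\<lambda>k. y k + t * z k) - t * q z)"
    if "0 \<le> s" "0 \<le> t" for s t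
  proof -
    have "linearize q z (\<lambda>k. x k + y k) \<le> q (\<lambda>k. (x k + y k) + (s + t) * z k) - (s + t) * q z"
      using that x y by (intro lin_le) auto
    also have "(\<lambda>k. (x k + y k) + (s + t) * z k) = (\<lambda>k. (x k + s * z k) + (y k + t * z k))"
      by (auto simp: algebra_simps)
    also have "q \<dots> \<le> q (\<lambda>k. x k + s * z k) + q (\<lambda>k. y k + t * z k)"
      using x y z by (intro add) auto
    finally show ?thesis by (simp add: algebra_simps)
  qed
  have "linearize q z (\<lambda>k. x k + y k) - (q (\<lambda>k. x k + s * z k) - s * q z) \<le> linearize q z y"
    if "0 \<le> s" for s
    using *[OF that] by (intro lin_ge) (auto simp: algebra_simps)
  then have "linearize q z (\<lambda>k. x k + y k) - linearize q z y \<le> linearize q z x"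
    by (intro lin_ge) (auto simp: algebra_simps)
  then show "linearize q z (\<lambda>k. x k + y k) \<le> linearize q z x + linearize q z y" by simp
next
  fix c :: real and x :: "nat \<Rightarrow> real" assume c: "0 \<le> c" and x: "x \<in> c00"
  show "linearize q z (\<lambda>k. c * x k) = c * linearize q z x"
  proof (cases "c = 0")
    case True
    have q0: "q (\<lambda>_. 0) = 0" using scale[of 0 z] z by simp
    have "linearize q z (\<lambda>_. 0) \<le> 0" using linearize_le[of "\<lambda>_. 0"] q0 by simp
    moreover have "0 \<le> linearize q z (\<lambda>_. 0)"
      using scale z by (intro lin_ge) auto
    ultimately show ?thesis using True by simp
  next
    case False
    then have c: "0 < c" using c by simp
    have *: "q (\<lambda>k. c * x k + t * z k) - t * q z = c * (q (\<lambda>k. x k + t / c * z k) - t / c * q z)"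
      for t
    proof -
      have "(\<lambda>k. c * x k + t * z k) = (\<lambda>k. c * (x k + t / c * z k))"
        using c by (auto simp: field_simps)
      then show ?thesis using scale[of c "\<lambda>k. x k + t / c * z k"] c x z
        by (auto simp: algebra_simps)
    qed
    have "c * linearize q z x \<le> linearize q z (\<lambda>k. c * x k)"
    proof (rule lin_ge)
      fix t :: real assume "0 \<le> t"
      then show "c * linearize q z x \<le> q (\<lambda>k. c * x k + t * z k) - t * q z"
        unfolding * using c by (intro mult_left_mono lin_le x) auto
    qed
    moreover have "linearize q z (\<lambda>k. c * x k) / c \<le> linearize q z x"
    proof (rule lin_ge)
      fix t :: real assume "0 \<le> t"
      then have "linearize q z (\<lambda>k. c * x k) \<le> q (\<lambda>k. c * x k + (c * t) * z k) - (c * t) * q z"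
        using c x by (intro lin_le) auto
      then show "linearize q z (\<lambda>k. c * x k) / c \<le> q (\<lambda>k. x k + t * z k) - t * q z"
        unfolding * using c by (simp add: field_simps)
    qed
    ultimately show ?thesis using c by (simp add: field_simps)
  qed
qed

end

text \<open>The assumption \<open>lin\<close> makes \<open>q\<close> odd, hence linear, on the line
  through \<open>z\<close>; subadditivity used for adding and for removing \<open>c * z\<close> then
  gives both inequalities.\<close>

lemma sublinear00_add_line:
  assumes q: "sublinear00 q" and z: "z \<in> c00" and y: "y \<in> c00"
    and lin: "q (\<lambda>k. - z k) \<le> - q z"
  shows "q (\<lambda>k. y k + c * z k) = q y + c * q z"
proof -
  have add: "q (\<lambda>k. x k + y k) \<le> q x + q y" if "x \<in> c00" "y \<in> c00" for x y
    using q that by (auto simp: sublinear00_def)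
  have scale: "q (\<lambda>k. c * x k) = c * q x" if "0 \<le> c" "x \<in> c00" for c x
    using q that by (auto simp: sublinear00_def)
  have "0 \<le> q z + q (\<lambda>k. - z k)"
    using add[of z "\<lambda>k. - z k"] scale[of 0 z] z by simp
  with lin have neg: "q (\<lambda>k. - z k) = - q z" by simp
  have sc: "q (\<lambda>k. c * z k) = c * q z" for c
  proof (cases "0 \<le> c")
    case False
    then show ?thesis using scale[of "-c" "\<lambda>k. - z k"] z neg by simp
  qed (simp add: scale z)
  have "q (\<lambda>k. y k + c * z k) \<le> q y + c * q z"
    using add[of y "\<lambda>k. c * z k"] sc y z by simp
  moreover have "q y \<le> q (\<lambda>k. y k + c * z k) + (- c) * q z"
    using add[of "\<lambda>k. y k + c * z k" "\<lambda>k. (- c) * z k"] sc[of "- c"] y z by simp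
  ultimately show ?thesis by simp
qed

text \<open>The unit vectors are a countable algebraic basis, so an induction suffices: linearise
  along \<open>x\<close>, then along each unit vector in turn. The functionals decrease, and on a
  vector supported below \<open>n\<close> the \<open>n\<close>-th one is already linear.\<close>

theorem hahn_banach_c00:
  assumes p: "seminorm00 p" and x: "x \<in> c00"
  obtains \<phi> where "\<And>y. y \<in> c00 \<Longrightarrow> pair \<phi> y \<le> p y" "pair \<phi> x = p x"
proof -
  have p': "sublinear00 p" using p by (auto simp: sublinear00_def seminorm00_def)
  define Q where "Q = rec_nat (linearize p x) (\<lambda>n q. linearize q (unit_seq n))"
  have Q0: "Q 0 = linearize p x" and QS: "Q (Suc n) = linearize (Q n) (unit_seq n)" for n
    by (simp_all add: Q_def)
  have sub: "sublinear00 (Q n)" for n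
    by (induction n) (auto simp: Q0 QS intro!: sublinear00_linearize p' x)
  have dec: "Q (n + m) y \<le> Q n y" if "y \<in> c00" for n m y
  proof (induction m)
    case (Suc m)
    have "Q (n + Suc m) y \<le> Q (n + m) y"
      using linearize_le[OF sub[of "n + m"] c00_unit_seq[of "n + m"] that] QS by simp
    then show ?case using Suc by simp
  qed simp
  have neg: "- q y \<le> q (\<lambda>k. - y k)" if "y \<in> c00" "sublinear00 q" for y q
  proof -
    have "q (\<lambda>k. y k + - y k) \<le> q y + q (\<lambda>k. - y k)"
      using that(2) bspec[OF bspec[OF conjunct1[OF that(2)[unfolded sublinear00_def]] that(1)] c00_minus[OF that(1)]]
      by simp
    moreover have "q (\<lambda>k. 0 * y k) = 0 * q y"
      using spec[OF conjunct2[OF that(2)[unfolded sublinear00_def]], of 0, rule_format, OF order_refl that(1)]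
      by simp
    ultimately show ?thesis by simp
  qed
  \<comment> \<open>A line on which the functional is odd stays frozen: later functionals are
    smaller at both \<open>z\<close> and \<open>- z\<close>, and sublinearity keeps the sum of these
    two values nonnegative.\<close>
  have fix_line: "Q (n + m) z = Q n z \<and> Q (n + m) (\<lambda>k. - z k) \<le> - Q (n + m) z"
    if z: "z \<in> c00" "Q n (\<lambda>k. - z k) \<le> - Q n z" for n m z
    using dec[OF z(1), of n m] dec[OF c00_minus[OF z(1)], of n m] neg[OF z(1) sub[of "n + m"]] z(2)
    by linarith
  have x_eq: "Q m x = p x" for m
  proof -
    have "Q 0 (\<lambda>k. - x k) \<le> - p x"
      unfolding Q0 by (rule linearize_minus_le[OF p' x])
    moreover have "Q 0 x \<le> p x"
      unfolding Q0 by (rule linearize_le[OF p' x x])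
    moreover have "- Q 0 x \<le> Q 0 (\<lambda>k. - x k)" by (rule neg[OF x sub])
    ultimately show ?thesis using fix_line[OF x, of 0 m] by simp
  qed
  define \<phi> where "\<phi> k = Q (Suc k) (unit_seq k)" for k
  have unit: "Q m (unit_seq n) = \<phi> n \<and> Q m (\<lambda>k. - unit_seq n k) \<le> - Q m (unit_seq n)"
    if "Suc n \<le> m" for n m
  proof -
    have "Q (Suc n) (\<lambda>k. - unit_seq n k) \<le> - Q n (unit_seq n)"
      unfolding QS by (rule linearize_minus_le) (auto intro: sub)
    also have "\<dots> \<le> - Q (Suc n) (unit_seq n)"
      using dec[of "unit_seq n" n 1] by simp
    finally show ?thesis
      using fix_line[of "unit_seq n" "Suc n" "m - Suc n"] that by (simp add: \<phi>_def)
  qed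
  have lin: "Q m (trunc n y) = (\<Sum>k<n. \<phi> k * y k)" if "n \<le> m" for m n y
    using that
  proof (induction n)
    case 0
    have "Q m (\<lambda>k. 0 * y k) = 0"
      using spec[OF conjunct2[OF sub[of m, unfolded sublinear00_def]], of 0, rule_format, OF order_refl c00_zero]
      by simp
    then show ?case by (simp add: trunc_def)
  next
    case (Suc n)
    then have "Q m (trunc (Suc n) y) = Q m (trunc n y) + y n * Q m (unit_seq n)"
      unfolding trunc_Suc using unit[of n m]
      by (intro sublinear00_add_line sub) auto
    then show ?case using Suc unit[of n m] by (simp add: mult.commute)
  qed
  have pr: "\<exists>m. pair \<phi> y = Q m y" if "y \<in> c00" for y
  proof -
    obtain n where n: "\<forall>k\<ge>n. y k = 0" using \<open>y \<in> c00\<close> by (rule c00E)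
    then have "trunc n y = y" by (intro trunc_eq) auto
    then have "pair \<phi> y = Q n y" using lin[of n n y] pair_trunc[of \<phi> n y] by simp
    then show ?thesis ..
  qed
  show thesis
  proof
    fix y assume y: "y \<in> c00"
    then obtain m where "pair \<phi> y = Q m y" using pr by blast
    also have "\<dots> \<le> Q 0 y" using dec[OF y, of 0 m] by simp
    also have "\<dots> \<le> p y" unfolding Q0 by (rule linearize_le[OF p' x y])
    finally show "pair \<phi> y \<le> p y" .
  next
    show "pair \<phi> x = p x" using pr[OF x] x_eq by auto
  qed
qed

text \<open>A product of compact intervals is compact, and sequentially so because a countable
  product of lines is first countable.\<close>

lemma pointwise_convergent_subseq:
  fixes x :: "nat \<Rightarrow> nat \<Rightarrow> real"
  assumes "\<And>n k. \<bar>x n k\<bar> \<le> c k"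
  obtains r l where "strict_mono r" "\<And>k. (\<lambda>n. x (r n) k) \<longlonglongrightarrow> l k"
proof -
  have "compactin (product_topology (\<lambda>_. euclidean) UNIV) (PiE UNIV (\<lambda>k. {- c k..c k}))"
    by (subst compactin_PiE) auto
  then have "compact (PiE UNIV (\<lambda>k. {- c k..c k}))"
    by (simp add: euclidean_product_topology)
  then have "seq_compact (PiE UNIV (\<lambda>k. {- c k..c k}))"
    by (rule compact_imp_seq_compact)
  moreover have "\<forall>n. x n \<in> PiE UNIV (\<lambda>k. {- c k..c k})"
    using assms by (auto simp: PiE_def abs_le_iff minus_le_iff)
  ultimately obtain l r where r: "strict_mono r" and l: "(x \<circ> r) \<longlonglongrightarrow> l"
    by (meson seq_compactE)
  have "(\<lambda>n. x (r n) k) \<longlonglongrightarrow> l k" for k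
  proof -
    have "isCont (\<lambda>f::nat \<Rightarrow> real. f k) l"
      using continuous_on_product_coordinates[of k]
        continuous_on_eq_continuous_at[of UNIV "\<lambda>f::nat \<Rightarrow> real. f k"] by blast
    then show ?thesis using l by (auto dest: isCont_tendsto_compose simp: o_def)
  qed
  with r that show thesis by blast
qed

subsection \<open>The Cantor set\<close>

text \<open>Common form of the ternary expansion of the points of the Cantor set and of the binary
  expansion of reals.\<close>

definition bit_series :: "real \<Rightarrow> real \<Rightarrow> (nat \<Rightarrow> bool) \<Rightarrow> real" where
  "bit_series a q b = (\<Sum>n. (if b n then a else 0) / q ^ Suc n)"

context
  fixes a q :: real
  assumes q: "1 < q" and a: "0 \<le> a" "a \<le> q - 1"
begin

private lemma gs: "(\<lambda>n. a / q ^ Suc n) sums (a / (q - 1))"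
proof -
  have "(\<lambda>n. (a / q) * (1 / q) ^ n) sums ((a / q) * (1 / (1 - 1 / q)))"
    using q by (intro sums_mult geometric_sums) auto
  moreover have "(a / q) * (1 / (1 - 1 / q)) = a / (q - 1)"
    using q by (simp add: divide_simps)
  moreover have "(\<lambda>n. (a / q) * (1 / q) ^ n) = (\<lambda>n. a / q ^ Suc n)"
    by (simp add: power_divide)
  ultimately show ?thesis by metis
qed

lemma bit_series_summable: "summable (\<lambda>n. (if b n then a else 0) / q ^ Suc n)"
  by (rule summable_comparison_test'[OF sums_summable[OF gs], of 0])
    (use q a in \<open>auto simp: divide_right_mono\<close>)

lemma bit_series_nonneg: "0 \<le> bit_series a q b"
  unfolding bit_series_def by (rule suminf_nonneg[OF bit_series_summable]) (use q a in auto)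

lemma bit_series_le_1: "bit_series a q b \<le> 1"
proof -
  have "bit_series a q b \<le> (\<Sum>n. a / q ^ Suc n)"
    unfolding bit_series_def
    by (rule suminf_le[OF _ bit_series_summable sums_summable[OF gs]]) (use q a in auto)
  also have "\<dots> = a / (q - 1)" using gs by (rule sums_unique[symmetric])
  also have "\<dots> \<le> 1" using q a by simp
  finally show ?thesis .
qed

lemma bit_series_split:
  "bit_series a q b = (\<Sum>n<N. (if b n then a else 0) / q ^ Suc n) + bit_series a q (\<lambda>n. b (n + N)) / q ^ N"
proof -
  have "bit_series a q (\<lambda>n. b (n + N)) / q ^ N
     = (\<Sum>n. (if b (n + N) then a else 0) / q ^ Suc n / q ^ N)"
    unfolding bit_series_def by (rule suminf_divide[symmetric, OF bit_series_summable])
  also have "\<dots> = (\<Sum>n. (if b (n + N) then a else 0) / q ^ Suc (n + N))"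
    by (simp add: power_add mult_ac)
  finally show ?thesis
    unfolding bit_series_def using suminf_split_initial_segment[OF bit_series_summable, of b N] by simp
qed

lemma bit_series_near:
  assumes "\<And>n. n < N \<Longrightarrow> b n = b' n"
  shows "\<bar>bit_series a q b - bit_series a q b'\<bar> \<le> 1 / q ^ N"
proof -
  let ?s = "\<lambda>b. bit_series a q (\<lambda>n. b (n + N))"
  have "bit_series a q b - bit_series a q b' = (?s b - ?s b') / q ^ N"
    using bit_series_split[of b N] bit_series_split[of b' N] assms by (simp add: diff_divide_distrib)
  moreover have "\<bar>?s b - ?s b'\<bar> \<le> 1"
    using bit_series_nonneg[of "\<lambda>n. b (n + N)"] bit_series_le_1[of "\<lambda>n. b (n + N)"]
      bit_series_nonneg[of "\<lambda>n. b' (n + N)"] bit_series_le_1[of "\<lambda>n. b' (n + N)"] by simp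
  ultimately show ?thesis using q by (simp add: divide_right_mono)
qed

end

abbreviation "ternary \<equiv> bit_series 2 3"
abbreviation "dyadic \<equiv> bit_series 1 2"

text \<open>The first different digit contributes \<open>2 / 3 ^ Suc N\<close>, and the remaining
  digits can take back at most half of that.\<close>

lemma ternary_separated:
  assumes "\<And>n. n < N \<Longrightarrow> b n = b' n" "b N \<noteq> b' N"
  shows "1 / 3 ^ Suc N \<le> \<bar>ternary b - ternary b'\<bar>"
proof -
  have *: "1 / 3 ^ Suc N \<le> ternary b - ternary b'"
    if "\<And>n. n < N \<Longrightarrow> b n = b' n" "b N" "\<not> b' N" for b b'
  proof -
    let ?s = "\<lambda>b. ternary (\<lambda>n. b (n + Suc N))"
    have "ternary b - ternary b' = 2 / 3 ^ Suc N + (?s b - ?s b') / 3 ^ Suc N"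
      using bit_series_split[of 3 2 b "Suc N"] bit_series_split[of 3 2 b' "Suc N"] that
      by (simp add: diff_divide_distrib)
    also have "\<dots> = (2 + (?s b - ?s b')) / 3 ^ Suc N" by (simp add: add_divide_distrib)
    also have "1 / 3 ^ Suc N \<le> \<dots>"
      using bit_series_nonneg[of 3 2 "\<lambda>n. b (n + Suc N)"] bit_series_le_1[of 3 2 "\<lambda>n. b' (n + Suc N)"]
      by (intro divide_right_mono) auto
    finally show ?thesis .
  qed
  show ?thesis
  proof (cases "b N")
    case True
    then show ?thesis using *[of b b'] assms by fastforce
  next
    case False
    then show ?thesis using *[of b' b] assms by (fastforce simp: abs_minus_commute)
  qed
qed

lemma ternary_agree:
  assumes "\<bar>ternary b - ternary b'\<bar> < 1 / 3 ^ N" "n < N"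
  shows "b n = b' n"
proof (rule ccontr)
  assume "b n \<noteq> b' n"
  define m where "m = (LEAST m. b m \<noteq> b' m)"
  have m: "b m \<noteq> b' m" "\<And>k. k < m \<Longrightarrow> b k = b' k" "m \<le> n"
    using LeastI[of "\<lambda>m. b m \<noteq> b' m", OF \<open>b n \<noteq> b' n\<close>]
      not_less_Least[of _ "\<lambda>m. b m \<noteq> b' m"] Least_le[of "\<lambda>m. b m \<noteq> b' m", OF \<open>b n \<noteq> b' n\<close>]
    unfolding m_def by blast+
  have "1 / 3 ^ N \<le> (1::real) / 3 ^ Suc m"
    using m(3) assms(2) by (intro divide_left_mono power_increasing) auto
  with ternary_separated[of m b b'] m assms(1) show False by auto
qed

lemma inj_ternary: "inj ternary"
proof (rule injI, rule ext)
  fix b b' n assume "ternary b = ternary b'"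
  then show "b n = b' n" using ternary_agree[of b b' "Suc n" n] by simp
qed

lemma cantor_eq: "cantor = range ternary"
  by (auto simp: cantor_def bit_series_def)

definition digits :: "real \<Rightarrow> nat \<Rightarrow> bool" where
  "digits = the_inv ternary"

lemma digits_ternary [simp]: "digits (ternary b) = b"
  unfolding digits_def by (rule the_inv_f_f[OF inj_ternary])

text \<open>A subsequence converges digit by digit. Limits of digits are 0 or 1, so each digit is
  eventually constant, and agreement on a long prefix means closeness of the points.\<close>

lemma compact_cantor: "compact cantor"
  unfolding seq_compact_eq_compact[symmetric]
proof (rule seq_compactI)
  fix t :: "nat \<Rightarrow> real" assume t: "\<forall>n. t n \<in> cantor"
  define x :: "nat \<Rightarrow> nat \<Rightarrow> real" where "x n k = (if digits (t n) k then 1 else 0)" for n k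
  obtain r l where r: "strict_mono r" and l: "\<And>k. (\<lambda>n. x (r n) k) \<longlonglongrightarrow> l k"
    by (rule pointwise_convergent_subseq[of x "\<lambda>_. 1"]) (auto simp: x_def)
  define b where "b k \<longleftrightarrow> 1 / 2 < l k" for k
  have ev: "eventually (\<lambda>n. digits (t (r n)) k = b k) sequentially" for k
  proof -
    have "l k = 0 \<or> l k = 1"
    proof -
      have "l k \<in> {0, 1}"
        by (rule Lim_in_closed_set[OF _ _ _ l]) (auto simp: x_def)
      then show ?thesis by simp
    qed
    moreover have "eventually (\<lambda>n. dist (x (r n) k) (l k) < 1/2) sequentially"
      using l by (rule tendstoD) simp
    ultimately show ?thesis
      by (auto elim!: eventually_mono simp: b_def x_def dist_real_def split: if_splits)
  qed
  have "(\<lambda>n. t (r n)) \<longlonglongrightarrow> ternary b"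
  proof (rule LIMSEQ_I)
    fix e :: real assume "0 < e"
    then obtain N where N: "(1/3) ^ N < e" using real_arch_pow_inv[of e "1/3"] by auto
    have "eventually (\<lambda>n. \<forall>k<N. digits (t (r n)) k = b k) sequentially"
      using ev by (intro eventually_ball_finite[of "{..<N}", simplified lessThan_iff Ball_def])
        (auto simp: Ball_def intro: eventually_mono)
    then obtain n0 where n0: "\<And>n k. n0 \<le> n \<Longrightarrow> k < N \<Longrightarrow> digits (t (r n)) k = b k"
      by (auto simp: eventually_sequentially)
    show "\<exists>n0. \<forall>n\<ge>n0. norm (t (r n) - ternary b) < e"
    proof (intro exI allI impI)
      fix n assume n: "n0 \<le> n"
      have "t (r n) \<in> cantor" using t by blast
      then have "t (r n) = ternary (digits (t (r n)))" by (auto simp: cantor_eq)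
      then have "\<bar>t (r n) - ternary b\<bar> \<le> 1 / 3 ^ N"
        using bit_series_near[of 3 2 N "digits (t (r n))" b] n0[OF n] by simp
      then show "norm (t (r n) - ternary b) < e" using N by (simp add: power_one_over)
    qed
  qed
  with r show "\<exists>l\<in>cantor. \<exists>r. strict_mono r \<and> (t \<circ> r) \<longlonglongrightarrow> l"
    by (auto simp: cantor_eq o_def)
qed

lemma cantor_nonempty: "cantor \<noteq> {}"
  by (auto simp: cantor_eq)

text \<open>The digit at \<open>j\<close> is the parity of the integer part of
  \<open>2 ^ Suc j * y\<close>; the partial sums are then the integer part of
  \<open>2 ^ n * y\<close> divided by \<open>2 ^ n\<close>. The bound \<open>y < 1\<close> starts
  this induction with integer part 0.\<close>

lemma dyadic_surj:
  assumes "0 \<le> y" "y < 1"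
  shows "\<exists>b. dyadic b = y"
proof
  define b where "b j = odd \<lfloor>2 ^ Suc j * y\<rfloor>" for j
  have fl: "\<lfloor>2 ^ Suc n * y\<rfloor> = 2 * \<lfloor>2 ^ n * y\<rfloor> + (if b n then 1 else 0)" for n
  proof -
    have "\<lfloor>2 ^ Suc n * y\<rfloor> div 2 = \<lfloor>2 ^ n * y\<rfloor>"
      using floor_divide_real_eq_div[of 2 "2 ^ Suc n * y"] by simp
    then have "\<lfloor>2 ^ Suc n * y\<rfloor> = 2 * \<lfloor>2 ^ n * y\<rfloor> + \<lfloor>2 ^ Suc n * y\<rfloor> mod 2"
      using mult_div_mod_eq[of 2 "\<lfloor>2 ^ Suc n * y\<rfloor>"] by presburger
    moreover have "\<lfloor>2 ^ Suc n * y\<rfloor> mod 2 = (if b n then 1 else 0)"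
      unfolding b_def by presburger
    ultimately show ?thesis by simp
  qed
  have part: "(\<Sum>j<n. (if b j then 1 else 0) / 2 ^ Suc j) = \<lfloor>2 ^ n * y\<rfloor> / 2 ^ n" for n
  proof (induction n)
    case 0
    show ?case using assms by (simp add: floor_eq_iff)
  next
    case (Suc n)
    have "(\<lfloor>2 ^ Suc n * y\<rfloor> :: real) / 2 ^ Suc n = \<lfloor>2 ^ n * y\<rfloor> / 2 ^ n + (if b n then 1 else 0) / 2 ^ Suc n"
      unfolding fl by (simp add: field_simps)
    then show ?case using Suc by simp
  qed
  have "\<bar>dyadic b - y\<bar> \<le> 2 * (1/2) ^ n" for n
  proof -
    have "dyadic b = \<lfloor>2 ^ n * y\<rfloor> / 2 ^ n + dyadic (\<lambda>j. b (j + n)) / 2 ^ n"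
      using bit_series_split[of 2 1 b n] part[of n] by simp
    moreover have "y = (2 ^ n * y) / 2 ^ n" by simp
    ultimately have "dyadic b - y = (\<lfloor>2 ^ n * y\<rfloor> - 2 ^ n * y + dyadic (\<lambda>j. b (j + n))) / 2 ^ n"
      by (simp add: add_divide_distrib diff_divide_distrib)
    moreover have "\<bar>\<lfloor>2 ^ n * y\<rfloor> - 2 ^ n * y + dyadic (\<lambda>j. b (j + n))\<bar> \<le> 2"
      using bit_series_nonneg[of 2 1 "\<lambda>j. b (j + n)"] bit_series_le_1[of 2 1 "\<lambda>j. b (j + n)"] by linarith
    ultimately show ?thesis by (simp add: divide_right_mono power_one_over)
  qed
  moreover have "(\<lambda>n. 2 * (1/2::real) ^ n) \<longlonglongrightarrow> 2 * 0"
    by (intro tendsto_intros) auto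
  ultimately have "\<bar>dyadic b - y\<bar> \<le> 2 * 0"
    by (intro LIMSEQ_le_const[of "\<lambda>n. 2 * (1/2::real) ^ n"]) auto
  then show "dyadic b = y" by simp
qed

subsection \<open>Continuous images of the Cantor set\<close>

text \<open>A retraction of the space of bit sequences onto the closed set \<open>F\<close>: follow \<open>b\<close> as long as
  some point of \<open>F\<close> continues the prefix read so far, and flip the bit otherwise.\<close>

primrec retract_prefix :: "(nat \<Rightarrow> bool) set \<Rightarrow> (nat \<Rightarrow> bool) \<Rightarrow> nat \<Rightarrow> nat \<Rightarrow> bool" where
  "retract_prefix F b 0 = (\<lambda>_. False)"
| "retract_prefix F b (Suc n) = (retract_prefix F b n)
     (n := (if \<exists>f\<in>F. (\<forall>i<n. f i = retract_prefix F b n i) \<and> f n = b n then b n else \<not> b n))"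

definition bit_retract :: "(nat \<Rightarrow> bool) set \<Rightarrow> (nat \<Rightarrow> bool) \<Rightarrow> nat \<Rightarrow> bool" where
  "bit_retract F b n = retract_prefix F b (Suc n) n"

lemma retract_prefix_eq: "i < n \<Longrightarrow> retract_prefix F b n i = bit_retract F b i"
proof (induction n)
  case (Suc n)
  show ?case
  proof (cases "i = n")
    case True
    then show ?thesis unfolding bit_retract_def by (rule ssubst) (rule refl)
  next
    case False
    then have "retract_prefix F b (Suc n) i = retract_prefix F b n i" by simp
    then show ?thesis using Suc False by simp
  qed
qed simp

text \<open>If the bit \<open>b n\<close> is rejected, the point of \<open>F\<close> that continues
  the old prefix must have the flipped bit.\<close>

lemma retract_prefix_extends:
  assumes "F \<noteq> {}"
  shows "\<exists>f\<in>F. \<forall>i<n. f i = retract_prefix F b n i"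
proof (induction n)
  case (Suc n)
  then obtain f where f: "f \<in> F" "\<forall>i<n. f i = retract_prefix F b n i" by blast
  show ?case
  proof (cases "\<exists>f\<in>F. (\<forall>i<n. f i = retract_prefix F b n i) \<and> f n = b n")
    case True
    then show ?thesis by (auto simp: less_Suc_eq)
  next
    case False
    then have "f n = (\<not> b n)" using f by blast
    with f False show ?thesis by (auto simp: less_Suc_eq intro!: bexI[of _ f])
  qed
qed (use assms in auto)

lemma bit_retract_extends:
  "F \<noteq> {} \<Longrightarrow> \<exists>f\<in>F. \<forall>i<n. f i = bit_retract F b i"
  using retract_prefix_extends[of F n b] retract_prefix_eq[of _ n F b] by auto

lemma bit_retract_id:
  assumes "b \<in> F" shows "bit_retract F b = b"
proof -
  have "\<forall>i<n. retract_prefix F b n i = b i" for n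
  proof (induction n)
    case (Suc n)
    then have "\<exists>f\<in>F. (\<forall>i<n. f i = retract_prefix F b n i) \<and> f n = b n"
      using assms by (intro bexI[of _ b]) auto
    then show ?case using Suc by (auto simp: less_Suc_eq)
  qed simp
  then show ?thesis by (auto simp: fun_eq_iff bit_retract_def simp del: retract_prefix.simps)
qed

text \<open>This is the continuity of the retraction: the first \<open>n\<close> bits of the result
  are read off from the first \<open>n\<close> bits of \<open>b\<close>.\<close>

lemma bit_retract_agree:
  assumes "\<And>i. i < n \<Longrightarrow> b i = b' i" "i < n"
  shows "bit_retract F b i = bit_retract F b' i"
proof -
  have "retract_prefix F b m = retract_prefix F b' m" if "m \<le> n" for m
    using that by (induction m) (auto simp: assms(1))
  then show ?thesis using assms(2) by (simp add: bit_retract_def del: retract_prefix.simps)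
qed

text \<open>By the pairing function one bit sequence encodes a binary expansion for every
  coordinate, which maps bit sequences continuously onto a product of intervals that contains
  \<open>D\<close>. Composing with the retraction onto the preimage \<open>F\<close> of
  \<open>D\<close> makes the image exactly \<open>D\<close>.\<close>

theorem cantor_parametrization:
  fixes D :: "(nat \<Rightarrow> real) set" and c :: "nat \<Rightarrow> real"
  assumes ne: "D \<noteq> {}"
    and c: "\<And>\<phi> k. \<phi> \<in> D \<Longrightarrow> \<bar>\<phi> k\<bar> \<le> c k"
    and closed: "\<And>s l. (\<And>n. s n \<in> D) \<Longrightarrow> (\<And>k. (\<lambda>n. s n k) \<longlonglongrightarrow> l k) \<Longrightarrow> l \<in> D"
  obtains g :: "real \<Rightarrow> nat \<Rightarrow> real"
    where "\<forall>k. continuous_on cantor (\<lambda>t. g t k)" "g ` cantor = D"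
proof -
  \<comment> \<open>Coordinate \<open>k\<close> runs over an interval twice as long as that of
    radius \<open>1 + c k\<close>, so the binary fractions needed for points of \<open>D\<close> lie
    between 1/4 and 3/4, away from the excluded value 1. The summand 1 keeps the scale positive when
    \<open>c k = 0\<close>.\<close>
  define x where "x b k = (1 + c k) * (4 * dyadic (\<lambda>j. b (prod_encode (k, j))) - 2)" for b k
  define F where "F = {b. x b \<in> D}"
  have c_nn: "0 \<le> c k" for k using ne c[of _ k] by (metis abs_ge_zero ex_in_conv order_trans)
  have near: "\<bar>x b k - x b' k\<bar> \<le> (1 + c k) * (4 * (1/2) ^ J)"
    if "\<And>j. j < J \<Longrightarrow> b (prod_encode (k, j)) = b' (prod_encode (k, j))" for b b' k J
  proof -
    have "x b k - x b' k = (1 + c k) * (4 * (dyadic (\<lambda>j. b (prod_encode (k, j))) - dyadic (\<lambda>j. b' (prod_encode (k, j)))))"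
      by (simp add: x_def algebra_simps)
    then have "\<bar>x b k - x b' k\<bar> = \<bar>1 + c k\<bar> * (\<bar>4\<bar> * \<bar>dyadic (\<lambda>j. b (prod_encode (k, j))) - dyadic (\<lambda>j. b' (prod_encode (k, j)))\<bar>)"
      by (simp only: abs_mult)
    then have "\<bar>x b k - x b' k\<bar> = (1 + c k) * (4 * \<bar>dyadic (\<lambda>j. b (prod_encode (k, j))) - dyadic (\<lambda>j. b' (prod_encode (k, j)))\<bar>)"
      using c_nn[of k] by simp
    also have "\<dots> \<le> (1 + c k) * (4 * (1 / 2 ^ J))"
      using c_nn[of k] that by (intro mult_left_mono bit_series_near) auto
    finally show ?thesis by (simp add: power_one_over)
  qed
  have x_cont: "\<exists>N. \<forall>b b'. (\<forall>i<N. b i = b' i) \<longrightarrow> \<bar>x b k - x b' k\<bar> < e" if "0 < e" for e k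
  proof -
    have "0 < e / (4 * (1 + c k))" using that c_nn[of k] by simp
    then obtain J where "(1/2::real) ^ J < e / (4 * (1 + c k))"
      using real_arch_pow_inv[of "e / (4 * (1 + c k))" "1/2"] by auto
    then have J: "(1 + c k) * (4 * (1/2) ^ J) < e"
      using c_nn[of k] by (simp add: field_simps)
    define N where "N = Suc (Max (insert 0 ((\<lambda>j. prod_encode (k, j)) ` {..<J})))"
    have "prod_encode (k, j) < N" if "j < J" for j
      unfolding N_def less_Suc_eq_le using that by (intro Max_ge) auto
    then have "\<bar>x b k - x b' k\<bar> < e" if "\<forall>i<N. b i = b' i" for b b'
      using near[of J b k b'] J that by fastforce
    then show ?thesis by blast
  qed
  have onto: "\<exists>b\<in>F. x b = \<phi>" if "\<phi> \<in> D" for \<phi>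
  proof -
    have "\<exists>b. dyadic b = (\<phi> k / (1 + c k) + 2) / 4" for k
    proof (rule dyadic_surj)
      define a where "a = \<phi> k / (1 + c k)"
      have "\<bar>a\<bar> \<le> 1" using c[OF that, of k] c_nn[of k] by (simp add: a_def divide_simps)
      then have "0 \<le> (a + 2) / 4" "(a + 2) / 4 < 1" by auto
      then show "0 \<le> (\<phi> k / (1 + c k) + 2) / 4" "(\<phi> k / (1 + c k) + 2) / 4 < 1"
        unfolding a_def by blast+
    qed
    then obtain B where B: "\<And>k. dyadic (B k) = (\<phi> k / (1 + c k) + 2) / 4" by metis
    define b where "b n = B (fst (prod_decode n)) (snd (prod_decode n))" for n
    have "1 + c k \<noteq> 0" for k using c_nn[of k] by simp
    then have "(1 + c k) * (4 * ((\<phi> k / (1 + c k) + 2) / 4) - 2) = \<phi> k" for k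
    proof -
      have "4 * ((a + 2) / 4) - 2 = a" for a :: real by (simp add: field_simps)
      then show ?thesis using \<open>\<And>k. 1 + c k \<noteq> 0\<close> by (metis nonzero_mult_div_cancel_left times_divide_eq_right)
    qed
    then have "x b = \<phi>" by (simp add: x_def b_def B fun_eq_iff)
    then show ?thesis using that by (auto simp: F_def)
  qed
  then have F_ne: "F \<noteq> {}" using ne by blast
  \<comment> \<open>Points of \<open>F\<close> agree with the retracted sequence on arbitrarily long
    prefixes; their images converge coordinatewise, so closedness of \<open>D\<close>
    applies.\<close>
  have retr: "bit_retract F b \<in> F" for b
  proof -
    have "\<forall>n. \<exists>f. f \<in> F \<and> (\<forall>i<n. f i = bit_retract F b i)"
      using bit_retract_extends[OF F_ne, of _ b] by blast
    then obtain f where "\<forall>n. f n \<in> F \<and> (\<forall>i<n. f n i = bit_retract F b i)"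
      by (rule choice[THEN exE])
    then have f: "\<And>n. f n \<in> F" "\<And>n i. i < n \<Longrightarrow> f n i = bit_retract F b i" by auto
    have "(\<lambda>n. x (f n) k) \<longlonglongrightarrow> x (bit_retract F b) k" for k
    proof (rule LIMSEQ_I)
      fix e :: real assume "0 < e"
      then obtain N where N: "\<And>b b'. (\<forall>i<N. b i = b' i) \<Longrightarrow> \<bar>x b k - x b' k\<bar> < e"
        using x_cont by metis
      show "\<exists>n0. \<forall>n\<ge>n0. norm (x (f n) k - x (bit_retract F b) k) < e"
      proof (intro exI[of _ N] allI impI)
        fix n assume "N \<le> n"
        then show "norm (x (f n) k - x (bit_retract F b) k) < e"
          unfolding real_norm_def by (intro N) (auto simp: f)
      qed
    qed
    then show ?thesis using closed[of "\<lambda>n. x (f n)"] f(1) by (auto simp: F_def)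
  qed
  define g where "g t = x (bit_retract F (digits t))" for t
  have "continuous_on cantor (\<lambda>t. g t k)" for k
    unfolding continuous_on_iff
  proof (intro ballI allI impI)
    fix t e :: real assume t: "t \<in> cantor" and "0 < e"
    then obtain N where N: "\<And>b b'. (\<forall>i<N. b i = b' i) \<Longrightarrow> \<bar>x b k - x b' k\<bar> < e"
      using x_cont by metis
    have "dist (g t' k) (g t k) < e" if t': "t' \<in> cantor" "dist t' t < 1 / 3 ^ N" for t'
    proof -
      obtain b where "t = ternary b" using t unfolding cantor_eq by blast
      moreover obtain b' where "t' = ternary b'" using t'(1) unfolding cantor_eq by blast
      ultimately have b: "t = ternary b" "t' = ternary b'" .
      then have "\<forall>i<N. bit_retract F b' i = bit_retract F b i"
        using ternary_agree[of b' b N] t'(2) bit_retract_agree[of N b' b]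
        by (auto simp: dist_real_def)
      then show ?thesis using N by (simp add: g_def b dist_real_def)
    qed
    then show "\<exists>d>0. \<forall>t'\<in>cantor. dist t' t < d \<longrightarrow> dist (g t' k) (g t k) < e"
      by (intro exI[of _ "1 / 3 ^ N"]) auto
  qed
  moreover have "g ` cantor = D"
  proof
    show "g ` cantor \<subseteq> D" using retr by (auto simp: g_def F_def)
    show "D \<subseteq> g ` cantor"
    proof
      fix \<phi> assume "\<phi> \<in> D"
      then obtain b where "b \<in> F" "x b = \<phi>" using onto by blast
      then show "\<phi> \<in> g ` cantor"
        by (intro image_eqI[of _ _ "ternary b"]) (auto simp: g_def bit_retract_id cantor_eq)
    qed
  qed
  ultimately show thesis using that by blast
qed

subsection \<open>The space of continuous functions on the Cantor set\<close>

lemma nonneg_null_squeeze: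
  fixes a b :: "nat \<Rightarrow> real"
  assumes "b \<longlonglongrightarrow> 0" "\<And>n. 0 \<le> a n" "\<And>n. a n \<le> b n"
  shows "a \<longlonglongrightarrow> 0"
  by (rule tendsto_sandwich[of "\<lambda>_. 0" a sequentially b]) (use assms in auto)

lemma CD_bdd: "f \<in> CD \<Longrightarrow> bdd_above ((\<lambda>x. \<bar>f x\<bar>) ` cantor)"
  unfolding CD_def
  by (intro compact_imp_bounded[THEN bounded_imp_bdd_above] compact_continuous_image compact_cantor)
    (auto intro: continuous_intros)

lemma abs_le_supnorm: "f \<in> CD \<Longrightarrow> \<bar>f t\<bar> \<le> supnorm f"
proof (cases "t \<in> cantor")
  case False
  assume f: "f \<in> CD"
  obtain s where s: "s \<in> cantor" using cantor_nonempty by blast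
  have "0 \<le> \<bar>f s\<bar>" by simp
  also have "\<dots> \<le> supnorm f"
    unfolding supnorm_def by (rule cSUP_upper[OF s CD_bdd[OF f]])
  finally show ?thesis using False f by (auto simp: CD_def)
qed (auto simp: supnorm_def intro!: cSUP_upper CD_bdd)

lemma supnorm_le: "(\<And>t. t \<in> cantor \<Longrightarrow> \<bar>f t\<bar> \<le> c) \<Longrightarrow> supnorm f \<le> c"
  unfolding supnorm_def by (rule cSUP_least[OF cantor_nonempty])

lemma supnorm_nonneg: "f \<in> CD \<Longrightarrow> 0 \<le> supnorm f"
  using abs_le_supnorm[of f undefined] by simp

lemma CD_zero [simp]: "(\<lambda>_. 0) \<in> CD"
  by (auto simp: CD_def)

lemma CD_add [simp]: "f \<in> CD \<Longrightarrow> g \<in> CD \<Longrightarrow> (\<lambda>t. f t + g t) \<in> CD"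
  by (auto simp: CD_def intro: continuous_intros)

lemma CD_diff [simp]: "f \<in> CD \<Longrightarrow> g \<in> CD \<Longrightarrow> (\<lambda>t. f t - g t) \<in> CD"
  by (auto simp: CD_def intro: continuous_intros)

lemma CD_mult [simp]: "f \<in> CD \<Longrightarrow> (\<lambda>t. c * f t) \<in> CD"
  by (auto simp: CD_def intro: continuous_intros)

lemma CD_sum [simp]: "(\<And>i. i \<in> I \<Longrightarrow> f i \<in> CD) \<Longrightarrow> (\<lambda>t. \<Sum>i\<in>I. f i t) \<in> CD"
  by (induction I rule: infinite_finite_induct) auto

lemma CD_ops [simp]:
  "f \<in> CD \<Longrightarrow> g \<in> CD \<Longrightarrow> fadd f g \<in> CD"
  "f \<in> CD \<Longrightarrow> g \<in> CD \<Longrightarrow> fdiff f g \<in> CD"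
  "f \<in> CD \<Longrightarrow> fscale c f \<in> CD"
  by (simp_all add: fadd_def fdiff_def fscale_def)

lemma supnorm_add:
  assumes "f \<in> CD" "g \<in> CD" shows "supnorm (\<lambda>t. f t + g t) \<le> supnorm f + supnorm g"
proof (rule supnorm_le)
  fix t
  show "\<bar>f t + g t\<bar> \<le> supnorm f + supnorm g"
    using abs_le_supnorm[OF assms(1), of t] abs_le_supnorm[OF assms(2), of t] by linarith
qed

lemma supnorm_diff_triangle:
  assumes "f \<in> CD" "g \<in> CD" "h \<in> CD"
  shows "supnorm (fdiff f h) \<le> supnorm (fdiff f g) + supnorm (fdiff g h)"
  using supnorm_add[of "fdiff f g" "fdiff g h"] assms by (simp add: fdiff_def)

lemma supnorm_minus_commute: "supnorm (fdiff f g) = supnorm (fdiff g f)"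
  by (simp add: supnorm_def fdiff_def abs_minus_commute)

lemma supnorm_triangle:
  assumes "f \<in> CD" "g \<in> CD" shows "supnorm f \<le> supnorm (fdiff f g) + supnorm g"
  using supnorm_add[of "fdiff f g" g] assms by (simp add: fdiff_def)

lemma supnorm_scale:
  assumes "f \<in> CD" shows "supnorm (\<lambda>t. c * f t) = \<bar>c\<bar> * supnorm f"
proof (rule antisym)
  show "supnorm (\<lambda>t. c * f t) \<le> \<bar>c\<bar> * supnorm f"
    using abs_le_supnorm[OF assms] by (intro supnorm_le) (simp add: abs_mult mult_left_mono)
  show "\<bar>c\<bar> * supnorm f \<le> supnorm (\<lambda>t. c * f t)"
  proof (cases "c = 0")
    case True
    then show ?thesis using supnorm_nonneg[of "\<lambda>_. 0"] by simp
  next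
    case False
    have "supnorm f \<le> supnorm (\<lambda>t. c * f t) / \<bar>c\<bar>"
      using abs_le_supnorm[OF CD_mult[OF assms], of c] False
      by (intro supnorm_le) (simp add: abs_mult field_simps)
    then show ?thesis using False by (simp add: field_simps)
  qed
qed

lemma supnorm_zero [simp]: "supnorm (\<lambda>_. 0) = 0"
  using cantor_nonempty by (simp add: supnorm_def)

lemma supnorm_eq_0: "f \<in> CD \<Longrightarrow> supnorm f \<le> 0 \<Longrightarrow> f = (\<lambda>_. 0)"
  using abs_le_supnorm[of f] by (metis abs_le_zero_iff ext order_trans)

lemma cd_converges_pointwise:
  assumes "cd_converges s f" "\<And>n. s n \<in> CD" "f \<in> CD"
  shows "(\<lambda>n. s n t) \<longlonglongrightarrow> f t"
proof (rule LIM_zero_cancel, rule tendsto_rabs_zero_cancel, rule nonneg_null_squeeze)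
  show "\<bar>s n t - f t\<bar> \<le> supnorm (fdiff (s n) f)" for n
    using abs_le_supnorm[of "fdiff (s n) f" t] assms by (simp add: fdiff_def)
qed (use assms in \<open>auto simp: cd_converges_def\<close>)

lemma cd_converges_unique:
  assumes "cd_converges s f" "cd_converges s g" "\<And>n. s n \<in> CD" "f \<in> CD" "g \<in> CD"
  shows "f = g"
  using LIMSEQ_unique[OF cd_converges_pointwise[OF assms(1,3,4)] cd_converges_pointwise[OF assms(2,3,5)]]
  by (auto simp: fun_eq_iff)

lemma cd_converges_supnorm:
  assumes "cd_converges s f" "\<And>n. s n \<in> CD" "f \<in> CD"
  shows "(\<lambda>n. supnorm (s n)) \<longlonglongrightarrow> supnorm f"
proof (rule LIM_zero_cancel, rule tendsto_rabs_zero_cancel, rule nonneg_null_squeeze)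
  show "\<bar>supnorm (s n) - supnorm f\<bar> \<le> supnorm (fdiff (s n) f)" for n
    using supnorm_triangle[of "s n" f] supnorm_triangle[of f "s n"] assms
    by (simp add: supnorm_minus_commute[of f])
qed (use assms in \<open>auto simp: cd_converges_def\<close>)

lemma cd_converges_add:
  assumes "cd_converges s f" "cd_converges s' g" "\<And>n. s n \<in> CD" "\<And>n. s' n \<in> CD" "f \<in> CD" "g \<in> CD"
  shows "cd_converges (\<lambda>n. fadd (s n) (s' n)) (fadd f g)"
  unfolding cd_converges_def
proof (rule nonneg_null_squeeze)
  show "supnorm (fdiff (fadd (s n) (s' n)) (fadd f g)) \<le> supnorm (fdiff (s n) f) + supnorm (fdiff (s' n) g)" for n
    using supnorm_add[of "fdiff (s n) f" "fdiff (s' n) g"] assms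
    by (simp add: fdiff_def fadd_def algebra_simps)
  show "(\<lambda>n. supnorm (fdiff (s n) f) + supnorm (fdiff (s' n) g)) \<longlonglongrightarrow> 0"
    using tendsto_add[OF assms(1,2)[unfolded cd_converges_def]] by simp
qed (use assms in \<open>auto intro!: supnorm_nonneg\<close>)

lemma cd_converges_scale:
  assumes "cd_converges s f" "\<And>n. s n \<in> CD" "f \<in> CD"
  shows "cd_converges (\<lambda>n. fscale c (s n)) (fscale c f)"
proof -
  have "supnorm (fdiff (fscale c (s n)) (fscale c f)) = \<bar>c\<bar> * supnorm (fdiff (s n) f)" for n
    using supnorm_scale[of "fdiff (s n) f" c] assms by (simp add: fdiff_def fscale_def algebra_simps)
  then show ?thesis
    using tendsto_mult[OF tendsto_const[of "\<bar>c\<bar>"] assms(1)[unfolded cd_converges_def]]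
    by (simp add: cd_converges_def)
qed

lemma cd_converges_const [simp]: "cd_converges (\<lambda>_. f) f"
  by (simp add: cd_converges_def fdiff_def)

text \<open>The ordered form \<open>n \<le> m\<close> with a weak inequality is the one in which
  bounded completeness of the basis delivers its estimate.\<close>

definition cd_Cauchy :: "(nat \<Rightarrow> cfun) \<Rightarrow> bool" where
  "cd_Cauchy s \<longleftrightarrow> (\<forall>e>0. \<exists>N. \<forall>n\<ge>N. \<forall>m\<ge>n. supnorm (fdiff (s m) (s n)) \<le> e)"

lemma cd_complete:
  assumes s: "\<And>n. s n \<in> CD" and "cd_Cauchy s"
  obtains f where "f \<in> CD" "cd_converges s f"
proof -
  have C: "\<exists>N. \<forall>n\<ge>N. \<forall>m\<ge>n. supnorm (fdiff (s m) (s n)) \<le> e" if "e > 0" for e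
    using assms(2) that by (auto simp: cd_Cauchy_def)
  have pw: "\<bar>s m t - s n t\<bar> \<le> supnorm (fdiff (s m) (s n))" for m n t
    using abs_le_supnorm[of "fdiff (s m) (s n)" t] s by (simp add: fdiff_def)
  have "Cauchy (\<lambda>n. s n t)" for t
  proof (rule metric_CauchyI)
    fix e :: real assume "0 < e"
    then obtain N where N: "\<And>n m. N \<le> n \<Longrightarrow> n \<le> m \<Longrightarrow> supnorm (fdiff (s m) (s n)) \<le> e / 2"
      using C[of "e / 2"] by auto
    have "\<bar>s m t - s n t\<bar> < e" if "N \<le> m" "N \<le> n" for m n
    proof (cases "n \<le> m")
      case True
      then show ?thesis using N[OF that(2) True] pw[of m t n] \<open>0 < e\<close> by simp
    next
      case False
      then show ?thesis using N[OF that(1), of n] pw[of n t m] \<open>0 < e\<close> by simp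
    qed
    then show "\<exists>N. \<forall>m\<ge>N. \<forall>n\<ge>N. dist (s m t) (s n t) < e"
      by (auto simp: dist_real_def)
  qed
  then have "convergent (\<lambda>n. s n t)" for t by (simp add: Cauchy_convergent_iff)
  then obtain f where f: "\<And>t. (\<lambda>n. s n t) \<longlonglongrightarrow> f t"
    unfolding convergent_def by metis
  have close: "\<bar>f t - s n t\<bar> \<le> e"
    if "\<And>m. n \<le> m \<Longrightarrow> supnorm (fdiff (s m) (s n)) \<le> e" for t n e
  proof (rule LIMSEQ_le_const2)
    show "(\<lambda>m. \<bar>s m t - s n t\<bar>) \<longlonglongrightarrow> \<bar>f t - s n t\<bar>" by (intro tendsto_intros f)
    show "\<exists>N. \<forall>m\<ge>N. \<bar>s m t - s n t\<bar> \<le> e"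
      using pw that by (intro exI[of _ n]) (meson order_trans)
  qed
  have "continuous_on cantor f"
  proof (rule uniform_limit_theorem)
    show "\<forall>\<^sub>F n in sequentially. continuous_on cantor (s n)" using s by (simp add: CD_def)
    show "uniform_limit cantor s f sequentially"
    proof (rule uniform_limitI)
      fix e :: real assume "0 < e"
      then obtain N where N: "\<And>n m. N \<le> n \<Longrightarrow> n \<le> m \<Longrightarrow> supnorm (fdiff (s m) (s n)) \<le> e / 2"
        using C[of "e / 2"] by auto
      have "dist (s n t) (f t) < e" if "N \<le> n" for n t
        using close[of n "e / 2" t] N[OF that] \<open>0 < e\<close> by (simp add: dist_real_def abs_minus_commute)
      then show "\<forall>\<^sub>F n in sequentially. \<forall>t\<in>cantor. dist (s n t) (f t) < e"
        by (auto simp: eventually_sequentially)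
    qed
  qed simp
  moreover have "f t = 0" if "t \<notin> cantor" for t
    using f[of t] s that by (simp add: CD_def LIMSEQ_const_iff)
  ultimately have fCD: "f \<in> CD" by (simp add: CD_def)
  have "cd_converges s f"
    unfolding cd_converges_def
  proof (rule LIMSEQ_I)
    fix e :: real assume "0 < e"
    then obtain N where N: "\<And>n m. N \<le> n \<Longrightarrow> n \<le> m \<Longrightarrow> supnorm (fdiff (s m) (s n)) \<le> e / 2"
      using C[of "e / 2"] by auto
    have "norm (supnorm (fdiff (s n) f) - 0) < e" if "N \<le> n" for n
    proof -
      have "supnorm (fdiff (s n) f) \<le> e / 2"
        using close[of n "e / 2"] N[OF that] by (intro supnorm_le) (simp add: fdiff_def abs_minus_commute)
      then show ?thesis using supnorm_nonneg[of "fdiff (s n) f"] fCD s \<open>0 < e\<close> by simp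
    qed
    then show "\<exists>N. \<forall>n\<ge>N. norm (supnorm (fdiff (s n) f) - 0) < e" by blast
  qed
  with fCD that show thesis by blast
qed

lemma cd_converges_subseq:
  "cd_converges s f \<Longrightarrow> strict_mono r \<Longrightarrow> cd_converges (\<lambda>n. s (r n)) f"
  unfolding cd_converges_def using LIMSEQ_subseq_LIMSEQ by (fastforce simp: o_def)

lemma SB_CD: "X \<in> SB \<Longrightarrow> f \<in> X \<Longrightarrow> f \<in> CD"
  by (auto simp: SB_def closed_subspace_def linear_subspace_def)

lemma SB_zero: "X \<in> SB \<Longrightarrow> (\<lambda>_. 0) \<in> X"
  by (auto simp: SB_def closed_subspace_def linear_subspace_def)

lemma SB_add: "X \<in> SB \<Longrightarrow> f \<in> X \<Longrightarrow> g \<in> X \<Longrightarrow> fadd f g \<in> X"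
  by (auto simp: SB_def closed_subspace_def linear_subspace_def)

lemma SB_scale: "X \<in> SB \<Longrightarrow> f \<in> X \<Longrightarrow> fscale c f \<in> X"
  by (auto simp: SB_def closed_subspace_def linear_subspace_def)

lemma SB_diff:
  assumes "X \<in> SB" "f \<in> X" "g \<in> X" shows "fdiff f g \<in> X"
proof -
  have "fdiff f g = fadd f (fscale (- 1) g)" by (simp add: fdiff_def fadd_def fscale_def)
  then show ?thesis using SB_add[OF assms(1,2) SB_scale[OF assms(1,3)]] by simp
qed

lemma SB_sum:
  assumes "X \<in> SB" "\<And>i. i \<in> I \<Longrightarrow> f i \<in> X" shows "(\<lambda>t. \<Sum>i\<in>I. a i * f i t) \<in> X"
  using assms(2)
proof (induction I rule: infinite_finite_induct)
  case (insert i I)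
  have "fadd (fscale (a i) (f i)) (\<lambda>t. \<Sum>i\<in>I. a i * f i t) \<in> X"
    using insert by (intro SB_add SB_scale assms(1)) auto
  then show ?case using insert.hyps by (simp add: fadd_def fscale_def)
qed (simp_all add: SB_zero[OF assms(1)])

lemma SB_closed:
  "X \<in> SB \<Longrightarrow> (\<And>n. s n \<in> X) \<Longrightarrow> f \<in> CD \<Longrightarrow> cd_converges s f \<Longrightarrow> f \<in> X"
  unfolding SB_def closed_subspace_def by blast

lemma SB_complete:
  assumes "X \<in> SB" "\<And>n. s n \<in> X" "cd_Cauchy s"
  obtains f where "f \<in> X" "cd_converges s f"
proof -
  obtain f where "f \<in> CD" "cd_converges s f"
    by (rule cd_complete[OF SB_CD[OF assms(1,2)] assms(3)])
  then show thesis using that SB_closed[OF assms(1), of s f] assms(2) by blast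
qed

subsection \<open>Realising a norm on finite sequences inside the space of continuous functions\<close>

lemma trunc_add: "trunc n (\<lambda>k. x k + y k) = (\<lambda>k. trunc n x k + trunc n y k)"
  and trunc_diff: "trunc n (\<lambda>k. x k - y k) = (\<lambda>k. trunc n x k - trunc n y k)"
  and trunc_scale: "trunc n (\<lambda>k. c * x k) = (\<lambda>k. c * trunc n x k)"
  by (auto simp: trunc_def)

lemma trunc_trunc: "trunc m (trunc n x) = trunc (min m n) x"
  by (auto simp: trunc_def fun_eq_iff)

lemma pair_diff:
  assumes "x \<in> c00" "y \<in> c00"
  shows "pair \<phi> (\<lambda>k. x k - y k) = pair \<phi> x - pair \<phi> y"
  using pair_add[OF assms(1) c00_minus[OF assms(2)], of \<phi>] pair_scale[OF assms(2), of \<phi> "-1"] by simp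

lemma pair_zero [simp]: "pair \<phi> (\<lambda>_. 0) = 0"
  by (simp add: pair_def)

lemma c00_trunc_eq:
  assumes "x \<in> c00" obtains n where "\<And>m. n \<le> m \<Longrightarrow> trunc m x = x"
proof -
  obtain n where n: "\<forall>k\<ge>n. x k = 0" using assms by (rule c00E)
  show thesis by (rule that[of n]) (intro trunc_eq, use n in auto)
qed

lemma pair_tendsto:
  assumes "\<And>k. (\<lambda>n. x n k) \<longlonglongrightarrow> a k"
  shows "(\<lambda>n. pair \<phi> (trunc N (x n))) \<longlonglongrightarrow> pair \<phi> (trunc N a)"
  unfolding pair_trunc by (intro tendsto_intros assms)

text \<open>The unit vectors form a monotone basis. \<open>shrinking\<close> says that the
  restrictions of a bounded functional to the tails tend to 0 in norm,
  \<open>boundedly_complete\<close> that bounded partial sums are Cauchy; by James, the two together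
  give reflexivity.\<close>

locale basis_norm =
  fixes p :: "(nat \<Rightarrow> real) \<Rightarrow> real"
  assumes seminorm: "seminorm00 p"
    and unit_pos: "0 < p (unit_seq k)"
    and trunc_le: "x \<in> c00 \<Longrightarrow> p (trunc n x) \<le> p x"
    and shrinking: "(\<And>x. x \<in> c00 \<Longrightarrow> \<bar>pair \<phi> x\<bar> \<le> C * p x) \<Longrightarrow> 0 < e \<Longrightarrow>
      \<exists>n. \<forall>x\<in>c00. (\<forall>k<n. x k = 0) \<longrightarrow> \<bar>pair \<phi> x\<bar> \<le> e * p x"
    and boundedly_complete: "(\<And>n. p (trunc n a) \<le> C) \<Longrightarrow> 0 < e \<Longrightarrow>
      \<exists>N. \<forall>n\<ge>N. \<forall>m\<ge>n. p (\<lambda>k. trunc m a k - trunc n a k) \<le> e"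
begin

lemma coord_le: "x \<in> c00 \<Longrightarrow> \<bar>x k\<bar> * p (unit_seq k) \<le> 2 * p x"
proof -
  assume x: "x \<in> c00"
  have "(\<lambda>j. x k * unit_seq k j) = (\<lambda>j. trunc (Suc k) x j - trunc k x j)"
    by (auto simp: trunc_Suc)
  then have "\<bar>x k\<bar> * p (unit_seq k) = p (\<lambda>j. trunc (Suc k) x j - trunc k x j)"
    using seminorm00_scale[OF seminorm, of "unit_seq k" "x k"] by simp
  also have "\<dots> \<le> p (trunc (Suc k) x) + p (trunc k x)"
    by (intro seminorm00_diff[OF seminorm]) auto
  also have "\<dots> \<le> 2 * p x" using trunc_le[OF x, of "Suc k"] trunc_le[OF x, of k] by simp
  finally show ?thesis .
qed

text \<open>The Banach-Mazur embedding. \<open>D\<close> is the dual unit ball in coordinates,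
  bounded in each coordinate and closed under pointwise limits, so the Cantor set maps onto it by
  some \<open>g\<close>; the \<open>k\<close>-th vector is the \<open>k\<close>-th coordinate of
  \<open>g\<close>. Evaluation at a point of the Cantor set is then a functional in
  \<open>D\<close>, and Hahn-Banach shows that these functionals attain the norm.\<close>

lemma ex_basis: "\<exists>e. (\<forall>k. e k \<in> CD) \<and> (\<forall>x\<in>c00. supnorm (\<lambda>t. pair (\<lambda>k. e k t) x) = p x)"
proof -
  define D where "D = {\<phi>. \<forall>x\<in>c00. pair \<phi> x \<le> p x}"
  have abs: "\<bar>pair \<phi> x\<bar> \<le> p x" if "\<phi> \<in> D" "x \<in> c00" for \<phi> x
    using that pair_scale[of x \<phi> "-1"] seminorm00_minus[OF seminorm, of x] c00_minus[of x]
    unfolding D_def abs_le_iff by fastforce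
  obtain \<phi>0 where "\<And>y. y \<in> c00 \<Longrightarrow> pair \<phi>0 y \<le> p y"
    using hahn_banach_c00[OF seminorm c00_zero] by blast
  then have "D \<noteq> {}" by (auto simp: D_def)
  moreover have "\<bar>\<phi> k\<bar> \<le> p (unit_seq k)" if "\<phi> \<in> D" for \<phi> k
    using abs[OF that c00_unit_seq] by simp
  moreover have "l \<in> D"
    if s: "\<And>n. s n \<in> D" and l: "\<And>k. (\<lambda>n. s n k) \<longlonglongrightarrow> l k" for s l
    unfolding D_def
  proof (intro CollectI ballI)
    fix x :: "nat \<Rightarrow> real" assume "x \<in> c00"
    then have "pair (s n) x \<le> p x" for n using s by (auto simp: D_def)
    moreover have "(\<lambda>n. pair (s n) x) \<longlonglongrightarrow> pair l x"
      unfolding pair_def by (intro tendsto_intros l)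
    ultimately show "pair l x \<le> p x" by (intro LIMSEQ_le_const2) auto
  qed
  ultimately obtain g where g: "\<forall>k. continuous_on cantor (\<lambda>t. g t k)" "g ` cantor = D"
    by (rule cantor_parametrization) blast
  define e where "e k t = (if t \<in> cantor then g t k else 0)" for k t
  have "e k \<in> CD" for k
    using g(1)[rule_format, of k] by (auto simp: CD_def e_def cong: continuous_on_cong)
  moreover have "supnorm (\<lambda>t. pair (\<lambda>k. e k t) x) = p x" if x: "x \<in> c00" for x
  proof (rule antisym)
    have e: "pair (\<lambda>k. e k t) x = pair (g t) x" if "t \<in> cantor" for t
      using that by (simp add: e_def)
    show "supnorm (\<lambda>t. pair (\<lambda>k. e k t) x) \<le> p x"
      using g(2) by (intro supnorm_le) (auto simp: e intro!: abs x)
    obtain \<phi> where \<phi>: "\<And>y. y \<in> c00 \<Longrightarrow> pair \<phi> y \<le> p y" "pair \<phi> x = p x"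
      using hahn_banach_c00[OF seminorm x] by blast
    then have "\<phi> \<in> D" by (auto simp: D_def)
    then obtain t where t: "t \<in> cantor" "\<phi> = g t" using g(2) by blast
    have "p x = \<bar>pair (\<lambda>k. e k t) x\<bar>"
      using \<phi>(2) t e[OF t(1)] seminorm00_nonneg[OF seminorm x] by simp
    also have "\<dots> \<le> supnorm (\<lambda>t. pair (\<lambda>k. e k t) x)"
    proof -
      have "(\<lambda>t. pair (\<lambda>k. e k t) x) \<in> CD"
        unfolding pair_def mult.commute[of "e _ _"] using \<open>\<And>k. e k \<in> CD\<close> by simp
      then show ?thesis by (rule abs_le_supnorm)
    qed
    finally show "p x \<le> supnorm (\<lambda>t. pair (\<lambda>k. e k t) x)" .
  qed
  ultimately show ?thesis by blast
qed

definition basis :: "nat \<Rightarrow> cfun" where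
  "basis = (SOME e. (\<forall>k. e k \<in> CD) \<and> (\<forall>x\<in>c00. supnorm (\<lambda>t. pair (\<lambda>k. e k t) x) = p x))"

definition comb :: "(nat \<Rightarrow> real) \<Rightarrow> cfun" where
  "comb x = (\<lambda>t. pair (\<lambda>k. basis k t) x)"

definition realization :: "cfun set" where
  "realization = {f \<in> CD. \<exists>s. (\<forall>n. s n \<in> c00) \<and> cd_converges (\<lambda>n. comb (s n)) f}"

lemma basis_CD: "basis k \<in> CD"
  and supnorm_comb: "x \<in> c00 \<Longrightarrow> supnorm (comb x) = p x"
  using someI_ex[OF ex_basis] by (auto simp: basis_def comb_def)

lemma comb_CD [simp]: "comb x \<in> CD"
  unfolding comb_def pair_def mult.commute[of "basis _ _"] using basis_CD by simp

lemma comb_add: "x \<in> c00 \<Longrightarrow> y \<in> c00 \<Longrightarrow> comb (\<lambda>k. x k + y k) = fadd (comb x) (comb y)"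
  and comb_diff: "x \<in> c00 \<Longrightarrow> y \<in> c00 \<Longrightarrow> comb (\<lambda>k. x k - y k) = fdiff (comb x) (comb y)"
  and comb_scale: "x \<in> c00 \<Longrightarrow> comb (\<lambda>k. c * x k) = fscale c (comb x)"
  by (simp_all add: comb_def fadd_def fdiff_def fscale_def pair_add pair_diff pair_scale)

lemma supnorm_comb_diff:
  "x \<in> c00 \<Longrightarrow> y \<in> c00 \<Longrightarrow> supnorm (fdiff (comb x) (comb y)) = p (\<lambda>k. x k - y k)"
  using supnorm_comb[of "\<lambda>k. x k - y k"] comb_diff[of x y] by simp

lemma comb_trunc: "comb (trunc N a) = (\<lambda>t. \<Sum>n<N. a n * basis n t)"
  by (simp add: comb_def pair_trunc mult.commute)

lemma comb_in_realization: "x \<in> c00 \<Longrightarrow> comb x \<in> realization"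
  by (auto simp: realization_def intro!: exI[of _ "\<lambda>_. x"])

lemma realization_CD: "f \<in> realization \<Longrightarrow> f \<in> CD"
  by (simp add: realization_def)

lemma realization_add: "f \<in> realization \<Longrightarrow> g \<in> realization \<Longrightarrow> fadd f g \<in> realization"
proof -
  assume f: "f \<in> realization" and g: "g \<in> realization"
  obtain s where s: "\<And>n. s n \<in> c00" "cd_converges (\<lambda>n. comb (s n)) f"
    using f by (auto simp: realization_def)
  obtain s' where s': "\<And>n. s' n \<in> c00" "cd_converges (\<lambda>n. comb (s' n)) g"
    using g by (auto simp: realization_def)
  have "cd_converges (\<lambda>n. comb (\<lambda>k. s n k + s' n k)) (fadd f g)"
    using cd_converges_add[OF s(2) s'(2)] f g by (simp add: comb_add s s' realization_CD)
  then show ?thesis using f g s s' unfolding realization_def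
    by (intro CollectI conjI exI[of _ "\<lambda>n k. s n k + s' n k"]) auto
qed

lemma realization_scale: "f \<in> realization \<Longrightarrow> fscale c f \<in> realization"
proof -
  assume f: "f \<in> realization"
  obtain s where s: "\<And>n. s n \<in> c00" "cd_converges (\<lambda>n. comb (s n)) f"
    using f by (auto simp: realization_def)
  have "cd_converges (\<lambda>n. comb (\<lambda>k. c * s n k)) (fscale c f)"
    using cd_converges_scale[OF s(2)] f by (simp add: comb_scale s realization_CD)
  then show ?thesis using f s unfolding realization_def
    by (intro CollectI conjI exI[of _ "\<lambda>n k. c * s n k"]) auto
qed

lemma realization_SB: "realization \<in> SB"
  unfolding SB_def closed_subspace_def linear_subspace_def
proof (intro CollectI conjI allI impI ballI)
  show "realization \<subseteq> CD" by (auto simp: realization_def)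
  show "(\<lambda>t. 0) \<in> realization" using comb_in_realization[OF c00_zero] by (simp add: comb_def)
next
  fix s f assume A: "(\<forall>n. s n \<in> realization) \<and> f \<in> CD \<and> cd_converges s f"
  have "\<exists>x\<in>c00. supnorm (fdiff (comb x) (s n)) < inverse (Suc n)" for n
  proof -
    obtain u where u: "\<And>n. u n \<in> c00" "cd_converges (\<lambda>n. comb (u n)) (s n)"
      using A by (auto simp: realization_def)
    then have "eventually (\<lambda>m. supnorm (fdiff (comb (u m)) (s n)) < inverse (Suc n)) sequentially"
      unfolding cd_converges_def by (intro order_tendstoD) auto
    then show ?thesis using u(1) by (auto simp: eventually_sequentially)
  qed
  then obtain x where x: "\<And>n. x n \<in> c00" "\<And>n. supnorm (fdiff (comb (x n)) (s n)) < inverse (Suc n)"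
    by metis
  have sCD: "s n \<in> CD" for n using A by (auto simp: realization_CD)
  have "cd_converges (\<lambda>n. comb (x n)) f"
    unfolding cd_converges_def
  proof (rule nonneg_null_squeeze)
    show "(\<lambda>n. inverse (real (Suc n)) + supnorm (fdiff (s n) f)) \<longlonglongrightarrow> 0"
      using tendsto_add[OF LIMSEQ_inverse_real_of_nat, of "\<lambda>n. supnorm (fdiff (s n) f)" 0] A
      by (simp add: cd_converges_def)
    show "supnorm (fdiff (comb (x n)) f) \<le> inverse (real (Suc n)) + supnorm (fdiff (s n) f)" for n
      using supnorm_diff_triangle[of "comb (x n)" "s n" f] x(2)[of n] A sCD by simp
  qed (use A in \<open>auto intro!: supnorm_nonneg\<close>)
  then show "f \<in> realization" using A x by (auto simp: realization_def)
qed (auto intro: realization_add realization_scale)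

text \<open>The coefficients are the limits of the coordinates of an approximating sequence, which
  exist because coordinates are continuous for \<open>p\<close>.\<close>

lemma expansion_exists:
  assumes "f \<in> realization"
  shows "\<exists>a. cd_converges (\<lambda>N. comb (trunc N a)) f"
proof -
  obtain s where s: "\<And>n. s n \<in> c00" and lim: "cd_converges (\<lambda>n. comb (s n)) f"
    using assms by (auto simp: realization_def)
  have fCD: "f \<in> CD" by (rule realization_CD[OF assms])
  have dist_lim: "(\<lambda>m. p (\<lambda>k. s m k - s j k)) \<longlonglongrightarrow> supnorm (fdiff f (comb (s j)))" for j
  proof -
    have "cd_converges (\<lambda>m. fdiff (comb (s m)) (comb (s j))) (fdiff f (comb (s j)))"
      using lim by (simp add: cd_converges_def fdiff_def)
    from cd_converges_supnorm[OF this] show ?thesis using s fCD by (simp add: supnorm_comb_diff)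
  qed
  have small: "\<exists>j0. \<forall>j\<ge>j0. supnorm (fdiff f (comb (s j))) < e" if "0 < e" for e
    using order_tendstoD(2)[OF lim[unfolded cd_converges_def] that]
    by (auto simp: eventually_sequentially supnorm_minus_commute)
  have "Cauchy (\<lambda>n. s n k)" for k
  proof (rule metric_CauchyI)
    fix e :: real assume "0 < e"
    define d where "d = e * p (unit_seq k) / 4"
    have "0 < d" using unit_pos \<open>0 < e\<close> by (simp add: d_def)
    then obtain j0 where j0: "\<And>j. j0 \<le> j \<Longrightarrow> supnorm (fdiff f (comb (s j))) < d" using small by blast
    have "dist (s m k) (s n k) < e" if "j0 \<le> m" "j0 \<le> n" for m n
    proof -
      have "\<bar>s m k - s n k\<bar> * p (unit_seq k) \<le> 2 * p (\<lambda>k. s m k - s n k)"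
        using coord_le[of "\<lambda>k. s m k - s n k" k] s by simp
      also have "p (\<lambda>k. s m k - s n k) \<le> supnorm (fdiff (comb (s m)) f) + supnorm (fdiff f (comb (s n)))"
        using supnorm_diff_triangle[of "comb (s m)" f "comb (s n)"] s fCD by (simp add: supnorm_comb_diff)
      also have "\<dots> < 2 * d" using j0[OF that(1)] j0[OF that(2)] by (simp add: supnorm_minus_commute)
      finally have "\<bar>s m k - s n k\<bar> * p (unit_seq k) < e * p (unit_seq k)" by (simp add: d_def)
      then show ?thesis using unit_pos[of k] by (simp add: dist_real_def)
    qed
    then show "\<exists>M. \<forall>m\<ge>M. \<forall>n\<ge>M. dist (s m k) (s n k) < e" by blast
  qed
  then have "convergent (\<lambda>n. s n k)" for k by (simp add: Cauchy_convergent_iff)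
  then obtain a where a: "\<And>k. (\<lambda>n. s n k) \<longlonglongrightarrow> a k" unfolding convergent_def by metis
  \<comment> \<open>Once \<open>N\<close> is beyond the support of \<open>s j\<close>, truncation
    fixes \<open>s j\<close> and contracts the distance from \<open>s m\<close> to it. Letting
    \<open>m\<close> tend to infinity at each point \<open>t\<close>, both the partial sum and
    \<open>f\<close> are as close to \<open>comb (s j)\<close> as \<open>f\<close> is.\<close>
  have main: "supnorm (fdiff (comb (trunc N a)) f) \<le> 2 * supnorm (fdiff f (comb (s j)))"
    if N: "trunc N (s j) = s j" for N j
  proof (rule supnorm_le)
    fix t
    have "(\<lambda>m. \<bar>comb (trunc N (s m)) t - comb (s j) t\<bar>) \<longlonglongrightarrow> \<bar>comb (trunc N a) t - comb (s j) t\<bar>"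
      unfolding comb_def by (intro tendsto_intros pair_tendsto a)
    moreover have "\<bar>comb (trunc N (s m)) t - comb (s j) t\<bar> \<le> p (\<lambda>k. s m k - s j k)" for m
    proof -
      have "\<bar>comb (trunc N (s m)) t - comb (s j) t\<bar> \<le> supnorm (fdiff (comb (trunc N (s m))) (comb (s j)))"
        using abs_le_supnorm[of "fdiff (comb (trunc N (s m))) (comb (s j))" t] by (simp add: fdiff_def)
      also have "\<dots> = p (trunc N (\<lambda>k. s m k - s j k))"
        using s by (simp add: supnorm_comb_diff trunc_diff N)
      also have "\<dots> \<le> p (\<lambda>k. s m k - s j k)" using s by (intro trunc_le) auto
      finally show ?thesis .
    qed
    ultimately have "\<bar>comb (trunc N a) t - comb (s j) t\<bar> \<le> supnorm (fdiff f (comb (s j)))"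
      using dist_lim[of j] by (meson LIMSEQ_le)
    moreover have "\<bar>f t - comb (s j) t\<bar> \<le> supnorm (fdiff f (comb (s j)))"
      using abs_le_supnorm[of "fdiff f (comb (s j))" t] fCD by (simp add: fdiff_def)
    ultimately show "\<bar>fdiff (comb (trunc N a)) f t\<bar> \<le> 2 * supnorm (fdiff f (comb (s j)))"
      unfolding fdiff_def by linarith
  qed
  have "cd_converges (\<lambda>N. comb (trunc N a)) f"
    unfolding cd_converges_def
  proof (rule LIMSEQ_I)
    fix e :: real assume "0 < e"
    then obtain j where j: "supnorm (fdiff f (comb (s j))) < e / 2" using small[of "e / 2"] by auto
    obtain N0 where N0: "\<And>N. N0 \<le> N \<Longrightarrow> trunc N (s j) = s j" using c00_trunc_eq[OF s] by blast
    have "norm (supnorm (fdiff (comb (trunc N a)) f) - 0) < e" if "N0 \<le> N" for N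
      using main[OF N0[OF that]] j supnorm_nonneg[of "fdiff (comb (trunc N a)) f"] fCD by simp
    then show "\<exists>N0. \<forall>N\<ge>N0. norm (supnorm (fdiff (comb (trunc N a)) f) - 0) < e" by blast
  qed
  then show ?thesis by blast
qed

lemma expansion_unique:
  assumes "cd_converges (\<lambda>N. comb (trunc N a)) f" "cd_converges (\<lambda>N. comb (trunc N b)) f" "f \<in> CD"
  shows "a = b"
proof
  fix k
  have "(\<lambda>N. p (trunc N (\<lambda>k. a k - b k))) \<longlonglongrightarrow> 0"
  proof (rule nonneg_null_squeeze)
    show "(\<lambda>N. supnorm (fdiff (comb (trunc N a)) f) + supnorm (fdiff (comb (trunc N b)) f)) \<longlonglongrightarrow> 0"
      using tendsto_add[OF assms(1,2)[unfolded cd_converges_def]] by simp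
    show "p (trunc N (\<lambda>k. a k - b k))
      \<le> supnorm (fdiff (comb (trunc N a)) f) + supnorm (fdiff (comb (trunc N b)) f)" for N
      using supnorm_diff_triangle[of "comb (trunc N a)" f "comb (trunc N b)"] assms(3)
      by (simp add: supnorm_comb_diff trunc_diff supnorm_minus_commute[of f])
  qed (simp add: seminorm00_nonneg[OF seminorm])
  moreover have "\<bar>a k - b k\<bar> * p (unit_seq k) \<le> 2 * p (trunc N (\<lambda>k. a k - b k))" if "Suc k \<le> N" for N
    using coord_le[OF c00_trunc, of N "\<lambda>k. a k - b k" k] that by (simp add: trunc_def)
  ultimately have "\<bar>a k - b k\<bar> * p (unit_seq k) \<le> 2 * 0"
    by (intro LIMSEQ_le_const[of "\<lambda>N. 2 * p (trunc N (\<lambda>k. a k - b k))"] tendsto_intros) auto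
  then show "a k = b k" using unit_pos[of k] by (simp add: mult_le_0_iff)
qed

definition coef :: "cfun \<Rightarrow> nat \<Rightarrow> real" where
  "coef f = (SOME a. cd_converges (\<lambda>N. comb (trunc N a)) f)"

lemma coef_converges: "f \<in> realization \<Longrightarrow> cd_converges (\<lambda>N. comb (trunc N (coef f))) f"
  unfolding coef_def by (rule someI_ex[OF expansion_exists])

lemma coef_eqI: "f \<in> CD \<Longrightarrow> cd_converges (\<lambda>N. comb (trunc N a)) f \<Longrightarrow> f \<in> realization \<and> coef f = a"
proof -
  assume f: "f \<in> CD" and a: "cd_converges (\<lambda>N. comb (trunc N a)) f"
  then have "f \<in> realization" by (auto simp: realization_def intro!: exI[of _ "\<lambda>N. trunc N a"])
  then show ?thesis using expansion_unique[OF coef_converges a f] by simp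
qed

lemma coef_add: "f \<in> realization \<Longrightarrow> g \<in> realization \<Longrightarrow> coef (fadd f g) = (\<lambda>k. coef f k + coef g k)"
  using cd_converges_add[OF coef_converges coef_converges, of f g]
  by (intro coef_eqI[THEN conjunct2]) (auto simp: trunc_add comb_add realization_CD)

lemma coef_scale: "f \<in> realization \<Longrightarrow> coef (fscale c f) = (\<lambda>k. c * coef f k)"
  using cd_converges_scale[OF coef_converges, of f c]
  by (intro coef_eqI[THEN conjunct2]) (auto simp: trunc_scale comb_scale realization_CD)

lemma trunc_coef_le: "f \<in> realization \<Longrightarrow> p (trunc N (coef f)) \<le> supnorm f"
proof -
  assume f: "f \<in> realization"
  have "(\<lambda>M. p (trunc M (coef f))) \<longlonglongrightarrow> supnorm f"
    using cd_converges_supnorm[OF coef_converges[OF f]] f by (simp add: supnorm_comb realization_CD)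
  moreover have "p (trunc N (coef f)) \<le> p (trunc M (coef f))" if "N \<le> M" for M
    using trunc_le[of "trunc M (coef f)" N] that by (simp add: trunc_trunc min_absorb1)
  ultimately show ?thesis by (intro LIMSEQ_le_const) auto
qed

lemma coef_le: "f \<in> realization \<Longrightarrow> \<bar>coef f k\<bar> * p (unit_seq k) \<le> 2 * supnorm f"
  using coord_le[OF c00_trunc, of "Suc k" "coef f" k] trunc_coef_le[of f "Suc k"] by (simp add: trunc_def)

lemma schauder_basis: "has_schauder_basis realization"
  unfolding has_schauder_basis_def
proof (intro exI[of _ basis] conjI allI ballI)
  fix n
  have "comb (unit_seq n) = basis n" by (simp add: comb_def)
  then show "basis n \<in> realization" using comb_in_realization[of "unit_seq n"] by simp
next
  fix f assume f: "f \<in> realization"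
  show "\<exists>!a. cd_converges (\<lambda>N t. \<Sum>n<N. a n * basis n t) f"
    unfolding comb_trunc[symmetric] using coef_converges[OF f] expansion_unique realization_CD[OF f] by blast
qed

lemma converges_in_realization:
  assumes "\<And>n. p (trunc n a) \<le> C"
  obtains f where "f \<in> realization" "coef f = a" "cd_converges (\<lambda>N. comb (trunc N a)) f" "supnorm f \<le> C"
proof -
  have "cd_Cauchy (\<lambda>N. comb (trunc N a))"
    unfolding cd_Cauchy_def supnorm_comb_diff[OF c00_trunc c00_trunc]
    using boundedly_complete[OF assms] by blast
  then obtain f where f: "f \<in> CD" "cd_converges (\<lambda>N. comb (trunc N a)) f"
    using cd_complete[of "\<lambda>N. comb (trunc N a)"] by auto
  moreover have "supnorm f \<le> C"
    using LIMSEQ_le_const2[OF cd_converges_supnorm[OF f(2) comb_CD f(1)], of C] assms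
    by (auto simp: supnorm_comb)
  ultimately show thesis using that[of f] coef_eqI[OF f] by blast
qed

text \<open>An operator into the space is given by its coordinates: uniformly bounded partial sums
  already converge, because the basis is boundedly complete.\<close>

lemma ex_bounded_op_into:
  assumes X: "X \<in> SB"
    and add: "\<And>x y k. x \<in> X \<Longrightarrow> y \<in> X \<Longrightarrow> \<alpha> (fadd x y) k = \<alpha> x k + \<alpha> y k"
    and scale: "\<And>c x k. x \<in> X \<Longrightarrow> \<alpha> (fscale c x) k = c * \<alpha> x k"
    and le: "\<And>x N. x \<in> X \<Longrightarrow> p (trunc N (\<alpha> x)) \<le> K * supnorm x"
  shows "\<exists>B. bounded_op X realization B \<and> (\<forall>x\<in>X. coef (B x) = \<alpha> x)"
proof -
  have "\<exists>f. f \<in> realization \<and> coef f = \<alpha> x \<and> supnorm f \<le> K * supnorm x" if "x \<in> X" for x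
    using converges_in_realization[OF le[OF that]] by metis
  then obtain B where B: "\<And>x. x \<in> X \<Longrightarrow> B x \<in> realization" "\<And>x. x \<in> X \<Longrightarrow> coef (B x) = \<alpha> x"
    "\<And>x. x \<in> X \<Longrightarrow> supnorm (B x) \<le> K * supnorm x" by metis
  have inj: "f = g" if "f \<in> realization" "g \<in> realization" "coef f = coef g" for f g
    using cd_converges_unique[OF coef_converges coef_converges[of g, folded that(3)]] that
    by (simp add: realization_CD)
  have "bounded_op X realization B"
    unfolding bounded_op_def
  proof (intro conjI ballI allI exI[of _ K])
    show "B (fadd x y) = fadd (B x) (B y)" if "x \<in> X" "y \<in> X" for x y
      using that by (intro inj) (auto simp: B coef_add add SB_add[OF X] realization_add fun_eq_iff)
    show "B (fscale c x) = fscale c (B x)" if "x \<in> X" for x c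
      using that by (intro inj) (auto simp: B coef_scale scale SB_scale[OF X] realization_scale fun_eq_iff)
  qed (auto simp: B)
  with B(2) show ?thesis by blast
qed

text \<open>The values at the basis vectors determine the operator on finite combinations; the
  partial sums of \<open>z\<close> are Cauchy, and \<open>le\<close> carries this over to
  \<open>Y\<close>, which is complete.\<close>

lemma ex_bounded_op_from:
  assumes Y: "Y \<in> SB" and y: "\<And>k. y k \<in> Y"
    and le: "\<And>x. x \<in> c00 \<Longrightarrow> supnorm (\<lambda>t. pair (\<lambda>k. y k t) x) \<le> K * p x"
  shows "\<exists>C. bounded_op realization Y C \<and>
    (\<forall>z\<in>realization. cd_converges (\<lambda>N t. pair (\<lambda>k. y k t) (trunc N (coef z))) (C z))"
proof -
  define c where "c x = (\<lambda>t. pair (\<lambda>k. y k t) x)" for x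
  have cY: "c x \<in> Y" for x
    unfolding c_def pair_def mult.commute[of "y _ _"] by (intro SB_sum Y y)
  have c_add: "c (\<lambda>k. x k + x' k) = fadd (c x) (c x')" and c_diff: "c (\<lambda>k. x k - x' k) = fdiff (c x) (c x')"
    and c_scale: "c (\<lambda>k. r * x k) = fscale r (c x)" if "x \<in> c00" "x' \<in> c00" for x x' r
    using that by (simp_all add: c_def fadd_def fdiff_def fscale_def pair_add pair_diff pair_scale)
  have K: "0 \<le> K"
    using order_trans[OF supnorm_nonneg[OF SB_CD[OF Y cY]] le[OF c00_unit_seq, folded c_def, of undefined]]
      unit_pos[of undefined] by (simp add: zero_le_mult_iff)
  have "\<exists>f. f \<in> Y \<and> cd_converges (\<lambda>N. c (trunc N (coef z))) f" if z: "z \<in> realization" for z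
  proof -
    have "cd_Cauchy (\<lambda>N. c (trunc N (coef z)))"
      unfolding cd_Cauchy_def
    proof (intro allI impI)
      fix e :: real assume "0 < e"
      then have "0 < e / (K + 1)" using K by simp
      then obtain N where N: "\<And>n m. N \<le> n \<Longrightarrow> n \<le> m \<Longrightarrow>
          p (\<lambda>k. trunc m (coef z) k - trunc n (coef z) k) \<le> e / (K + 1)"
        using boundedly_complete[OF trunc_coef_le[OF z]] by blast
      have "supnorm (fdiff (c (trunc m (coef z))) (c (trunc n (coef z)))) \<le> e" if "N \<le> n" "n \<le> m" for m n
      proof -
        have "supnorm (fdiff (c (trunc m (coef z))) (c (trunc n (coef z))))
            \<le> K * p (\<lambda>k. trunc m (coef z) k - trunc n (coef z) k)"
          using le[of "\<lambda>k. trunc m (coef z) k - trunc n (coef z) k"]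
            c_diff[of "trunc m (coef z)" "trunc n (coef z)"] unfolding c_def by simp
        also have "\<dots> \<le> K * (e / (K + 1))" using N[OF that] K by (intro mult_left_mono)
        also have "\<dots> \<le> e" using K \<open>0 < e\<close> by (simp add: field_simps)
        finally show ?thesis .
      qed
      then show "\<exists>N. \<forall>n\<ge>N. \<forall>m\<ge>n. supnorm (fdiff (c (trunc m (coef z))) (c (trunc n (coef z)))) \<le> e"
        by blast
    qed
    then show ?thesis using SB_complete[OF Y, of "\<lambda>N. c (trunc N (coef z))"] cY by blast
  qed
  then obtain C where C: "\<And>z. z \<in> realization \<Longrightarrow> C z \<in> Y"
    "\<And>z. z \<in> realization \<Longrightarrow> cd_converges (\<lambda>N. c (trunc N (coef z))) (C z)" by metis
  have CD: "c x \<in> CD" "z \<in> realization \<Longrightarrow> C z \<in> CD" for x z using SB_CD[OF Y] cY C(1) by auto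
  have "bounded_op realization Y C"
    unfolding bounded_op_def
  proof (intro conjI ballI allI exI[of _ K])
    fix f g assume f: "f \<in> realization" and g: "g \<in> realization"
    have "cd_converges (\<lambda>N. c (trunc N (coef (fadd f g)))) (fadd (C f) (C g))"
      using cd_converges_add[OF C(2)[OF f] C(2)[OF g]] f g CD
      by (simp add: coef_add trunc_add c_add)
    then show "C (fadd f g) = fadd (C f) (C g)"
      using cd_converges_unique[OF C(2)[OF realization_add[OF f g]]] f g CD realization_add by simp
  next
    fix f r assume f: "f \<in> realization"
    have "cd_converges (\<lambda>N. c (trunc N (coef (fscale r f)))) (fscale r (C f))"
      using cd_converges_scale[OF C(2)[OF f], of r] f CD
      by (simp add: coef_scale trunc_scale c_scale[of _ "\<lambda>_. 0"])
    then show "C (fscale r f) = fscale r (C f)"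
      using cd_converges_unique[OF C(2)[OF realization_scale[OF f]]] f CD realization_scale by simp
  next
    fix f assume f: "f \<in> realization"
    have "supnorm (c (trunc N (coef f))) \<le> K * supnorm f" for N
      using le[OF c00_trunc, of N "coef f"] mult_left_mono[OF trunc_coef_le[OF f] K, of N]
      unfolding c_def by simp
    then show "supnorm (C f) \<le> K * supnorm f"
      using LIMSEQ_le_const2[OF cd_converges_supnorm[OF C(2)[OF f]]] f CD by blast
  qed (auto simp: C)
  then show ?thesis using C(2) unfolding c_def by blast
qed

end

section \<open>Duals and biduals of closed subspaces\<close>

lemma dual_add: "\<phi> \<in> dual X \<Longrightarrow> \<psi> \<in> dual X \<Longrightarrow> (\<lambda>x. \<phi> x + \<psi> x) \<in> dual X"
proof -
  assume \<phi>: "\<phi> \<in> dual X" and \<psi>: "\<psi> \<in> dual X"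
  obtain K where K: "\<And>x. x \<in> X \<Longrightarrow> \<bar>\<phi> x\<bar> \<le> K * supnorm x"
    using \<phi> unfolding dual_def by blast
  obtain L where L: "\<And>x. x \<in> X \<Longrightarrow> \<bar>\<psi> x\<bar> \<le> L * supnorm x"
    using \<psi> unfolding dual_def by blast
  have "\<bar>\<phi> x + \<psi> x\<bar> \<le> (K + L) * supnorm x" if "x \<in> X" for x
    using K[OF that] L[OF that] by (simp add: distrib_right)
  then show ?thesis using \<phi> \<psi> unfolding dual_def
    by (intro CollectI conjI exI[of _ "K + L"]) (auto simp: algebra_simps)
qed

lemma dual_scale: "\<phi> \<in> dual X \<Longrightarrow> (\<lambda>x. c * \<phi> x) \<in> dual X"
proof -
  assume \<phi>: "\<phi> \<in> dual X"
  obtain K where K: "\<And>x. x \<in> X \<Longrightarrow> \<bar>\<phi> x\<bar> \<le> K * supnorm x"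
    using \<phi> unfolding dual_def by blast
  have "\<bar>c * \<phi> x\<bar> \<le> (\<bar>c\<bar> * K) * supnorm x" if "x \<in> X" for x
    using mult_left_mono[OF K[OF that], of "\<bar>c\<bar>"] by (simp add: abs_mult)
  then show ?thesis using \<phi> unfolding dual_def
    by (intro CollectI conjI exI[of _ "\<bar>c\<bar> * K"]) (auto simp: algebra_simps)
qed

lemma dual_zero: "(\<lambda>_. 0) \<in> dual X"
  by (auto simp: dual_def intro!: exI[of _ 0])

lemma dual_sum: "(\<And>i. i \<in> I \<Longrightarrow> \<phi> i \<in> dual X) \<Longrightarrow> (\<lambda>x. \<Sum>i\<in>I. c i * \<phi> i x) \<in> dual X"
  by (induction I rule: infinite_finite_induct) (auto intro!: dual_add dual_scale simp: dual_zero)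

lemma dual_norm_le:
  assumes "X \<in> SB" "\<And>x. x \<in> X \<Longrightarrow> supnorm x \<le> 1 \<Longrightarrow> \<bar>\<phi> x\<bar> \<le> c"
  shows "dual_norm X \<phi> \<le> c"
  unfolding dual_norm_def using SB_zero[OF assms(1)] assms(2) by (intro cSUP_least) auto

lemma dual_norm_nonneg:
  assumes "X \<in> SB" "\<phi> \<in> dual X" shows "0 \<le> dual_norm X \<phi>"
proof -
  obtain K where K: "\<And>x. x \<in> X \<Longrightarrow> \<bar>\<phi> x\<bar> \<le> K * supnorm x"
    using assms unfolding dual_def by blast
  have bd: "\<bar>\<phi> x\<bar> \<le> \<bar>K\<bar>" if "x \<in> X" "supnorm x \<le> 1" for x
  proof -
    have "\<bar>\<phi> x\<bar> \<le> \<bar>K\<bar> * supnorm x"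
      using K[OF that(1)] mult_right_mono[OF abs_ge_self supnorm_nonneg[OF SB_CD[OF assms(1) that(1)]], of K]
      by linarith
    also have "\<dots> \<le> \<bar>K\<bar> * 1" using that(2) by (intro mult_left_mono) auto
    finally show ?thesis by simp
  qed
  have "0 \<le> \<bar>\<phi> (\<lambda>_. 0)\<bar>" by simp
  also have "\<dots> \<le> dual_norm X \<phi>"
    unfolding dual_norm_def using SB_zero[OF assms(1)] bd by (intro cSUP_upper bdd_aboveI2[where M = "\<bar>K\<bar>"]) auto
  finally show ?thesis .
qed

lemma bidual_add:
  "\<Phi> \<in> bidual X \<Longrightarrow> \<phi> \<in> dual X \<Longrightarrow> \<psi> \<in> dual X \<Longrightarrow> \<Phi> (\<lambda>x. \<phi> x + \<psi> x) = \<Phi> \<phi> + \<Phi> \<psi>"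
  by (auto simp: bidual_def)

lemma bidual_scale: "\<Phi> \<in> bidual X \<Longrightarrow> \<phi> \<in> dual X \<Longrightarrow> \<Phi> (\<lambda>x. c * \<phi> x) = c * \<Phi> \<phi>"
  by (auto simp: bidual_def)

lemma bidual_sum:
  assumes "\<Phi> \<in> bidual X" "\<And>i. i \<in> I \<Longrightarrow> \<phi> i \<in> dual X"
  shows "\<Phi> (\<lambda>x. \<Sum>i\<in>I. c i * \<phi> i x) = (\<Sum>i\<in>I. c i * \<Phi> (\<phi> i))"
proof -
  note add = bidual_add[OF assms(1)] and scale = bidual_scale[OF assms(1)]
  have zero: "\<Phi> (\<lambda>_. 0) = 0" using scale[OF dual_zero, of 0] by simp
  show ?thesis using assms(2)
  proof (induction I rule: infinite_finite_induct)
    case (insert i I)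
    then have "\<Phi> (\<lambda>x. c i * \<phi> i x + (\<Sum>i\<in>I. c i * \<phi> i x)) = c i * \<Phi> (\<phi> i) + (\<Sum>i\<in>I. c i * \<Phi> (\<phi> i))"
      by (subst add) (auto intro: dual_scale dual_sum simp: scale)
    then show ?case using insert.hyps by simp
  qed (simp_all add: zero)
qed

section \<open>Reflexivity from a shrinking and boundedly complete basis\<close>

context basis_norm
begin

definition coord :: "nat \<Rightarrow> cfun \<Rightarrow> real" where
  "coord k = (\<lambda>f. if f \<in> realization then coef f k else 0)"

lemma coord_dual: "coord k \<in> dual realization"
proof -
  have "\<bar>coord k f\<bar> \<le> 2 / p (unit_seq k) * supnorm f" if "f \<in> realization" for f
    using coef_le[OF that, of k] unit_pos[of k] that by (simp add: coord_def field_simps)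
  then show ?thesis
    unfolding dual_def using coef_add coef_scale realization_add realization_scale
    by (intro CollectI conjI exI[of _ "2 / p (unit_seq k)"]) (auto simp: coord_def)
qed

lemma sum_coord:
  "f \<in> realization \<Longrightarrow> (\<Sum>k<n. c k * coord k f) = pair c (trunc n (coef f))"
  by (simp add: coord_def pair_trunc)

lemma dual_comb:
  assumes "\<phi> \<in> dual realization" "x \<in> c00"
  shows "\<phi> (comb x) = pair (\<lambda>k. \<phi> (basis k)) x"
proof -
  have add: "\<phi> (fadd f g) = \<phi> f + \<phi> g" if "f \<in> realization" "g \<in> realization" for f g
    using assms(1) that by (auto simp: dual_def)
  have scale: "\<phi> (fscale c f) = c * \<phi> f" if "f \<in> realization" for c f
    using assms(1) that by (auto simp: dual_def)
  have "\<phi> (comb (trunc n x)) = pair (\<lambda>k. \<phi> (basis k)) (trunc n x)" for n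
  proof (induction n)
    case 0
    have "fscale 0 (comb (trunc 0 x)) = comb (trunc 0 x)"
      by (simp add: fscale_def comb_def pair_trunc)
    then show ?case using scale[OF comb_in_realization[OF c00_trunc], of 0 0 x] by (simp add: pair_trunc)
  next
    case (Suc n)
    have e: "comb (unit_seq n) = basis n" by (simp add: comb_def)
    have "comb (trunc (Suc n) x) = fadd (comb (trunc n x)) (fscale (x n) (basis n))"
      unfolding trunc_Suc e[symmetric] by (simp add: comb_add comb_scale)
    then have "\<phi> (comb (trunc (Suc n) x)) = \<phi> (comb (trunc n x)) + x n * \<phi> (basis n)"
      using comb_in_realization[OF c00_unit_seq, of n]
      by (simp add: add scale comb_in_realization realization_scale e)
    then show ?case using Suc by (simp add: pair_trunc mult.commute)
  qed
  then show ?thesis using c00_trunc_eq[OF assms(2)] by (metis order_refl)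
qed

lemma dual_tendsto:
  assumes \<phi>: "\<phi> \<in> dual realization" and f: "f \<in> realization"
  shows "(\<lambda>N. pair (\<lambda>k. \<phi> (basis k)) (trunc N (coef f))) \<longlonglongrightarrow> \<phi> f"
proof -
  obtain K where K: "\<And>x. x \<in> realization \<Longrightarrow> \<bar>\<phi> x\<bar> \<le> K * supnorm x"
    using \<phi> unfolding dual_def by blast
  have diff: "\<phi> (fdiff g f) = \<phi> g - \<phi> f" if "g \<in> realization" for g
  proof -
    have "fdiff g f = fadd g (fscale (-1) f)" by (simp add: fdiff_def fadd_def fscale_def)
    moreover have "\<phi> (fadd g (fscale (-1) f)) = \<phi> g + \<phi> (fscale (-1) f)"
      using \<phi> that realization_scale[OF f] unfolding dual_def by blast
    moreover have "\<phi> (fscale (-1) f) = (-1) * \<phi> f"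
      using \<phi> f unfolding dual_def by blast
    ultimately show ?thesis by simp
  qed
  have "(\<lambda>N. \<phi> (comb (trunc N (coef f)))) \<longlonglongrightarrow> \<phi> f"
  proof (rule LIM_zero_cancel, rule tendsto_rabs_zero_cancel, rule nonneg_null_squeeze)
    show "(\<lambda>N. K * supnorm (fdiff (comb (trunc N (coef f))) f)) \<longlonglongrightarrow> 0"
      using tendsto_mult[OF tendsto_const coef_converges[OF f, unfolded cd_converges_def], of K] by simp
    show "\<bar>\<phi> (comb (trunc n (coef f))) - \<phi> f\<bar> \<le> K * supnorm (fdiff (comb (trunc n (coef f))) f)" for n
      using K[OF SB_diff[OF realization_SB comb_in_realization[OF c00_trunc] f], of n "coef f"]
        diff[OF comb_in_realization[OF c00_trunc]] by simp
  qed simp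
  then show ?thesis by (simp add: dual_comb[OF \<phi>])
qed

text \<open>James's argument. The values of \<open>\<Phi>\<close> at the coordinate functionals have
  bounded partial sums and hence are the coefficients of some \<open>z\<close>, by bounded
  completeness. Since the basis is shrinking, every \<open>\<phi>\<close> is the norm limit of
  combinations of coordinate functionals, on which \<open>\<Phi>\<close> and evaluation at
  \<open>z\<close> agree.\<close>

theorem reflexive: "reflexive_space realization"
  unfolding reflexive_space_def
proof
  fix \<Phi> assume \<Phi>: "\<Phi> \<in> bidual realization"
  obtain K0 where K0: "\<And>\<phi>. \<phi> \<in> dual realization \<Longrightarrow> \<bar>\<Phi> \<phi>\<bar> \<le> K0 * dual_norm realization \<phi>"
    using \<Phi> unfolding bidual_def by blast
  define K where "K = max K0 0"
  have K: "\<bar>\<Phi> \<phi>\<bar> \<le> K * c"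
    if "\<phi> \<in> dual realization" "\<And>x. x \<in> realization \<Longrightarrow> supnorm x \<le> 1 \<Longrightarrow> \<bar>\<phi> x\<bar> \<le> c" for \<phi> c
  proof -
    have "\<bar>\<Phi> \<phi>\<bar> \<le> K * dual_norm realization \<phi>"
      using K0[OF that(1)] mult_right_mono[OF max.cobounded1 dual_norm_nonneg[OF realization_SB that(1)], of K0 0]
      unfolding K_def by linarith
    also have "\<dots> \<le> K * c"
      using dual_norm_le[OF realization_SB that(2)] by (intro mult_left_mono) (auto simp: K_def)
    finally show ?thesis .
  qed
  define a where "a k = \<Phi> (coord k)" for k
  have "p (trunc n a) \<le> K" for n
  proof -
    \<comment> \<open>A norming functional of the partial sum, cut off at \<open>n\<close>, still
      has norm at most 1 because truncation is a contraction; applying \<open>\<Phi>\<close> to it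
      yields exactly \<open>p (trunc n a)\<close>.\<close>
    obtain \<phi> where \<phi>: "\<And>y. y \<in> c00 \<Longrightarrow> pair \<phi> y \<le> p y" "pair \<phi> (trunc n a) = p (trunc n a)"
      using hahn_banach_c00[OF seminorm c00_trunc] by blast
    have ab: "\<bar>pair \<phi> y\<bar> \<le> p y" if "y \<in> c00" for y
      using \<phi>(1)[OF that] \<phi>(1)[OF c00_minus[OF that]] seminorm00_minus[OF seminorm that]
        pair_scale[OF that, of \<phi> "-1"] by simp
    have "p (trunc n a) = (\<Sum>k<n. \<phi> k * \<Phi> (coord k))"
      using \<phi>(2) by (simp add: pair_trunc a_def)
    also have "\<dots> = \<Phi> (\<lambda>x. \<Sum>k<n. \<phi> k * coord k x)"
      by (rule bidual_sum[OF \<Phi> coord_dual, symmetric])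
    also have "\<dots> \<le> K * 1"
    proof (rule order_trans[OF abs_ge_self K])
      show "(\<lambda>x. \<Sum>k<n. \<phi> k * coord k x) \<in> dual realization" by (intro dual_sum coord_dual)
      show "\<bar>\<Sum>k<n. \<phi> k * coord k x\<bar> \<le> 1" if "x \<in> realization" "supnorm x \<le> 1" for x
        using ab[of "trunc n (coef x)"] trunc_coef_le[OF that(1), of n] that(2)
        by (simp add: sum_coord[OF that(1)])
    qed
    finally show ?thesis by simp
  qed
  then obtain z where z: "z \<in> realization" "coef z = a"
    by (rule converges_in_realization)
  have "\<Phi> \<phi> = \<phi> z" if \<phi>: "\<phi> \<in> dual realization" for \<phi>
  proof -
    define b where "b = (\<lambda>k. \<phi> (basis k))"
    obtain C where C: "\<And>x. x \<in> realization \<Longrightarrow> \<bar>\<phi> x\<bar> \<le> C * supnorm x"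
    using \<phi> unfolding dual_def by blast
    have bC: "\<bar>pair b x\<bar> \<le> C * p x" if "x \<in> c00" for x
      using C[OF comb_in_realization[OF that]] dual_comb[OF \<phi> that] by (simp add: b_def supnorm_comb[OF that])
    have "(\<lambda>N. pair b (trunc N a)) \<longlonglongrightarrow> \<Phi> \<phi>"
    proof (rule LIMSEQ_I)
      fix e :: real assume "0 < e"
      \<comment> \<open>The difference of two contractive truncations has norm at most 2, so the
        final error is \<open>K * (d * 2)\<close>, which is below \<open>e\<close>; the summand 1
        covers \<open>K = 0\<close>.\<close>
      define d where "d = e / (4 * (K + 1))"
      have "0 < d" using \<open>0 < e\<close> by (simp add: d_def K_def)
      obtain n where n: "\<And>x. x \<in> c00 \<Longrightarrow> \<forall>k<n. x k = 0 \<Longrightarrow> \<bar>pair b x\<bar> \<le> d * p x"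
        using shrinking[OF bC \<open>0 < d\<close>] by blast
      have "\<bar>pair b (trunc N a) - \<Phi> \<phi>\<bar> < e" if N: "n \<le> N" for N
      proof -
        define \<psi> where "\<psi> = (\<lambda>x. (\<Sum>k<N. b k * coord k x) + (-1) * \<phi> x)"
        have "\<psi> \<in> dual realization"
          unfolding \<psi>_def by (intro dual_add dual_scale dual_sum coord_dual \<phi>)
        moreover have "\<bar>\<psi> x\<bar> \<le> d * 2" if x: "x \<in> realization" "supnorm x \<le> 1" for x
        proof -
          have "(\<lambda>M. \<bar>pair b (trunc N (coef x)) - pair b (trunc M (coef x))\<bar>) \<longlonglongrightarrow> \<bar>pair b (trunc N (coef x)) - \<phi> x\<bar>"
            using dual_tendsto[OF \<phi> x(1)] unfolding b_def[symmetric] by (intro tendsto_intros)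
          moreover have "\<bar>pair b (trunc N (coef x)) - pair b (trunc M (coef x))\<bar> \<le> d * 2" if "N \<le> M" for M
          proof -
            have "\<bar>pair b (trunc N (coef x)) - pair b (trunc M (coef x))\<bar> = \<bar>pair b (\<lambda>k. trunc N (coef x) k - trunc M (coef x) k)\<bar>"
              by (simp add: pair_diff)
            also have "\<dots> \<le> d * p (\<lambda>k. trunc N (coef x) k - trunc M (coef x) k)"
              using N that by (intro n c00_diff c00_trunc) (simp add: trunc_def)
            also have "\<dots> \<le> d * 2"
              using seminorm00_diff[OF seminorm c00_trunc c00_trunc, of N "coef x" M "coef x"]
                trunc_coef_le[OF x(1), of N] trunc_coef_le[OF x(1), of M] x(2) \<open>0 < d\<close>
              by (intro mult_left_mono) auto
            finally show ?thesis .
          qed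
          ultimately have "\<bar>pair b (trunc N (coef x)) - \<phi> x\<bar> \<le> d * 2"
            by (intro LIMSEQ_le_const2) auto
          then show ?thesis by (simp add: \<psi>_def sum_coord[OF x(1)])
        qed
        ultimately have "\<bar>\<Phi> \<psi>\<bar> \<le> K * (d * 2)" by (rule K)
        moreover have "\<Phi> \<psi> = pair b (trunc N a) - \<Phi> \<phi>"
        proof -
          have "\<Phi> \<psi> = \<Phi> (\<lambda>x. \<Sum>k<N. b k * coord k x) + \<Phi> (\<lambda>x. (-1) * \<phi> x)"
            unfolding \<psi>_def by (intro bidual_add[OF \<Phi>] dual_sum dual_scale coord_dual \<phi>)
          also have "\<Phi> (\<lambda>x. (-1) * \<phi> x) = (-1) * \<Phi> \<phi>"
            by (rule bidual_scale[OF \<Phi> \<phi>])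
          also have "\<Phi> (\<lambda>x. \<Sum>k<N. b k * coord k x) = pair b (trunc N a)"
            unfolding bidual_sum[OF \<Phi> coord_dual] by (simp add: pair_trunc a_def)
          finally show ?thesis by simp
        qed
        moreover have "K * (d * 2) < e"
        proof -
          have "0 \<le> K" by (simp add: K_def)
          then show ?thesis
            using \<open>0 < e\<close> by (simp add: d_def field_simps add_pos_nonneg)
        qed
        ultimately show ?thesis by simp
      qed
      then show "\<exists>n. \<forall>N\<ge>n. norm (pair b (trunc N a) - \<Phi> \<phi>) < e" by auto
    qed
    moreover have "(\<lambda>N. pair b (trunc N a)) \<longlonglongrightarrow> \<phi> z"
      using dual_tendsto[OF \<phi> z(1)] unfolding z(2) b_def .
    ultimately show ?thesis by (rule LIMSEQ_unique)
  qed
  then show "\<exists>x\<in>realization. \<forall>\<phi>\<in>dual realization. \<Phi> \<phi> = \<phi> x" using z(1) by blast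
qed

end

subsection \<open>The Euclidean norm on finite sequences\<close>

definition l2 :: "(nat \<Rightarrow> real) \<Rightarrow> real" where
  "l2 x = sqrt (\<Sum>k. (x k)\<^sup>2)"

lemma l2_eq: "(\<And>k. n \<le> k \<Longrightarrow> x k = 0) \<Longrightarrow> l2 x = L2_set x {..<n}"
proof -
  assume x: "\<And>k. n \<le> k \<Longrightarrow> x k = 0"
  have "(\<Sum>k. (x k)\<^sup>2) = (\<Sum>k<n. (x k)\<^sup>2)"
    by (rule suminf_finite) (auto intro: x simp: not_less)
  then show ?thesis by (simp add: l2_def L2_set_def)
qed

lemma l2_sq: "(\<And>k. n \<le> k \<Longrightarrow> x k = 0) \<Longrightarrow> (l2 x)\<^sup>2 = (\<Sum>k<n. (x k)\<^sup>2)"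
  by (simp add: l2_eq[of n] L2_set_def sum_nonneg)

lemma c00_common:
  assumes "x \<in> c00" "y \<in> c00"
  obtains n where "\<forall>k\<ge>n. x k = 0" "\<forall>k\<ge>n. y k = 0"
proof -
  obtain m where m: "\<forall>k\<ge>m. x k = 0" using assms(1) by (rule c00E)
  obtain n where n: "\<forall>k\<ge>n. y k = 0" using assms(2) by (rule c00E)
  show thesis by (rule that[of "max m n"]) (use m n in auto)
qed

lemma l2_nonneg: "x \<in> c00 \<Longrightarrow> 0 \<le> l2 x"
proof -
  assume "x \<in> c00"
  then obtain n where "\<forall>k\<ge>n. x k = 0" by (rule c00E)
  then show ?thesis by (simp add: l2_eq[of n])
qed

lemma seminorm00_l2: "seminorm00 l2"
  unfolding seminorm00_def
proof (intro conjI ballI allI)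
  fix x y :: "nat \<Rightarrow> real" assume "x \<in> c00" "y \<in> c00"
  then obtain n where "\<forall>k\<ge>n. x k = 0" "\<forall>k\<ge>n. y k = 0" by (rule c00_common)
  then show "l2 (\<lambda>k. x k + y k) \<le> l2 x + l2 y"
    using L2_set_triangle_ineq[of x y "{..<n}"] by (simp add: l2_eq[of n])
next
  fix c :: real and x :: "nat \<Rightarrow> real" assume "x \<in> c00"
  then obtain n where n: "\<forall>k\<ge>n. x k = 0" by (rule c00E)
  then have "l2 (\<lambda>k. c * x k) = L2_set (\<lambda>k. c * x k) {..<n}" by (intro l2_eq) simp
  also have "\<dots> = \<bar>c\<bar> * L2_set x {..<n}"
    by (simp add: L2_set_def power_mult_distrib real_sqrt_mult flip: sum_distrib_left)
  also have "\<dots> = \<bar>c\<bar> * l2 x" using n by (simp add: l2_eq[of n])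
  finally show "l2 (\<lambda>k. c * x k) = \<bar>c\<bar> * l2 x" .
qed

lemma l2_mono:
  assumes "x \<in> c00" "y \<in> c00" "\<And>k. \<bar>x k\<bar> \<le> \<bar>y k\<bar>"
  shows "l2 x \<le> l2 y"
proof -
  obtain n where "\<forall>k\<ge>n. x k = 0" "\<forall>k\<ge>n. y k = 0" using assms(1,2) by (rule c00_common)
  moreover have "L2_set x {..<n} \<le> L2_set y {..<n}"
    unfolding L2_set_def
    by (intro real_sqrt_le_mono sum_mono) (use assms(3) in \<open>simp add: abs_le_square_iff\<close>)
  ultimately show ?thesis by (simp add: l2_eq[of n])
qed

lemma abs_le_l2:
  assumes "x \<in> c00" shows "\<bar>x k\<bar> \<le> l2 x"
proof -
  obtain n where n: "\<forall>k\<ge>n. x k = 0" using assms by (rule c00E)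
  have "\<bar>x k\<bar> \<le> L2_set (\<lambda>k. \<bar>x k\<bar>) {..<max n (Suc k)}"
    by (rule member_le_L2_set) auto
  also have "\<dots> = L2_set x {..<max n (Suc k)}" by (simp add: L2_set_def)
  also have "\<dots> = l2 x" using n by (intro l2_eq[symmetric]) auto
  finally show ?thesis .
qed

lemma l2_le_sum_abs: "(\<And>k. n \<le> k \<Longrightarrow> x k = 0) \<Longrightarrow> l2 x \<le> (\<Sum>k<n. \<bar>x k\<bar>)"
  by (simp add: l2_eq[of n] L2_set_le_sum_abs)

lemma l2_parallelogram:
  assumes "x \<in> c00" "y \<in> c00"
  shows "(l2 (\<lambda>k. x k - y k))\<^sup>2 = 2 * (l2 x)\<^sup>2 + 2 * (l2 y)\<^sup>2 - (l2 (\<lambda>k. x k + y k))\<^sup>2"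
proof -
  obtain n where n: "\<forall>k\<ge>n. x k = 0" "\<forall>k\<ge>n. y k = 0" using assms(1,2) by (rule c00_common)
  have "(\<Sum>k<n. (x k - y k)\<^sup>2) = (\<Sum>k<n. 2 * (x k)\<^sup>2 + 2 * (y k)\<^sup>2 - (x k + y k)\<^sup>2)"
    by (intro sum.cong) (auto simp: power2_eq_square algebra_simps)
  then show ?thesis using n
    by (simp add: l2_sq[of n] sum.distrib sum_subtractf sum_distrib_left)
qed

lemma l2_orthogonal:
  assumes "x \<in> c00" "y \<in> c00" "\<And>k. x k = 0 \<or> y k = 0"
  shows "(l2 (\<lambda>k. x k + y k))\<^sup>2 = (l2 x)\<^sup>2 + (l2 y)\<^sup>2"
proof -
  obtain n where n: "\<forall>k\<ge>n. x k = 0" "\<forall>k\<ge>n. y k = 0" using assms(1,2) by (rule c00_common)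
  have "(x k + y k)\<^sup>2 = (x k)\<^sup>2 + (y k)\<^sup>2" for k using assms(3)[of k] by auto
  then show ?thesis using n by (simp add: l2_sq[of n] sum.distrib)
qed

lemma l2_trunc_le: "x \<in> c00 \<Longrightarrow> l2 (trunc n x) \<le> l2 x"
  by (intro l2_mono) (auto simp: trunc_def)

lemma l2_trunc_diff_le: "x \<in> c00 \<Longrightarrow> l2 (\<lambda>k. trunc n x k - trunc m x k) \<le> l2 x"
  by (intro l2_mono c00_diff) (auto simp: trunc_def)

text \<open>Blocks over disjoint intervals are orthogonal, so the norm of the sum grows like
  \<open>sqrt M\<close> and not like \<open>M\<close>; the averaging argument for the shrinking
  property lives on this gain.\<close>

lemma l2_disjoint_sum:
  assumes z: "\<And>l. l < M \<Longrightarrow> z l \<in> c00" and a: "\<And>l l'. l \<le> l' \<Longrightarrow> a l \<le> (a l' :: nat)"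
    and supp: "\<And>l k. l < M \<Longrightarrow> k < a l \<or> a (Suc l) \<le> k \<Longrightarrow> z l k = 0"
    and c: "\<And>l. l < M \<Longrightarrow> l2 (z l) \<le> c"
  shows "(l2 (\<lambda>k. \<Sum>l<M. z l k))\<^sup>2 \<le> real M * c\<^sup>2"
  using z supp c
proof (induction M)
  case 0
  show ?case using seminorm00_zero[OF seminorm00_l2] by simp
next
  case (Suc M)
  have orth: "(\<Sum>l<M. z l k) = 0 \<or> z M k = 0" for k
  proof (cases "k < a M")
    case False
    have "z l k = 0" if "l < M" for l
      using Suc.prems(2)[of l k] a[of "Suc l" M] that False by auto
    then show ?thesis by simp
  qed (use Suc.prems in auto)
  have "(l2 (\<lambda>k. (\<Sum>l<M. z l k) + z M k))\<^sup>2 = (l2 (\<lambda>k. \<Sum>l<M. z l k))\<^sup>2 + (l2 (z M))\<^sup>2"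
    using Suc.prems by (intro l2_orthogonal c00_sum orth) auto
  also have "\<dots> \<le> real M * c\<^sup>2 + c\<^sup>2"
    using Suc l2_nonneg[of "z M"] by (intro add_mono power_mono) auto
  finally show ?case by (simp add: algebra_simps)
qed

text \<open>This infimal convolution is the K-functional of interpolation theory. Decompositions of
  \<open>x\<close> and \<open>y\<close> add up to one of the sum, and they scale along with the
  vector.\<close>

lemma seminorm00_infconv:
  assumes f: "seminorm00 f" and g: "seminorm00 g"
  shows "seminorm00 (\<lambda>x. INF u\<in>c00. f u + g (\<lambda>k. x k - u k))"
proof -
  define h where "h x = (INF u\<in>c00. f u + g (\<lambda>k. x k - u k))" for x
  have ge0: "0 \<le> f u + g (\<lambda>k. x k - u k)" if "x \<in> c00" "u \<in> c00" for x u
    using that seminorm00_nonneg[OF f] seminorm00_nonneg[OF g] by (intro add_nonneg_nonneg) auto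
  have le: "h x \<le> f u + g (\<lambda>k. x k - u k)" if "x \<in> c00" "u \<in> c00" for x u
    unfolding h_def using that by (intro cINF_lower bdd_belowI2[where m = 0] ge0) auto
  have ge: "c \<le> h x" if "\<And>u. u \<in> c00 \<Longrightarrow> c \<le> f u + g (\<lambda>k. x k - u k)" for c x
    unfolding h_def using that c00_zero by (intro cINF_greatest) auto
  have scale: "h (\<lambda>k. c * x k) \<le> \<bar>c\<bar> * h x" if c: "c \<noteq> 0" and x: "x \<in> c00" for c x
  proof -
    have "h (\<lambda>k. c * x k) / \<bar>c\<bar> \<le> h x"
    proof (rule ge)
      fix u assume u: "u \<in> c00"
      have "h (\<lambda>k. c * x k) \<le> f (\<lambda>k. c * u k) + g (\<lambda>k. c * x k - c * u k)"
        using u x by (intro le) auto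
      also have "(\<lambda>k. c * x k - c * u k) = (\<lambda>k. c * (x k - u k))" by (simp add: algebra_simps)
      also have "f (\<lambda>k. c * u k) + g (\<lambda>k. c * (x k - u k)) = \<bar>c\<bar> * (f u + g (\<lambda>k. x k - u k))"
        using u x by (simp add: seminorm00_scale[OF f] seminorm00_scale[OF g] distrib_left)
      finally show "h (\<lambda>k. c * x k) / \<bar>c\<bar> \<le> f u + g (\<lambda>k. x k - u k)"
        using c by (simp add: field_simps)
    qed
    then show ?thesis using c by (simp add: field_simps)
  qed
  have "seminorm00 h"
    unfolding seminorm00_def
  proof (intro conjI ballI allI)
    fix x y assume x: "x \<in> c00" and y: "y \<in> c00"
    have *: "h (\<lambda>k. x k + y k) \<le> (f u + g (\<lambda>k. x k - u k)) + (f v + g (\<lambda>k. y k - v k))"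
      if "u \<in> c00" "v \<in> c00" for u v
    proof -
      have "h (\<lambda>k. x k + y k) \<le> f (\<lambda>k. u k + v k) + g (\<lambda>k. (x k + y k) - (u k + v k))"
        using that x y by (intro le) auto
      also have "(\<lambda>k. (x k + y k) - (u k + v k)) = (\<lambda>k. (x k - u k) + (y k - v k))"
        by (simp add: algebra_simps)
      finally show ?thesis
        using seminorm00_add[OF f that] seminorm00_add[OF g, of "\<lambda>k. x k - u k" "\<lambda>k. y k - v k"] that x y
        by simp
    qed
    have "h (\<lambda>k. x k + y k) - (f u + g (\<lambda>k. x k - u k)) \<le> h y" if "u \<in> c00" for u
      using *[OF that] by (intro ge) (auto simp: algebra_simps)
    then have "h (\<lambda>k. x k + y k) - h y \<le> h x" by (intro ge) (auto simp: algebra_simps)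
    then show "h (\<lambda>k. x k + y k) \<le> h x + h y" by simp
  next
    fix c :: real and x :: "nat \<Rightarrow> real" assume x: "x \<in> c00"
    show "h (\<lambda>k. c * x k) = \<bar>c\<bar> * h x"
    proof (cases "c = 0")
      case True
      have "h (\<lambda>_. 0) \<le> 0"
        using le[OF c00_zero c00_zero] seminorm00_zero[OF f] seminorm00_zero[OF g] by simp
      moreover have "0 \<le> h (\<lambda>_. 0)" using ge0[OF c00_zero] by (intro ge)
      ultimately show ?thesis using True by simp
    next
      case False
      have "h x = h (\<lambda>k. (1 / c) * (c * x k))" using False by simp
      also have "\<dots> \<le> \<bar>1 / c\<bar> * h (\<lambda>k. c * x k)" using False x by (intro scale) auto
      finally have "\<bar>c\<bar> * h x \<le> h (\<lambda>k. c * x k)" using False by (simp add: field_simps)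
      then show ?thesis using scale[OF False x] by simp
    qed
  qed
  then show ?thesis by (simp add: h_def[abs_def])
qed

subsection \<open>The tree of finite sequences of natural numbers\<close>

text \<open>Nodes are coded so that \<open>child v m\<close> exceeds \<open>v\<close>; the enumeration of the nodes is
  therefore compatible with the tree order, and initial segments of \<open>nat\<close> are subtrees.\<close>

definition child :: "nat \<Rightarrow> nat \<Rightarrow> nat" where
  "child v m = Suc (prod_encode (m, v))"

definition parent :: "nat \<Rightarrow> nat" where
  "parent v = snd (prod_decode (v - 1))"

definition label :: "nat \<Rightarrow> nat" where
  "label v = fst (prod_decode (v - 1))"

lemma parent_child [simp]: "parent (child v m) = v"
  and label_child [simp]: "label (child v m) = m"
  by (simp_all add: child_def parent_def label_def)

lemma child_pos: "0 < child v m"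
  by (simp add: child_def)

lemma parent_less: "0 < v \<Longrightarrow> parent v < v"
  using le_prod_encode_2[of "snd (prod_decode (v - 1))" "fst (prod_decode (v - 1))"]
  by (simp add: parent_def)

lemma label_le: "label v \<le> v"
  using le_prod_encode_1[of "fst (prod_decode (v - 1))" "snd (prod_decode (v - 1))"]
  by (simp add: label_def)

function lev :: "nat \<Rightarrow> nat" where
  "lev v = (if v = 0 then 0 else Suc (lev (parent v)))"
  by auto
termination by (relation "Wellfounded.measure id") (auto simp: parent_less)

declare lev.simps [simp del]

lemma lev_0 [simp]: "lev 0 = 0"
  and lev_pos: "0 < v \<Longrightarrow> lev v = Suc (lev (parent v))"
  by (simp_all add: lev.simps[of 0] lev.simps[of v])

lemma lev_child [simp]: "lev (child v m) = Suc (lev v)"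
  using lev_pos[OF child_pos] by simp

lemma lev_le: "lev v \<le> v"
proof (induction v rule: less_induct)
  case (less v)
  then show ?case using lev_pos[of v] parent_less[of v] by (cases "v = 0") fastforce+
qed

lemma lev_eq_0 [simp]: "lev v = 0 \<longleftrightarrow> v = 0"
  using lev_pos[of v] by (cases "v = 0") auto

text \<open>The ancestor of \<open>b\<close> at level \<open>k\<close>; truncated subtraction makes
  it \<open>b\<close> itself when \<open>k\<close> is at or beyond the level of
  \<open>b\<close>.\<close>

definition anc :: "nat \<Rightarrow> nat \<Rightarrow> nat" where
  "anc b k = (parent ^^ (lev b - k)) b"

lemma anc_self [simp]: "lev b \<le> k \<Longrightarrow> anc b k = b"
  by (simp add: anc_def)

lemma anc_parent: "k < lev b \<Longrightarrow> anc b k = anc (parent b) k"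
proof -
  assume k: "k < lev b"
  then have "lev b = Suc (lev (parent b))" using lev_pos[of b] by (cases "b = 0") auto
  then have "lev b - k = Suc (lev (parent b) - k)" using k by simp
  then show ?thesis by (simp add: anc_def funpow_Suc_right del: funpow.simps)
qed

lemma lev_anc: "k \<le> lev b \<Longrightarrow> lev (anc b k) = k"
proof (induction b rule: less_induct)
  case (less b)
  show ?case
  proof (cases "k = lev b")
    case False
    then have k: "k < lev b" using less.prems by simp
    then have "0 < b" using lev_eq_0[of b] by (cases "b = 0") auto
    then show ?thesis using less.IH[OF parent_less] k lev_pos[of b] anc_parent[OF k] by simp
  qed simp
qed

lemma anc_le: "anc b k \<le> b"
proof (induction b rule: less_induct)
  case (less b)
  show ?case
  proof (cases "k < lev b")
    case True
    then have "0 < b" using lev_eq_0[of b] by (cases "b = 0") auto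
    then show ?thesis using less.IH[OF parent_less] parent_less[of b] anc_parent[OF True] by simp
  qed simp
qed

lemma anc_anc: "j \<le> k \<Longrightarrow> k \<le> lev b \<Longrightarrow> anc (anc b k) j = anc b j"
proof (induction b rule: less_induct)
  case (less b)
  show ?case
  proof (cases "k = lev b")
    case False
    then have k: "k < lev b" using less.prems by simp
    then have "0 < b" using lev_eq_0[of b] by (cases "b = 0") auto
    then show ?thesis
      using less.IH[OF parent_less] less.prems k lev_pos[of b] anc_parent[OF k] anc_parent[of j b] by simp
  qed simp
qed

lemma anc_mono: "j \<le> k \<Longrightarrow> k \<le> lev b \<Longrightarrow> anc b j \<le> anc b k"
  using anc_anc[of j k b] anc_le[of "anc b k" j] by simp

definition desc :: "nat \<Rightarrow> nat set" where
  "desc v = {b. lev v \<le> lev b \<and> anc b (lev v) = v}"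

lemma desc_self: "v \<in> desc v"
  by (simp add: desc_def)

lemma desc_ge: "b \<in> desc v \<Longrightarrow> v \<le> b"
  using anc_le[of b "lev v"] by (auto simp: desc_def)

lemma anc_desc: "b \<in> desc v \<Longrightarrow> lev v \<le> k \<Longrightarrow> k \<le> lev b \<Longrightarrow> anc b k \<in> desc v"
  by (auto simp: desc_def lev_anc anc_anc)

lemma desc_anc: "k \<le> lev b \<Longrightarrow> b \<in> desc (anc b k)"
  by (simp add: desc_def lev_anc)

text \<open>The values on the path from \<open>v\<close> down to \<open>b\<close>, indexed by level,
  so that they can serve as coefficients of the basis whose norm is \<open>\<beta>\<close>. The
  zeros below \<open>lev v\<close> are the restriction to the tail of the expansion.\<close>

definition segment :: "(nat \<Rightarrow> real) \<Rightarrow> nat \<Rightarrow> nat \<Rightarrow> nat \<Rightarrow> real" where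
  "segment x v b = (\<lambda>k. if lev v \<le> k \<and> k \<le> lev b then x (anc b k) else 0)"

lemma segment_c00 [simp]: "segment x v b \<in> c00"
  by (rule c00I[of "Suc (lev b)"]) (simp add: segment_def)

lemma segment_add: "segment (\<lambda>k. x k + y k) v b = (\<lambda>k. segment x v b k + segment y v b k)"
  and segment_scale: "segment (\<lambda>k. c * x k) v b = (\<lambda>k. c * segment x v b k)"
  by (auto simp: segment_def)

text \<open>Different levels of a path are different nodes, so the segment is a rearranged part of
  \<open>x\<close>.\<close>

lemma l2_segment_le:
  assumes "x \<in> c00" shows "l2 (segment x v b) \<le> l2 x"
proof (rule power2_le_imp_le)
  obtain n where n: "\<forall>k\<ge>n. x k = 0" using assms by (rule c00E)
  have inj: "inj_on (anc b) {..lev b}"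
    by (rule inj_onI) (metis atMost_iff lev_anc)
  have "(l2 (segment x v b))\<^sup>2 = (\<Sum>k<Suc (lev b). (segment x v b k)\<^sup>2)"
    by (rule l2_sq) (simp add: segment_def)
  also have "\<dots> \<le> (\<Sum>k\<le>lev b. (x (anc b k))\<^sup>2)"
    unfolding lessThan_Suc_atMost by (rule sum_mono) (simp add: segment_def)
  also have "\<dots> = (\<Sum>t\<in>anc b ` {..lev b}. (x t)\<^sup>2)"
    by (simp add: sum.reindex[OF inj])
  also have "\<dots> \<le> (\<Sum>t<max n (Suc b). (x t)\<^sup>2)"
    by (rule sum_mono2) (auto simp: less_Suc_eq_le le_max_iff_disj less_max_iff_disj anc_le)
  also have "\<dots> = (l2 x)\<^sup>2"
    by (rule l2_sq[symmetric]) (use n in auto)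
  finally show "(l2 (segment x v b))\<^sup>2 \<le> (l2 x)\<^sup>2" .
qed (rule l2_nonneg[OF assms])

subsection \<open>The tree norm\<close>

locale tree_norm =
  fixes \<beta> :: "(nat \<Rightarrow> real) \<Rightarrow> real"
  assumes seminorm_\<beta>: "seminorm00 \<beta>"
    and \<beta>_le_l2: "x \<in> c00 \<Longrightarrow> \<beta> x \<le> l2 x"
    and \<beta>_unit_pos: "0 < \<beta> (unit_seq k)"
begin

text \<open>\<open>N v\<close> is the interpolation seminorm at \<open>v\<close> between the Hilbert norm and \<open>q v\<close>; the label of \<open>v\<close>
  is the weight that the branch chooses for step \<open>lev v\<close>. The summand \<open>q v x / 2 ^ lev v\<close> of \<open>nu\<close>, which is
  harmless along one branch, makes \<open>p\<close> dominate the sequence norm of \<open>l2\<close> at the forks of the tree.\<close>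

definition q :: "nat \<Rightarrow> (nat \<Rightarrow> real) \<Rightarrow> real" where
  "q v x = (SUP b\<in>desc v. \<beta> (segment x v b))"

definition N :: "nat \<Rightarrow> (nat \<Rightarrow> real) \<Rightarrow> real" where
  "N v x = (INF u\<in>c00. l2 u / (real (label v) + 1) + 2 ^ lev v * q v (\<lambda>k. x k - u k))"

definition nu :: "(nat \<Rightarrow> real) \<Rightarrow> nat \<Rightarrow> real" where
  "nu x v = N v x + q v x / 2 ^ lev v"

definition p :: "(nat \<Rightarrow> real) \<Rightarrow> real" where
  "p x = l2 (nu x)"

lemma \<beta>_nonneg: "x \<in> c00 \<Longrightarrow> 0 \<le> \<beta> x"
  by (rule seminorm00_nonneg[OF seminorm_\<beta>])

lemma \<beta>_segment_le: "x \<in> c00 \<Longrightarrow> \<beta> (segment x v b) \<le> l2 x"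
  using \<beta>_le_l2[OF segment_c00, of x v b] l2_segment_le[of x v b] by simp

lemma q_upper: "x \<in> c00 \<Longrightarrow> b \<in> desc v \<Longrightarrow> \<beta> (segment x v b) \<le> q v x"
  unfolding q_def by (rule cSUP_upper) (auto intro!: bdd_aboveI2[where M = "l2 x"] \<beta>_segment_le)

lemma q_least: "(\<And>b. b \<in> desc v \<Longrightarrow> \<beta> (segment x v b) \<le> c) \<Longrightarrow> q v x \<le> c"
  unfolding q_def using desc_self[of v] by (intro cSUP_least) auto

lemma q_le_l2: "x \<in> c00 \<Longrightarrow> q v x \<le> l2 x"
  by (intro q_least \<beta>_segment_le)

lemma seminorm_q: "seminorm00 (q v)"
proof -
  have scale: "q v (\<lambda>k. c * x k) \<le> \<bar>c\<bar> * q v x" if "x \<in> c00" for c x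
    using q_upper[OF that] by (intro q_least)
      (simp add: segment_scale seminorm00_scale[OF seminorm_\<beta>] mult_left_mono)
  show ?thesis
    unfolding seminorm00_def
  proof (intro conjI ballI allI)
    fix x y assume xy: "x \<in> c00" "y \<in> c00"
    show "q v (\<lambda>k. x k + y k) \<le> q v x + q v y"
    proof (rule q_least)
      fix b assume b: "b \<in> desc v"
      have "\<beta> (segment (\<lambda>k. x k + y k) v b) \<le> \<beta> (segment x v b) + \<beta> (segment y v b)"
        unfolding segment_add by (intro seminorm00_add[OF seminorm_\<beta>]) auto
      then show "\<beta> (segment (\<lambda>k. x k + y k) v b) \<le> q v x + q v y"
        using q_upper[OF xy(1) b] q_upper[OF xy(2) b] by simp
    qed
  next
    fix c :: real and x assume x: "x \<in> c00"
    show "q v (\<lambda>k. c * x k) = \<bar>c\<bar> * q v x"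
    proof (cases "c = 0")
      case True
      have "\<beta> (segment (\<lambda>_. 0) v b) = 0" for b
        using seminorm00_zero[OF seminorm_\<beta>] by (simp add: segment_def cong: if_cong)
      moreover have "desc v \<noteq> {}" using desc_self[of v] by blast
      ultimately show ?thesis using True by (simp add: q_def)
    next
      case False
      have "q v x = q v (\<lambda>k. (1 / c) * (c * x k))" using False by simp
      also have "\<dots> \<le> \<bar>1 / c\<bar> * q v (\<lambda>k. c * x k)" using x by (intro scale) auto
      finally have "\<bar>c\<bar> * q v x \<le> q v (\<lambda>k. c * x k)" using False by (simp add: field_simps)
      then show ?thesis using scale[OF x, of c] by simp
    qed
  qed
qed

lemma q_nonneg: "x \<in> c00 \<Longrightarrow> 0 \<le> q v x"
  by (rule seminorm00_nonneg[OF seminorm_q])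

text \<open>All nodes of the subtree at \<open>v\<close> have codes at least \<open>v\<close>. As a
  consequence, only finitely many nodes contribute to \<open>p x\<close> for finitely supported
  \<open>x\<close>.\<close>

lemma q_eq_0: "(\<And>k. v \<le> k \<Longrightarrow> x k = 0) \<Longrightarrow> q v x = 0"
proof -
  assume x: "\<And>k. v \<le> k \<Longrightarrow> x k = 0"
  then have c: "x \<in> c00" by (rule c00I)
  have "segment x v b = (\<lambda>_. 0)" if "b \<in> desc v" for b
    using x desc_ge[OF anc_desc[OF that]] by (auto simp: segment_def)
  then have "q v x \<le> 0"
    by (intro q_least) (simp add: seminorm00_zero[OF seminorm_\<beta>])
  then show ?thesis using q_nonneg[OF c, of v] by simp
qed

lemma q_coord: "x \<in> c00 \<Longrightarrow> \<bar>x v\<bar> * \<beta> (unit_seq (lev v)) \<le> q v x"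
proof -
  assume x: "x \<in> c00"
  have "segment x v v = (\<lambda>k. x v * unit_seq (lev v) k)"
    by (auto simp: segment_def unit_seq_def)
  then show ?thesis
    using q_upper[OF x desc_self, of v] seminorm00_scale[OF seminorm_\<beta>, of "unit_seq (lev v)" "x v"]
    by simp
qed

text \<open>Along a branch the codes increase, so truncation cuts every segment to an initial one.\<close>

lemma q_trunc_le: "x \<in> c00 \<Longrightarrow> q v (trunc n x) \<le> q v x"
proof -
  assume x: "x \<in> c00"
  show ?thesis
  proof (rule q_least)
    fix b assume b: "b \<in> desc v"
    show "\<beta> (segment (trunc n x) v b) \<le> q v x"
    proof (cases "v < n")
      case False
      then have "segment (trunc n x) v b = (\<lambda>_. 0)"
        using desc_ge[OF anc_desc[OF b]] by (fastforce simp: segment_def trunc_def)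
      then show ?thesis using q_nonneg[OF x] by (simp add: seminorm00_zero[OF seminorm_\<beta>])
    next
      case True
      define J where "J = {k. lev v \<le> k \<and> k \<le> lev b \<and> anc b k < n}"
      have J: "finite J" "lev v \<in> J"
        using True b by (auto simp: J_def desc_def intro: finite_subset[of _ "{..lev b}"])
      define j where "j = Max J"
      have j: "j \<in> J" unfolding j_def using J by (intro Max_in) auto
      have lev_j: "lev (anc b j) = j" using j by (intro lev_anc) (simp add: J_def)
      have "segment (trunc n x) v b = segment x v (anc b j)"
      proof
        fix k
        have "anc b k < n" if "lev v \<le> k" "k \<le> j"
          using anc_mono[of k j b] that j by (auto simp: J_def)
        moreover have "\<not> anc b k < n" if "lev v \<le> k" "k \<le> lev b" "\<not> k \<le> j"
          using Max_ge[OF J(1), of k] that unfolding J_def j_def by auto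
        moreover have "anc (anc b j) k = anc b k" if "k \<le> j"
          using that j by (intro anc_anc) (auto simp: J_def)
        ultimately show "segment (trunc n x) v b k = segment x v (anc b j) k"
          using j by (auto simp: segment_def trunc_def lev_j J_def)
      qed
      then show ?thesis using j by (simp add: q_upper[OF x] anc_desc[OF b] J_def)
    qed
  qed
qed

lemma q_trunc_diff_le: "x \<in> c00 \<Longrightarrow> q v (\<lambda>k. trunc n x k - trunc m x k) \<le> 2 * q v x"
  using seminorm00_diff[OF seminorm_q c00_trunc c00_trunc, of v n x m x] q_trunc_le[of x v n] q_trunc_le[of x v m]
  by simp

lemma seminorm_N: "seminorm00 (N v)"
proof -
  have "seminorm00 (\<lambda>u. l2 u / (real (label v) + 1))"
    unfolding seminorm00_def
  proof (intro conjI ballI allI)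
    fix x y assume "x \<in> c00" "y \<in> c00"
    then show "l2 (\<lambda>k. x k + y k) / (real (label v) + 1)
        \<le> l2 x / (real (label v) + 1) + l2 y / (real (label v) + 1)"
      using seminorm00_add[OF seminorm00_l2, of x y] by (simp add: divide_right_mono flip: add_divide_distrib)
  qed (simp add: seminorm00_scale[OF seminorm00_l2])
  moreover have "seminorm00 (\<lambda>u. 2 ^ lev v * q v u)"
    unfolding seminorm00_def
  proof (intro conjI ballI allI)
    fix x y assume "x \<in> c00" "y \<in> c00"
    then show "2 ^ lev v * q v (\<lambda>k. x k + y k) \<le> 2 ^ lev v * q v x + 2 ^ lev v * q v y"
      using seminorm00_add[OF seminorm_q, of x y] by (simp flip: distrib_left)
  qed (simp add: seminorm00_scale[OF seminorm_q])
  ultimately show ?thesis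
    unfolding N_def[abs_def] by (rule seminorm00_infconv)
qed

lemma N_upper:
  "x \<in> c00 \<Longrightarrow> u \<in> c00 \<Longrightarrow> N v x \<le> l2 u / (real (label v) + 1) + 2 ^ lev v * q v (\<lambda>k. x k - u k)"
  unfolding N_def
  by (rule cINF_lower) (auto intro!: bdd_belowI2[where m = 0] add_nonneg_nonneg simp: q_nonneg l2_nonneg)

lemma N_le: "x \<in> c00 \<Longrightarrow> N v x \<le> 2 ^ lev v * q v x"
  using N_upper[OF _ c00_zero, of x v] seminorm00_zero[OF seminorm00_l2] by simp

lemma N_witness:
  assumes x: "x \<in> c00" and "N v x < c"
  obtains u where "u \<in> c00" "l2 u < c * (real (label v) + 1)" "2 ^ lev v * q v (\<lambda>k. x k - u k) < c"
proof -
  have "\<exists>u\<in>c00. l2 u / (real (label v) + 1) + 2 ^ lev v * q v (\<lambda>k. x k - u k) < c"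
    using assms(2) unfolding N_def
    by (subst (asm) cINF_less_iff)
      (auto intro!: bdd_belowI2[where m = 0] add_nonneg_nonneg simp: q_nonneg l2_nonneg x)
  then obtain u where u: "u \<in> c00" "l2 u / (real (label v) + 1) + 2 ^ lev v * q v (\<lambda>k. x k - u k) < c"
    by blast
  have "0 \<le> l2 u / (real (label v) + 1)" "0 \<le> 2 ^ lev v * q v (\<lambda>k. x k - u k)"
    using u x by (simp_all add: l2_nonneg q_nonneg)
  then have "l2 u / (real (label v) + 1) < c" "2 ^ lev v * q v (\<lambda>k. x k - u k) < c" using u by simp_all
  then show thesis using that[OF u(1)] by (simp add: field_simps)
qed

lemma N_nonneg: "x \<in> c00 \<Longrightarrow> 0 \<le> N v x"
  by (rule seminorm00_nonneg[OF seminorm_N])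

text \<open>Truncating both parts of a nearly optimal decomposition decreases both norms.\<close>

lemma N_trunc_le: "x \<in> c00 \<Longrightarrow> N v (trunc n x) \<le> N v x"
proof (rule field_le_epsilon)
  fix e :: real assume x: "x \<in> c00" and "0 < e"
  have "\<exists>u\<in>c00. l2 u / (real (label v) + 1) + 2 ^ lev v * q v (\<lambda>k. x k - u k) < N v x + e"
    using \<open>0 < e\<close> unfolding N_def
    by (subst cINF_less_iff[symmetric])
      (auto intro!: bdd_belowI2[where m = 0] add_nonneg_nonneg simp: q_nonneg l2_nonneg x)
  then obtain u where u: "u \<in> c00" "l2 u / (real (label v) + 1) + 2 ^ lev v * q v (\<lambda>k. x k - u k) < N v x + e"
    by blast
  have "N v (trunc n x) \<le> l2 (trunc n u) / (real (label v) + 1) + 2 ^ lev v * q v (trunc n (\<lambda>k. x k - u k))"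
    using N_upper[OF c00_trunc c00_trunc, of v n x n u] by (simp add: trunc_diff)
  also have "\<dots> \<le> l2 u / (real (label v) + 1) + 2 ^ lev v * q v (\<lambda>k. x k - u k)"
    using u(1) x by (intro add_mono divide_right_mono mult_left_mono l2_trunc_le q_trunc_le) auto
  finally show "N v (trunc n x) \<le> N v x + e" using u(2) by simp
qed

lemma seminorm_nu: "seminorm00 (\<lambda>x. nu x v)"
  unfolding seminorm00_def nu_def
proof (intro conjI ballI allI)
  fix x y assume xy: "x \<in> c00" "y \<in> c00"
  have "q v (\<lambda>k. x k + y k) / 2 ^ lev v \<le> q v x / 2 ^ lev v + q v y / 2 ^ lev v"
    using seminorm00_add[OF seminorm_q xy] by (simp add: divide_right_mono flip: add_divide_distrib)
  then show "N v (\<lambda>k. x k + y k) + q v (\<lambda>k. x k + y k) / 2 ^ lev v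
      \<le> N v x + q v x / 2 ^ lev v + (N v y + q v y / 2 ^ lev v)"
    using seminorm00_add[OF seminorm_N[of v] xy] by linarith
qed (simp add: seminorm00_scale[OF seminorm_q] seminorm00_scale[OF seminorm_N] distrib_left)

lemma nu_nonneg: "x \<in> c00 \<Longrightarrow> 0 \<le> nu x v"
  by (rule seminorm00_nonneg[OF seminorm_nu])

lemma nu_trunc_le: "x \<in> c00 \<Longrightarrow> nu (trunc n x) v \<le> nu x v"
  unfolding nu_def by (intro add_mono N_trunc_le divide_right_mono q_trunc_le) auto

lemma q_le_nu: "x \<in> c00 \<Longrightarrow> q v x \<le> 2 ^ lev v * nu x v"
  using N_nonneg[of x v] by (simp add: nu_def field_simps)

lemma N_le_nu: "x \<in> c00 \<Longrightarrow> N v x \<le> nu x v"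
  using q_nonneg[of x v] by (simp add: nu_def)

lemma nu_le_q: "x \<in> c00 \<Longrightarrow> nu x v \<le> 2 ^ Suc (lev v) * q v x"
proof -
  assume x: "x \<in> c00"
  have "q v x / 2 ^ lev v \<le> q v x / 1" using q_nonneg[OF x] by (intro divide_left_mono) auto
  also have "\<dots> \<le> 2 ^ lev v * q v x"
    using mult_right_mono[of 1 "2 ^ lev v" "q v x"] q_nonneg[OF x, of v] by simp
  finally show ?thesis using N_le[OF x, of v] by (simp add: nu_def)
qed

lemma nu_eq_0: "(\<And>k. v \<le> k \<Longrightarrow> x k = 0) \<Longrightarrow> nu x v = 0"
proof -
  assume x: "\<And>k. v \<le> k \<Longrightarrow> x k = 0"
  then have c: "x \<in> c00" by (rule c00I)
  show ?thesis using nu_le_q[OF c, of v] nu_nonneg[OF c, of v] q_eq_0[OF x] by simp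
qed

lemma nu_c00: "x \<in> c00 \<Longrightarrow> nu x \<in> c00"
proof -
  assume "x \<in> c00"
  then obtain n where n: "\<forall>k\<ge>n. x k = 0" by (rule c00E)
  show ?thesis by (rule c00I[of n]) (rule nu_eq_0, use n in auto)
qed

lemma p_nonneg: "x \<in> c00 \<Longrightarrow> 0 \<le> p x"
  by (simp add: p_def l2_nonneg nu_c00)

lemma nu_le_p: "x \<in> c00 \<Longrightarrow> nu x v \<le> p x"
  using abs_le_l2[OF nu_c00, of x v] by (simp add: p_def)

lemma seminorm_p: "seminorm00 p"
  unfolding seminorm00_def
proof (intro conjI ballI allI)
  fix x y assume xy: "x \<in> c00" "y \<in> c00"
  have "p (\<lambda>k. x k + y k) \<le> l2 (\<lambda>v. nu x v + nu y v)"
    unfolding p_def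
    using seminorm00_add[OF seminorm_nu xy] nu_nonneg xy by (intro l2_mono) (auto simp: nu_c00)
  also have "\<dots> \<le> p x + p y"
    unfolding p_def using xy by (intro seminorm00_add[OF seminorm00_l2]) (auto simp: nu_c00)
  finally show "p (\<lambda>k. x k + y k) \<le> p x + p y" .
next
  fix c :: real and x assume x: "x \<in> c00"
  have "nu (\<lambda>k. c * x k) = (\<lambda>v. \<bar>c\<bar> * nu x v)"
    using seminorm00_scale[OF seminorm_nu x] by auto
  then show "p (\<lambda>k. c * x k) = \<bar>c\<bar> * p x"
    using seminorm00_scale[OF seminorm00_l2 nu_c00[OF x], of "\<bar>c\<bar>"] by (simp add: p_def)
qed

lemma p_trunc_le: "x \<in> c00 \<Longrightarrow> p (trunc n x) \<le> p x"
  unfolding p_def by (rule l2_mono) (auto simp: nu_c00 nu_nonneg nu_trunc_le)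

lemma p_unit_pos: "0 < p (unit_seq v)"
proof -
  have "0 < \<bar>unit_seq v v\<bar> * \<beta> (unit_seq (lev v))" using \<beta>_unit_pos by (simp add: unit_seq_def)
  also have "\<dots> \<le> q v (unit_seq v)" by (rule q_coord) simp
  also have "\<dots> \<le> 2 ^ lev v * nu (unit_seq v) v" by (rule q_le_nu) simp
  also have "\<dots> \<le> 2 ^ lev v * p (unit_seq v)" by (intro mult_left_mono nu_le_p) auto
  finally show ?thesis by (simp add: zero_less_mult_iff)
qed

text \<open>The convexity inherited from the outer \<open>l2\<close> sum: if the norm of a sum is
  nearly maximal, the sequences \<open>nu x\<close> and \<open>nu y\<close> are nearly equal. It
  compares the norms at the nodes and not the vectors themselves.\<close>

lemma p_sum_parallelogram:
  assumes "x \<in> c00" "y \<in> c00"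
  shows "(l2 (\<lambda>v. nu x v - nu y v))\<^sup>2 \<le> 2 * (p x)\<^sup>2 + 2 * (p y)\<^sup>2 - (p (\<lambda>k. x k + y k))\<^sup>2"
proof -
  have "p (\<lambda>k. x k + y k) \<le> l2 (\<lambda>v. nu x v + nu y v)"
    unfolding p_def
    using seminorm00_add[OF seminorm_nu assms] nu_nonneg assms by (intro l2_mono) (auto simp: nu_c00)
  then have "(p (\<lambda>k. x k + y k))\<^sup>2 \<le> (l2 (\<lambda>v. nu x v + nu y v))\<^sup>2"
    using assms by (intro power_mono p_nonneg) auto
  then show ?thesis
    using l2_parallelogram[OF nu_c00[OF assms(1)] nu_c00[OF assms(2)]] by (simp add: p_def)
qed

definition tail_nu :: "nat \<Rightarrow> (nat \<Rightarrow> real) \<Rightarrow> real" where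
  "tail_nu K x = l2 (\<lambda>v. if K \<le> v then nu x v else 0)"

lemma nu_le_tail: "x \<in> c00 \<Longrightarrow> K \<le> v \<Longrightarrow> nu x v \<le> tail_nu K x"
  using abs_le_l2[of "\<lambda>v. if K \<le> v then nu x v else 0" v] nu_c00[of x] unfolding tail_nu_def by simp

lemma tail_nu_add:
  assumes "x \<in> c00" "y \<in> c00" shows "tail_nu K (\<lambda>k. x k + y k) \<le> tail_nu K x + tail_nu K y"
proof -
  have "tail_nu K (\<lambda>k. x k + y k) \<le> l2 (\<lambda>v. (if K \<le> v then nu x v else 0) + (if K \<le> v then nu y v else 0))"
    unfolding tail_nu_def
    using seminorm00_add[OF seminorm_nu assms] nu_nonneg assms by (intro l2_mono) (auto simp: nu_c00)
  also have "\<dots> \<le> tail_nu K x + tail_nu K y"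
    unfolding tail_nu_def using assms by (intro seminorm00_add[OF seminorm00_l2]) (auto simp: nu_c00)
  finally show ?thesis .
qed

lemma tail_nu_minus: "x \<in> c00 \<Longrightarrow> tail_nu K (\<lambda>k. - x k) = tail_nu K x"
proof -
  assume "x \<in> c00"
  then have eq: "nu (\<lambda>k. - x k) = nu x" using seminorm00_minus[OF seminorm_nu, of x] by auto
  show ?thesis unfolding tail_nu_def eq by (rule refl)
qed

text \<open>Beyond the support of \<open>x\<close> the sequence \<open>nu x\<close> vanishes, so
  there the difference is \<open>nu y\<close> up to sign.\<close>

lemma tail_nu_le_diff:
  assumes x: "x \<in> c00" and y: "y \<in> c00" and K: "\<And>k. K \<le> k \<Longrightarrow> x k = 0"
  shows "tail_nu K y \<le> l2 (\<lambda>v. nu x v - nu y v)"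
  unfolding tail_nu_def
  using nu_eq_0[of _ x] K by (intro l2_mono) (auto simp: nu_c00 x y nu_nonneg)

text \<open>The head is estimated by an \<open>l1\<close> sum over its \<open>K\<close> nodes; since
  \<open>lev v \<le> v < K\<close>, the factor in \<open>nu_le_q\<close> is at most
  \<open>2 ^ Suc K\<close> for each of them.\<close>

lemma p_le_head_tail:
  assumes x: "x \<in> c00" and head: "\<And>v. v < K \<Longrightarrow> q v x \<le> r" and tail: "tail_nu K x \<le> s"
  shows "p x \<le> real K * 2 ^ Suc K * r + s"
proof -
  have "p x = l2 (\<lambda>v. trunc K (nu x) v + (if K \<le> v then nu x v else 0))"
    unfolding p_def by (rule arg_cong[of _ _ l2]) (auto simp: trunc_def)
  also have "\<dots> \<le> l2 (trunc K (nu x)) + tail_nu K x"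
    unfolding tail_nu_def using x by (intro seminorm00_add[OF seminorm00_l2]) (auto simp: nu_c00)
  also have "l2 (trunc K (nu x)) \<le> (\<Sum>v<K. \<bar>trunc K (nu x) v\<bar>)"
    by (rule l2_le_sum_abs) (simp add: trunc_def)
  also have "\<dots> \<le> (\<Sum>v<K. 2 ^ Suc K * r)"
  proof (rule sum_mono)
    fix v assume "v \<in> {..<K}"
    then have v: "v < K" by simp
    have "nu x v \<le> 2 ^ Suc (lev v) * q v x" by (rule nu_le_q[OF x])
    also have "\<dots> \<le> 2 ^ Suc K * r"
      using lev_le[of v] v head[OF v] q_nonneg[OF x] by (intro mult_mono power_increasing) auto
    finally show "\<bar>trunc K (nu x) v\<bar> \<le> 2 ^ Suc K * r"
      using v nu_nonneg[OF x] by (simp add: trunc_def)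
  qed
  finally show ?thesis using tail by simp
qed

text \<open>Below level \<open>n\<close> each node of a segment contributes at most \<open>2 ^ n * \<eta>\<close>; what remains of the
  segment lies below a single node of level \<open>n\<close>.\<close>

lemma q_le_levelwise:
  assumes x: "x \<in> c00" and K: "\<And>k. k < K \<Longrightarrow> x k = 0"
    and eta: "\<And>t. K \<le> t \<Longrightarrow> nu x t \<le> \<eta>" and "0 \<le> \<eta>"
    and delta: "\<And>t. t < K \<Longrightarrow> lev t = n \<Longrightarrow> q t x \<le> \<delta>" and "0 \<le> \<delta>"
    and v: "lev v \<le> n"
  shows "q v x \<le> (real n + 1) * 2 ^ n * \<eta> + \<delta>"
proof (rule q_least)
  fix b assume b: "b \<in> desc v"
  define y where "y k = (if lev v \<le> k \<and> k \<le> lev b then x (anc b k) else 0)" for k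
  have big: "q t x \<le> 2 ^ n * \<eta>" if "K \<le> t" "lev t \<le> n" for t
  proof -
    have "q t x \<le> 2 ^ lev t * nu x t" by (rule q_le_nu[OF x])
    also have "\<dots> \<le> 2 ^ n * \<eta>"
      using that eta nu_nonneg[OF x] by (intro mult_mono power_increasing) auto
    finally show ?thesis .
  qed
  have single: "\<bar>y k\<bar> * \<beta> (unit_seq k) \<le> 2 ^ n * \<eta>" if "k < n" for k
  proof (cases "lev v \<le> k \<and> k \<le> lev b \<and> K \<le> anc b k")
    case True
    then have "\<bar>y k\<bar> * \<beta> (unit_seq k) \<le> q (anc b k) x"
      using q_coord[OF x, of "anc b k"] by (simp add: y_def lev_anc)
    also have "\<dots> \<le> 2 ^ n * \<eta>" using True that by (intro big) (auto simp: lev_anc)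
    finally show ?thesis .
  next
    case False
    then have "y k = 0" using K[of "anc b k"] by (auto simp: y_def)
    then show ?thesis using \<open>0 \<le> \<eta>\<close> by simp
  qed
  \<comment> \<open>The node \<open>t\<close> of level \<open>n\<close> on the path is either one of
    the finitely many with code below \<open>K\<close>, where \<open>delta\<close> applies, or its
    own summand in \<open>p\<close> controls the whole subtree below it.\<close>
  have rest: "\<beta> (\<lambda>k. if n \<le> k then y k else 0) \<le> 2 ^ n * \<eta> + \<delta>"
  proof (cases "n \<le> lev b")
    case True
    define t where "t = anc b n"
    have t: "lev t = n" "b \<in> desc t" using True by (auto simp: t_def lev_anc desc_anc)
    have "(\<lambda>k. if n \<le> k then y k else 0) = segment x t b"
      using v by (auto simp: segment_def y_def t)
    then have "\<beta> (\<lambda>k. if n \<le> k then y k else 0) \<le> q t x" using q_upper[OF x t(2)] by simp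
    also have "\<dots> \<le> 2 ^ n * \<eta> + \<delta>"
    proof (cases "t < K")
      case True
      then show ?thesis using delta[OF True t(1)] \<open>0 \<le> \<eta>\<close> by (simp add: add_increasing)
    next
      case False
      then show ?thesis using big[of t] t(1) \<open>0 \<le> \<delta>\<close> by simp
    qed
    finally show ?thesis .
  next
    case False
    then have "(\<lambda>k. if n \<le> k then y k else 0) = (\<lambda>_. 0)" by (auto simp: y_def)
    then show ?thesis using \<open>0 \<le> \<eta>\<close> \<open>0 \<le> \<delta>\<close> by (simp add: seminorm00_zero[OF seminorm_\<beta>])
  qed
  have yc: "y \<in> c00" by (rule c00I[of "Suc (lev b)"]) (simp add: y_def)
  have "segment x v b = (\<lambda>k. (\<Sum>j<n. y j * unit_seq j k) + (if n \<le> k then y k else 0))"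
  proof
    fix k
    have "(\<Sum>j<n. y j * unit_seq j k) = (\<Sum>j<n. if j = k then y j else 0)"
      by (rule sum.cong) (auto simp: unit_seq_def)
    then show "segment x v b k = (\<Sum>j<n. y j * unit_seq j k) + (if n \<le> k then y k else 0)"
      by (simp add: segment_def y_def)
  qed
  then have "\<beta> (segment x v b) \<le> \<beta> (\<lambda>k. \<Sum>j<n. y j * unit_seq j k) + \<beta> (\<lambda>k. if n \<le> k then y k else 0)"
    using yc by (auto intro!: seminorm00_add[OF seminorm_\<beta>] c00_sum)
  also have "\<beta> (\<lambda>k. \<Sum>j<n. y j * unit_seq j k) \<le> (\<Sum>j<n. \<beta> (\<lambda>k. y j * unit_seq j k))"
    by (rule seminorm00_sum[OF seminorm_\<beta>]) auto
  also have "\<dots> \<le> (\<Sum>j<n. 2 ^ n * \<eta>)"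
    using single by (intro sum_mono) (simp add: seminorm00_scale[OF seminorm_\<beta>])
  finally show "\<beta> (segment x v b) \<le> (real n + 1) * 2 ^ n * \<eta> + \<delta>"
    using rest by (simp add: algebra_simps)
qed

end

section \<open>Bounded completeness of the tree norm\<close>

context tree_norm
begin

text \<open>The norms of the partial sums increase to a supremum \<open>s\<close>; take
  \<open>k\<close> where it is nearly reached. For \<open>l \<ge> k\<close> the sum of the two
  truncations truncates to twice the shorter one, so its norm is nearly maximal, and the
  parallelogram estimate makes the two sequences \<open>nu\<close> close.\<close>

lemma tail_nu_bounded_seq:
  assumes C: "\<And>n. p (trunc n a) \<le> C" and eta: "0 < \<eta>"
  shows "\<exists>k. \<forall>l\<ge>k. tail_nu k (trunc l a) \<le> \<eta>"
proof -
  define s where "s = (SUP n. p (trunc n a))"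
  have bdd: "bdd_above (range (\<lambda>n. p (trunc n a)))" using C by (auto intro!: bdd_aboveI2[where M = C])
  have le: "p (trunc n a) \<le> s" for n unfolding s_def by (rule cSUP_upper[OF _ bdd]) simp
  have s0: "0 \<le> s" using le[of 0] p_nonneg[OF c00_trunc, of 0 a] by linarith
  \<comment> \<open>Chosen so that \<open>2 * (e * (2 * (s + 1)))\<close>, the bound on twice the
    difference of the squared norms, equals the square of \<open>\<eta>\<close>.\<close>
  define e where "e = \<eta>\<^sup>2 / (4 * (s + 1))"
  have "0 < e" using eta s0 by (simp add: e_def)
  then have "s - e < (SUP n. p (trunc n a))" by (simp add: s_def)
  then obtain k where k: "s - e < p (trunc k a)"
    using less_cSUP_iff[OF _ bdd, of "s - e"] by auto
  have "tail_nu k (trunc l a) \<le> \<eta>" if l: "k \<le> l" for l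
  proof -
    let ?x = "trunc k a" and ?y = "trunc l a"
    have "trunc k (\<lambda>j. ?x j + ?y j) = (\<lambda>j. 2 * ?x j)" using l by (auto simp: trunc_def)
    then have "2 * p ?x \<le> p (\<lambda>j. ?x j + ?y j)"
      using p_trunc_le[of "\<lambda>j. ?x j + ?y j" k] seminorm00_scale[OF seminorm_p, of ?x 2] by simp
    then have "(2 * p ?x)\<^sup>2 \<le> (p (\<lambda>j. ?x j + ?y j))\<^sup>2"
      by (intro power_mono) (simp_all add: p_nonneg)
    then have "(l2 (\<lambda>v. nu ?x v - nu ?y v))\<^sup>2 \<le> 2 * ((p ?y)\<^sup>2 - (p ?x)\<^sup>2)"
      using p_sum_parallelogram[of ?x ?y] by (simp add: power_mult_distrib)
    also have "(p ?y)\<^sup>2 - (p ?x)\<^sup>2 = (p ?y - p ?x) * (p ?y + p ?x)"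
      by (simp add: power2_eq_square algebra_simps)
    also have "\<dots> \<le> e * (2 * (s + 1))"
    proof (rule mult_mono)
      show "p ?y - p ?x \<le> e" using k le[of l] by simp
      show "p ?y + p ?x \<le> 2 * (s + 1)" using le[of l] le[of k] by simp
    qed (use \<open>0 < e\<close> p_nonneg[OF c00_trunc, of l a] p_nonneg[OF c00_trunc, of k a] in auto)
    also have "2 * (e * (2 * (s + 1))) = \<eta>\<^sup>2"
    proof -
      have "e * (4 * (s + 1)) = \<eta>\<^sup>2" unfolding e_def using s0 by (intro nonzero_eq_divide_eq[THEN iffD1]) auto
      then show ?thesis by (simp add: algebra_simps)
    qed
    finally have "(l2 (\<lambda>v. nu ?x v - nu ?y v))\<^sup>2 \<le> \<eta>\<^sup>2" by simp
    then have "l2 (\<lambda>v. nu ?x v - nu ?y v) \<le> \<eta>" using eta by (auto intro: power2_le_imp_le)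
    moreover have "tail_nu k ?y \<le> l2 (\<lambda>v. nu ?x v - nu ?y v)"
      by (rule tail_nu_le_diff) (auto simp: trunc_def c00_if intro: c00I[of l] c00I[of k])
    ultimately show ?thesis by simp
  qed
  then show ?thesis by blast
qed

text \<open>Modulo an error \<open>2 (C + 1) / 2 ^ lev t\<close> in \<open>q t\<close>, the partial sums are bounded in the
  Hilbert norm, hence have a pointwise limit there.\<close>

lemma q_block_small:
  assumes C: "\<And>n. p (trunc n a) \<le> C" and r: "0 < r" "4 * (C + 1) \<le> r * 2 ^ lev t"
  shows "\<exists>I. \<forall>i\<ge>I. \<forall>j\<ge>i. q t (\<lambda>k. trunc j a k - trunc i a k) \<le> r"
proof -
  define m where "m = (C + 1) * (real (label t) + 1)"
  have "\<exists>u. u \<in> c00 \<and> l2 u < m \<and> 2 ^ lev t * q t (\<lambda>k. trunc l a k - u k) < C + 1" for l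
  proof -
    have "N t (trunc l a) < C + 1"
      using N_le_nu[OF c00_trunc, of t l a] nu_le_p[OF c00_trunc, of l a t] C[of l] by linarith
    from N_witness[OF c00_trunc this] show ?thesis unfolding m_def by blast
  qed
  then obtain u where u: "\<And>l. u l \<in> c00" "\<And>l. l2 (u l) < m"
    "\<And>l. 2 ^ lev t * q t (\<lambda>k. trunc l a k - u l k) < C + 1"
    by metis
  have "\<bar>u l k\<bar> \<le> m" for l k using abs_le_l2[OF u(1), of l k] u(2)[of l] by linarith
  then obtain f w where f: "strict_mono f" and w: "\<And>k. (\<lambda>n. u (f n) k) \<longlonglongrightarrow> w k"
    using pointwise_convergent_subseq[of u "\<lambda>_. m"] by metis
  have "l2 (trunc j w) \<le> m" for j
  proof (rule LIMSEQ_le_const2)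
    have e: "l2 (trunc j y) = L2_set y {..<j}" for y
    proof -
      have "l2 (trunc j y) = L2_set (trunc j y) {..<j}" by (rule l2_eq) (simp add: trunc_def)
      then show ?thesis by (simp add: trunc_def L2_set_def)
    qed
    show "(\<lambda>n. l2 (trunc j (u (f n)))) \<longlonglongrightarrow> l2 (trunc j w)"
      unfolding e L2_set_def by (intro tendsto_intros w)
    show "\<exists>n0. \<forall>n\<ge>n0. l2 (trunc j (u (f n))) \<le> m"
      using l2_trunc_le[OF u(1)] u(2) by (meson less_imp_le order_trans)
  qed
  moreover have l2sq: "(l2 (trunc j w))\<^sup>2 = (\<Sum>k<j. (w k)\<^sup>2)" for j
  proof -
    have "(l2 (trunc j w))\<^sup>2 = (\<Sum>k<j. (trunc j w k)\<^sup>2)" by (rule l2_sq) (simp add: trunc_def)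
    then show ?thesis by (simp add: trunc_def)
  qed
  ultimately have "(\<Sum>k<j. (w k)\<^sup>2) \<le> m\<^sup>2" for j
    unfolding l2sq[symmetric] by (intro power_mono l2_nonneg) auto
  then have summ: "summable (\<lambda>k. (w k)\<^sup>2)" by (intro summableI_nonneg_bounded) auto
  have "0 < (r / 2)\<^sup>2" using r by simp
  then obtain I where I: "\<And>i j. I \<le> i \<Longrightarrow> norm (\<Sum>k\<in>{i..<j}. (w k)\<^sup>2) < (r / 2)\<^sup>2"
    using summ unfolding summable_Cauchy by metis
  have "q t (\<lambda>k. trunc j a k - trunc i a k) \<le> r" if ij: "I \<le> i" "i \<le> j" for i j
  proof -
    define D where "D y = (\<lambda>k. trunc j y k - trunc i y k)" for y :: "nat \<Rightarrow> real"
    have D0: "D y k = (if i \<le> k \<and> k < j then y k else 0)" for y k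
      using ij by (auto simp: D_def trunc_def)
    have Dc: "D y \<in> c00" for y by (rule c00I[of j]) (simp add: D0)
    have l2D: "l2 (D y) = sqrt (\<Sum>k\<in>{i..<j}. (y k)\<^sup>2)" for y
    proof -
      have "l2 (D y) = sqrt (\<Sum>k<j. (D y k)\<^sup>2)"
        using l2_eq[of j "D y"] by (simp add: D0 L2_set_def)
      also have "(\<Sum>k<j. (D y k)\<^sup>2) = (\<Sum>k\<in>{i..<j}. (y k)\<^sup>2)"
        by (rule sum.mono_neutral_cong_right) (auto simp: D0)
      finally show ?thesis .
    qed
    \<comment> \<open>On a block of \<open>a\<close>, the part coming from \<open>u\<close> is
      measured in the Hilbert norm. The remainder has \<open>q t\<close> at most
      \<open>r / 4\<close> by the choice of the level, and cutting out a block doubles this. Passing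
      to the limit replaces \<open>u\<close> by \<open>w\<close>, whose tails are small.\<close>
    have "q t (D a) \<le> r / 2 + l2 (D (u (f n)))" if "j \<le> f n" for n
    proof -
      let ?u = "u (f n)"
      let ?w = "\<lambda>k. trunc (f n) a k - ?u k"
      have "D a = (\<lambda>k. D ?w k + D ?u k)" using that by (auto simp: D0 trunc_def)
      then have "q t (D a) \<le> q t (D ?w) + q t (D ?u)"
        using seminorm00_add[OF seminorm_q Dc Dc, of t ?w ?u] by simp
      moreover have "q t (D ?u) \<le> l2 (D ?u)" by (rule q_le_l2[OF Dc])
      moreover have "q t (D ?w) \<le> r / 2"
      proof -
        have "2 ^ lev t * q t ?w \<le> C + 1" using u(3)[of "f n"] by simp
        then have "4 * (2 ^ lev t * q t ?w) \<le> 4 * (C + 1)" by (rule mult_left_mono) simp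
        also note r(2)
        finally have "4 * (2 ^ lev t * q t ?w) \<le> r * 2 ^ lev t" .
        moreover have "z * (4 * y) \<le> z * r" if "4 * (z * y) \<le> r * z" for y z :: real
          using that by (simp add: ac_simps)
        ultimately have "2 ^ lev t * (4 * q t ?w) \<le> 2 ^ lev t * r" by blast
        then have "4 * q t ?w \<le> r" by (rule mult_left_le_imp_le) simp
        moreover have "q t (D ?w) \<le> 2 * q t ?w"
          unfolding D_def using u(1) by (intro q_trunc_diff_le) auto
        ultimately show ?thesis by simp
      qed
      ultimately show ?thesis by simp
    qed
    moreover have "(\<lambda>n. r / 2 + l2 (D (u (f n)))) \<longlonglongrightarrow> r / 2 + l2 (D w)"
      unfolding l2D by (intro tendsto_intros w)
    moreover have "\<exists>n0. \<forall>n\<ge>n0. j \<le> f n"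
      using seq_suble[OF f] order_trans by blast
    ultimately have "q t (D a) \<le> r / 2 + l2 (D w)"
      by (intro LIMSEQ_le_const) blast+
    also have "l2 (D w) \<le> sqrt ((r / 2)\<^sup>2)"
      unfolding l2D using I[OF ij(1), of j] by (intro real_sqrt_le_mono) simp
    finally show ?thesis using r by (simp add: D_def)
  qed
  then show ?thesis by blast
qed

text \<open>Parameters that bring the right-hand side of \<open>q_le_levelwise\<close> below \<open>r\<close>.\<close>

lemma levelwise_parameters:
  assumes "0 < r" "0 \<le> (c::real)"
  obtains n \<eta> \<delta> where "K \<le> n" "0 < \<eta>" "0 < \<delta>" "(real n + 1) * 2 ^ n * \<eta> + \<delta> \<le> r" "c \<le> \<delta> * 2 ^ n"
proof -
  obtain n0 where n0: "2 * c / r < 2 ^ n0"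
    using real_arch_pow[of 2 "2 * c / r"] by auto
  define n where "n = max K n0"
  have "(2::real) ^ n0 \<le> 2 ^ n" by (simp add: n_def)
  then have "2 * c / r < 2 ^ n" using n0 by linarith
  then have 1: "c \<le> r / 2 * 2 ^ n" using assms by (simp add: field_simps)
  define \<eta> where "\<eta> = r / 2 / ((real n + 1) * 2 ^ n)"
  have pos: "0 < (real n + 1) * 2 ^ n" by simp
  then have "(real n + 1) * 2 ^ n * \<eta> = r / 2" unfolding \<eta>_def
    using nonzero_mult_div_cancel_left[of "(real n + 1) * 2 ^ n" "r / 2"] by (metis less_irrefl times_divide_eq_right)
  moreover have "0 < \<eta>" unfolding \<eta>_def using assms pos by (intro divide_pos_pos) auto
  ultimately show thesis using that[of n \<eta> "r / 2"] 1 assms by (simp add: n_def)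
qed

text \<open>Two cut-offs are needed. Beyond \<open>K1\<close> the norm of a block is small outright,
  so only \<open>q v\<close> for \<open>v < K1\<close> remains. This is reduced to level
  \<open>n\<close>, deep enough for the interpolation error at that level to be small: nodes of code
  at least \<open>K2\<close> are negligible, and for the finitely many others
  \<open>q_block_small\<close> gives a common starting index.\<close>

theorem p_boundedly_complete:
  assumes C: "\<And>n. p (trunc n a) \<le> C" and e: "0 < e"
  shows "\<exists>I. \<forall>i\<ge>I. \<forall>j\<ge>i. p (\<lambda>k. trunc j a k - trunc i a k) \<le> e"
proof -
  have C0: "0 \<le> C" using C[of 0] p_nonneg[OF c00_trunc, of 0 a] by linarith
  have block_tail: "tail_nu K (\<lambda>k. trunc j a k - trunc i a k) \<le> 2 * \<eta>"
    if "\<forall>l\<ge>K. tail_nu K (trunc l a) \<le> \<eta>" "K \<le> i" "i \<le> j" for K \<eta> i j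
    using tail_nu_add[OF c00_trunc c00_minus[OF c00_trunc], of K j a i a]
      tail_nu_minus[OF c00_trunc, of K i a] that(1)[rule_format, of i] that(1)[rule_format, of j] that(2,3)
    by (simp; linarith)
  obtain K1 where K1: "\<forall>l\<ge>K1. tail_nu K1 (trunc l a) \<le> e / 4"
    using tail_nu_bounded_seq[OF C, of "e / 4"] e by auto
  \<comment> \<open>\<open>p_le_head_tail\<close> multiplies the bound on the head by
    \<open>real K1 * 2 ^ Suc K1\<close>; this choice leaves at most \<open>e / 2\<close>, and the
    summand 1 covers \<open>K1 = 0\<close>.\<close>
  define r where "r = e / (2 * (real K1 * 2 ^ Suc K1 + 1))"
  have den: "0 < real K1 * 2 ^ Suc K1 + 1" by (simp add: add_nonneg_pos)
  then have "0 < r" using e by (simp add: r_def)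
  then obtain n \<eta> \<delta> where n: "K1 \<le> n" "0 < \<eta>" "0 < \<delta>" "(real n + 1) * 2 ^ n * \<eta> + \<delta> \<le> r"
    "4 * (C + 1) \<le> \<delta> * 2 ^ n"
    using levelwise_parameters[of r "4 * (C + 1)" K1] C0 by auto
  obtain K2 where K2: "\<forall>l\<ge>K2. tail_nu K2 (trunc l a) \<le> \<eta> / 2"
    using tail_nu_bounded_seq[OF C, of "\<eta> / 2"] n by auto
  have "\<forall>t\<in>{t. t < K2 \<and> lev t = n}. \<exists>I. \<forall>i\<ge>I. \<forall>j\<ge>i. q t (\<lambda>k. trunc j a k - trunc i a k) \<le> \<delta>"
    using q_block_small[OF C n(3)] n(5) by blast
  from bchoice[OF this] obtain I where "\<forall>t\<in>{t. t < K2 \<and> lev t = n}. \<forall>i\<ge>I t. \<forall>j\<ge>i.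
      q t (\<lambda>k. trunc j a k - trunc i a k) \<le> \<delta>" by blast
  then have I: "\<And>t i j. t < K2 \<Longrightarrow> lev t = n \<Longrightarrow> I t \<le> i \<Longrightarrow> i \<le> j \<Longrightarrow>
      q t (\<lambda>k. trunc j a k - trunc i a k) \<le> \<delta>"
    by blast
  define I0 where "I0 = Max (insert (max K1 K2) (I ` {..<K2}))"
  have I0: "K1 \<le> I0" "K2 \<le> I0" "\<And>t. t < K2 \<Longrightarrow> I t \<le> I0"
  proof -
    have "max K1 K2 \<le> I0" unfolding I0_def by (rule Max_ge) auto
    then show "K1 \<le> I0" "K2 \<le> I0" by auto
    show "I t \<le> I0" if "t < K2" for t unfolding I0_def by (rule Max_ge) (use that in auto)
  qed
  have "p (\<lambda>k. trunc j a k - trunc i a k) \<le> e" if ij: "I0 \<le> i" "i \<le> j" for i j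
  proof -
    let ?x = "\<lambda>k. trunc j a k - trunc i a k"
    have x: "?x \<in> c00" by (intro c00_diff c00_trunc)
    have tail2: "tail_nu K2 ?x \<le> \<eta>"
      using block_tail[OF K2, of i j] ij I0 by simp
    have "q v ?x \<le> r" if "v < K1" for v
    proof -
      have "q v ?x \<le> (real n + 1) * 2 ^ n * \<eta> + \<delta>"
      proof (rule q_le_levelwise[OF x, of K2])
        show "trunc j a k - trunc i a k = 0" if "k < K2" for k
          using that ij I0 by (simp add: trunc_def)
        show "nu ?x t \<le> \<eta>" if "K2 \<le> t" for t
          using nu_le_tail[OF x that] tail2 by simp
        show "q t ?x \<le> \<delta>" if "t < K2" "lev t = n" for t
          using I[OF that, of i j] I0(3)[OF that(1)] ij by simp
        show "lev v \<le> n" using lev_le[of v] that n(1) by simp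
      qed (use n in auto)
      then show ?thesis using n(4) by simp
    qed
    moreover have "tail_nu K1 ?x \<le> e / 2" using block_tail[OF K1, of i j] ij I0 by simp
    ultimately have "p ?x \<le> real K1 * 2 ^ Suc K1 * r + e / 2" by (rule p_le_head_tail[OF x])
    also have "real K1 * 2 ^ Suc K1 * r \<le> (real K1 * 2 ^ Suc K1 + 1) * r"
      using \<open>0 < r\<close> by (intro mult_right_mono) auto
    also have "(real K1 * 2 ^ Suc K1 + 1) * r = e / 2"
    proof -
      have "d * (e / (2 * d)) = e / 2" if "0 < d" for d :: real using that by simp
      then show ?thesis unfolding r_def using den by blast
    qed
    finally show ?thesis by simp
  qed
  then show ?thesis by blast
qed

end

section \<open>The shrinking property of the tree norm\<close>

lemma pair_sum:
  "(\<And>i. i \<in> I \<Longrightarrow> x i \<in> c00) \<Longrightarrow> pair \<phi> (\<lambda>k. \<Sum>i\<in>I. x i k) = (\<Sum>i\<in>I. pair \<phi> (x i))"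
  by (induction I rule: infinite_finite_induct) (simp_all add: pair_add)

context tree_norm
begin

text \<open>Averaging \<open>M\<close> successive blocks divides the Hilbert part of each of them by \<open>sqrt M\<close>.\<close>

lemma q_block_average_small:
  assumes z: "\<And>i. z i \<in> c00" "\<And>i. p (z i) \<le> 1"
    and supp: "\<And>i k. k < a i \<or> a (Suc i) \<le> k \<Longrightarrow> z i k = 0"
    and a: "\<And>i j. i \<le> j \<Longrightarrow> a i \<le> (a j :: nat)"
    and d: "0 < d" "16 \<le> d * 2 ^ lev t"
    and M: "0 < M" "(4 * (real (label t) + 1) / d)\<^sup>2 \<le> real M"
  shows "q t (\<lambda>k. (\<Sum>i<M. z i k) / real M) \<le> d"
proof -
  define m where "m = 2 * (real (label t) + 1)"
  have "\<exists>u. u \<in> c00 \<and> l2 u < m \<and> 2 ^ lev t * q t (\<lambda>k. z i k - u k) < 2" for i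
  proof -
    have "N t (z i) < 2"
      using N_le_nu[OF z(1)[of i], of t] nu_le_p[OF z(1)[of i], of t] z(2)[of i] by linarith
    from N_witness[OF z(1) this] show ?thesis unfolding m_def by blast
  qed
  then obtain u where u: "\<And>i. u i \<in> c00" "\<And>i. l2 (u i) < m"
    "\<And>i. 2 ^ lev t * q t (\<lambda>k. z i k - u i k) < 2"
    by metis
  define D where "D i y = (\<lambda>k. trunc (a (Suc i)) y k - trunc (a i) y k)" for i and y :: "nat \<Rightarrow> real"
  have D0: "D i y k = (if a i \<le> k \<and> k < a (Suc i) then y k else 0)" for i y k
    using a[of i "Suc i"] by (auto simp: D_def trunc_def)
  have Dc: "D i y \<in> c00" for i y by (rule c00I[of "a (Suc i)"]) (simp add: D0)
  let ?w = "\<lambda>i k. z i k - u i k"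
  let ?U = "\<lambda>k. \<Sum>i<M. D i (u i) k" and ?W = "\<lambda>k. \<Sum>i<M. D i (?w i) k"
  have UW: "?U \<in> c00" "?W \<in> c00" by (auto intro: c00_sum Dc)
  have z_split: "z i k = D i (u i) k + D i (?w i) k" for i k
    using supp[of k i] by (auto simp: D0)
  have "(\<Sum>i<M. z i k) = ?U k + ?W k" for k
    unfolding sum.distrib[symmetric] by (rule sum.cong[OF refl z_split])
  then have "(\<lambda>k. (\<Sum>i<M. z i k) / real M) = (\<lambda>k. (1 / real M) * (?U k + ?W k))"
    by simp
  then have "q t (\<lambda>k. (\<Sum>i<M. z i k) / real M) = 1 / real M * q t (\<lambda>k. ?U k + ?W k)"
    using seminorm00_scale[OF seminorm_q c00_add[OF UW], of t "1 / real M"] by simp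
  also have "\<dots> \<le> 1 / real M * (l2 ?U + q t ?W)"
    using seminorm00_add[OF seminorm_q UW, of t] q_le_l2[OF UW(1), of t] by (intro mult_left_mono) auto
  \<comment> \<open>The blocks of the Hilbert parts are orthogonal and of norm at most
    \<open>m\<close>, so their sum has norm at most \<open>sqrt M * m\<close>; the lower bound on
    \<open>M\<close> says precisely that this is at most \<open>M * d / 2\<close>.\<close>
  also have "l2 ?U \<le> real M * (d / 2)"
  proof (rule power2_le_imp_le)
    have "(l2 ?U)\<^sup>2 \<le> real M * m\<^sup>2"
    proof (rule l2_disjoint_sum[of M _ a])
      show "l2 (D i (u i)) \<le> m" for i
        using l2_trunc_diff_le[OF u(1), of "a (Suc i)" i "a i"] u(2)[of i] unfolding D_def by linarith
      show "D i (u i) k = 0" if "k < a i \<or> a (Suc i) \<le> k" for i k using that by (auto simp: D0)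
    qed (use Dc a in auto)
    also have "m\<^sup>2 \<le> real M * (d / 2)\<^sup>2"
    proof -
      have "m = (4 * (real (label t) + 1) / d) * (d / 2)" using d by (simp add: m_def)
      then have "m\<^sup>2 = (4 * (real (label t) + 1) / d)\<^sup>2 * (d / 2)\<^sup>2" by (simp only: power_mult_distrib)
      then show ?thesis using M(2) by (simp add: mult_right_mono)
    qed
    finally show "(l2 ?U)\<^sup>2 \<le> (real M * (d / 2))\<^sup>2"
      using M(1) by (simp add: power_mult_distrib power2_eq_square ac_simps mult_left_mono)
  qed (use d in auto)
  \<comment> \<open>The interpolation errors gain nothing from averaging and must be small one by
    one: the bound 2 at weight \<open>2 ^ lev t\<close> and the constant 16 give \<open>q t\<close>
    at most \<open>d / 8\<close> for each, doubled by cutting out the block.\<close>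
  also have "q t ?W \<le> real M * (d / 2)"
  proof -
    have "q t ?W \<le> (\<Sum>i<M. q t (D i (?w i)))" by (rule seminorm00_sum[OF seminorm_q Dc])
    also have "\<dots> \<le> (\<Sum>i<M. d / 2)"
    proof (rule sum_mono)
      fix i
      have "16 * q t (?w i) \<le> d * 2 ^ lev t * q t (?w i)"
        using d(2) u(1) z(1) by (intro mult_right_mono q_nonneg) auto
      also have "\<dots> = d * (2 ^ lev t * q t (?w i))" by simp
      also have "\<dots> \<le> d * 2" using u(3)[of i] d(1) by (intro mult_left_mono) auto
      finally have "16 * q t (?w i) \<le> d * 2" .
      moreover have "q t (D i (?w i)) \<le> 2 * q t (?w i)"
        unfolding D_def using u(1) z(1) by (intro q_trunc_diff_le) auto
      ultimately show "q t (D i (?w i)) \<le> d / 2" using d(1) by linarith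
    qed
    finally show ?thesis by simp
  qed
  finally show ?thesis using M(1) by (simp add: field_simps)
qed

context
  fixes \<phi> :: "nat \<Rightarrow> real" and C e :: real
  assumes \<phi>: "\<And>x. x \<in> c00 \<Longrightarrow> \<bar>pair \<phi> x\<bar> \<le> C * p x" and e: "0 < e"
    and neg: "\<And>n. \<exists>x\<in>c00. (\<forall>k<n. x k = 0) \<and> e * p x < \<bar>pair \<phi> x\<bar>"
begin

definition tail_ball :: "nat \<Rightarrow> (nat \<Rightarrow> real) set" where
  "tail_ball k = {x \<in> c00. (\<forall>j<k. x j = 0) \<and> p x \<le> 1}"

definition tail_norm :: "nat \<Rightarrow> real" where
  "tail_norm k = (SUP x\<in>tail_ball k. pair \<phi> x)"

text \<open>The tail balls decrease with \<open>k\<close>, so this infimum is the limit of the norms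
  of \<open>\<phi>\<close> on the tails; the assumption \<open>neg\<close> keeps it at least
  \<open>e\<close>.\<close>

definition limit_norm :: real where
  "limit_norm = (INF k. tail_norm k)"

private lemma pair_le_C: "x \<in> c00 \<Longrightarrow> pair \<phi> x \<le> \<bar>C\<bar> * p x"
  using \<phi>[of x] mult_right_mono[OF abs_ge_self p_nonneg[of x], of C] by linarith

private lemma tail_norm_upper: "x \<in> tail_ball k \<Longrightarrow> pair \<phi> x \<le> tail_norm k"
  unfolding tail_norm_def
proof (rule cSUP_upper)
  have "pair \<phi> x \<le> \<bar>C\<bar>" if "x \<in> tail_ball k" for x
    using pair_le_C[of x] mult_left_mono[of "p x" 1 "\<bar>C\<bar>"] that by (auto simp: tail_ball_def)
  then show "bdd_above (pair \<phi> ` tail_ball k)" by (auto intro!: bdd_aboveI2[where M = "\<bar>C\<bar>"])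
qed

private lemma tail_norm_ge: "e \<le> tail_norm k"
proof -
  obtain x where x: "x \<in> c00" "\<forall>j<k. x j = 0" "e * p x < \<bar>pair \<phi> x\<bar>" using neg by blast
  have "p x \<noteq> 0" using \<phi>[OF x(1)] x(3) by auto
  then have p: "0 < p x" using p_nonneg[OF x(1)] by simp
  define y where "y = (\<lambda>j. sgn (pair \<phi> x) / p x * x j)"
  have "p y = \<bar>sgn (pair \<phi> x) / p x\<bar> * p x"
    unfolding y_def by (rule seminorm00_scale[OF seminorm_p x(1)])
  also have "\<dots> \<le> 1" using p by (simp add: abs_mult sgn_if)
  finally have "y \<in> tail_ball k" using x by (auto simp: tail_ball_def y_def)
  moreover have "pair \<phi> y = \<bar>pair \<phi> x\<bar> / p x"
    unfolding y_def pair_scale[OF x(1)] by (simp add: abs_sgn mult.commute)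
  ultimately have "\<bar>pair \<phi> x\<bar> / p x \<le> tail_norm k" using tail_norm_upper by metis
  moreover have "e < \<bar>pair \<phi> x\<bar> / p x" using x(3) p by (simp add: field_simps)
  ultimately show ?thesis by simp
qed

private lemma limit_norm_le: "limit_norm \<le> tail_norm k"
  unfolding limit_norm_def using tail_norm_ge by (intro cINF_lower bdd_belowI2[where m = e]) auto

private lemma limit_norm_pos: "0 < limit_norm"
proof -
  have "e \<le> limit_norm" unfolding limit_norm_def using tail_norm_ge by (intro cINF_greatest) auto
  then show ?thesis using e by simp
qed

private lemma near_maximiser:
  assumes "0 < \<epsilon>" shows "\<exists>x\<in>tail_ball k. limit_norm - \<epsilon> < pair \<phi> x"
proof -
  have ne: "tail_ball k \<noteq> {}" using seminorm00_zero[OF seminorm_p] by (auto simp: tail_ball_def intro!: exI[of _ "\<lambda>_. 0"])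
  have "limit_norm - \<epsilon> < tail_norm k" using limit_norm_le[of k] assms by simp
  then show ?thesis unfolding tail_norm_def
    by (rule contrapos_pp) (auto simp: not_less intro!: cSUP_least ne)
qed

text \<open>Near-maximisers of \<open>\<phi>\<close> that are supported far out have sums of norm close to 2, so
  by the parallelogram law their sequences \<open>nu\<close> are close to that of a fixed one.\<close>

private lemma uniform_tails:
  assumes eta: "0 < \<eta>"
  shows "\<exists>k K \<epsilon>. 0 < \<epsilon> \<and> \<epsilon> \<le> limit_norm / 2 \<and>
    (\<forall>y\<in>tail_ball k. limit_norm - \<epsilon> \<le> pair \<phi> y \<longrightarrow> tail_nu K y \<le> \<eta>)"
proof -
  let ?d = limit_norm
  \<comment> \<open>The parallelogram estimate below ends in
    \<open>16 * \<epsilon> / limit_norm\<close>, which must not exceed the square of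
    \<open>\<eta>\<close>.\<close>
  define \<epsilon> where "\<epsilon> = min (?d / 2) (\<eta>\<^sup>2 * ?d / 16)"
  have \<epsilon>: "0 < \<epsilon>" "\<epsilon> \<le> ?d / 2" "\<epsilon> \<le> \<eta>\<^sup>2 * ?d / 16"
    using limit_norm_pos eta by (auto simp: \<epsilon>_def)
  have "\<not> (\<forall>k. ?d + \<epsilon> \<le> tail_norm k)"
  proof
    assume "\<forall>k. ?d + \<epsilon> \<le> tail_norm k"
    then have "?d + \<epsilon> \<le> ?d" unfolding limit_norm_def by (intro cINF_greatest) auto
    then show False using \<epsilon> by simp
  qed
  then obtain k where k: "tail_norm k < ?d + \<epsilon>" by (auto simp: not_le)
  obtain x where x: "x \<in> tail_ball k" "?d - \<epsilon> < pair \<phi> x" using near_maximiser[OF \<epsilon>(1)] by blast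
  have xc: "x \<in> c00" using x by (simp add: tail_ball_def)
  obtain K where K: "\<forall>j\<ge>K. x j = 0" using xc by (rule c00E)
  have "tail_nu K y \<le> \<eta>" if y: "y \<in> tail_ball k" "?d - \<epsilon> \<le> pair \<phi> y" for y
  proof -
    have yc: "y \<in> c00" using y by (simp add: tail_ball_def)
    let ?z = "\<lambda>j. x j + y j"
    have zc: "?z \<in> c00" using xc yc by simp
    have pz: "2 * (?d - \<epsilon>) \<le> pair \<phi> ?z" using x(2) y(2) by (simp add: pair_add xc yc)
    moreover have "0 < 2 * (?d - \<epsilon>)" using \<epsilon>(2) limit_norm_pos by simp
    ultimately have "0 < pair \<phi> ?z" by (rule less_le_trans[rotated])
    then have "p ?z \<noteq> 0" using pair_le_C[OF zc] by auto
    then have z0: "0 < p ?z" using p_nonneg[OF zc] by simp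
    have "(\<lambda>j. (1 / p ?z) * ?z j) \<in> tail_ball k"
      using x y zc z0 seminorm00_scale[OF seminorm_p zc, of "1 / p ?z"] by (auto simp: tail_ball_def)
    then have "pair \<phi> (\<lambda>j. (1 / p ?z) * ?z j) \<le> tail_norm k" by (rule tail_norm_upper)
    then have "pair \<phi> ?z \<le> tail_norm k * p ?z"
      unfolding pair_scale[OF zc] using z0 by (simp add: field_simps)
    also have "\<dots> \<le> (?d + \<epsilon>) * p ?z" using k z0 by (intro mult_right_mono) auto
    finally have up: "2 * (?d - \<epsilon>) \<le> (?d + \<epsilon>) * p ?z" using pz by simp
    \<comment> \<open>A linear lower bound for the quotient of
      \<open>limit_norm - \<epsilon>\<close> by \<open>limit_norm + \<epsilon>\<close>, which bounds
      half the norm of the sum from below.\<close>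
    define w where "w = 1 - 2 * \<epsilon> / ?d"
    have w: "0 \<le> w" "w \<le> 1" using \<epsilon> limit_norm_pos by (simp_all add: w_def field_simps)
    have "w * (?d + \<epsilon>) = ?d - \<epsilon> - 2 * \<epsilon>\<^sup>2 / ?d"
      using limit_norm_pos by (simp add: w_def field_simps power2_eq_square)
    also have "\<dots> \<le> ?d - \<epsilon>" using limit_norm_pos by simp
    finally have "2 * (w * (?d + \<epsilon>)) \<le> 2 * (?d - \<epsilon>)" by simp
    also note up
    also have "2 * (w * (?d + \<epsilon>)) = (?d + \<epsilon>) * (2 * w)" by simp
    finally have "(?d + \<epsilon>) * (2 * w) \<le> (?d + \<epsilon>) * p ?z" .
    then have "2 * w \<le> p ?z" by (rule mult_left_le_imp_le) (use \<epsilon> limit_norm_pos in simp)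
    then have "(2 * w)\<^sup>2 \<le> (p ?z)\<^sup>2" using w by (intro power_mono) auto
    moreover have "(p x)\<^sup>2 \<le> 1" "(p y)\<^sup>2 \<le> 1"
      using x y p_nonneg[OF xc] p_nonneg[OF yc] by (auto simp: tail_ball_def intro: power_le_one)
    ultimately have "(l2 (\<lambda>v. nu x v - nu y v))\<^sup>2 \<le> 4 - (2 * w)\<^sup>2"
      using p_sum_parallelogram[OF xc yc] by linarith
    also have "\<dots> = 4 * ((1 - w) * (1 + w))" by (simp add: power2_eq_square algebra_simps)
    also have "\<dots> \<le> 4 * ((1 - w) * 2)" using w by (intro mult_left_mono) auto
    also have "\<dots> = 16 * \<epsilon> / ?d" by (simp add: w_def)
    also have "\<dots> \<le> \<eta>\<^sup>2" using \<epsilon>(3) limit_norm_pos by (simp add: field_simps)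
    finally have "l2 (\<lambda>v. nu x v - nu y v) \<le> \<eta>" using eta by (auto intro: power2_le_imp_le)
    moreover have "tail_nu K y \<le> l2 (\<lambda>v. nu x v - nu y v)"
      by (rule tail_nu_le_diff[OF xc yc]) (use K in auto)
    ultimately show ?thesis by simp
  qed
  then show ?thesis using \<epsilon> by blast
qed

text \<open>An average \<open>y\<close> of successive near-maximisers is again a near-maximiser, so
  its tails are small by \<open>uniform_tails\<close>. Averaging also makes its head small, at
  finitely many nodes of a deep level and hence at the nodes below \<open>K1\<close>. Thus
  \<open>p y\<close> is too small for the value of \<open>\<phi>\<close> at
  \<open>y\<close>.\<close>

lemma not_shrinking_False: False
proof -
  let ?d = limit_norm
  \<comment> \<open>Head and tail will each be at most \<open>g\<close>, and
    \<open>(\<bar>C\<bar> + 1) * (2 * g)\<close> is a quarter of \<open>limit_norm\<close>, whereas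
    the value of \<open>\<phi>\<close> at \<open>y\<close> is at least half of it.\<close>
  define g where "g = ?d / (8 * (\<bar>C\<bar> + 1))"
  have g0: "0 < g" using limit_norm_pos by (simp add: g_def)
  obtain k1 K1 \<epsilon>1 where 1: "0 < \<epsilon>1" "\<epsilon>1 \<le> ?d / 2"
    "\<forall>y\<in>tail_ball k1. ?d - \<epsilon>1 \<le> pair \<phi> y \<longrightarrow> tail_nu K1 y \<le> g"
    using uniform_tails[OF g0] by blast
  define r where "r = g / (real K1 * 2 ^ Suc K1 + 1)"
  have den: "0 < real K1 * 2 ^ Suc K1 + 1" by (simp add: add_nonneg_pos)
  then have "0 < r" using g0 by (simp add: r_def)
  then obtain n \<eta> \<delta> where n: "K1 \<le> n" "0 < \<eta>" "0 < \<delta>" "(real n + 1) * 2 ^ n * \<eta> + \<delta> \<le> r"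
    "16 \<le> \<delta> * 2 ^ n"
    using levelwise_parameters[of r 16 K1] by auto
  obtain k2 K2 \<epsilon>2 where 2: "0 < \<epsilon>2" "\<epsilon>2 \<le> ?d / 2"
    "\<forall>y\<in>tail_ball k2. ?d - \<epsilon>2 \<le> pair \<phi> y \<longrightarrow> tail_nu K2 y \<le> \<eta>"
    using uniform_tails[OF n(2)] by blast
  define \<epsilon> where "\<epsilon> = min \<epsilon>1 \<epsilon>2"
  have \<epsilon>: "0 < \<epsilon>" "\<epsilon> \<le> \<epsilon>1" "\<epsilon> \<le> \<epsilon>2" using 1 2 by (auto simp: \<epsilon>_def)
  define k0 where "k0 = max (max k1 k2) (max K1 K2)"
  have "\<exists>y. y \<in> tail_ball l \<and> ?d - \<epsilon> \<le> pair \<phi> y" for l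
    using near_maximiser[OF \<epsilon>(1), of l] by (auto intro: less_imp_le)
  then obtain Y where Y: "\<And>l. Y l \<in> tail_ball l" "\<And>l. ?d - \<epsilon> \<le> pair \<phi> (Y l)" by metis
  have "\<exists>b\<ge>l. \<forall>j\<ge>b. Y l j = 0" for l
  proof -
    have "Y l \<in> c00" using Y(1) by (simp add: tail_ball_def)
    then obtain b where "\<forall>j\<ge>b. Y l j = 0" by (rule c00E)
    then show ?thesis by (intro exI[of _ "max b l"]) auto
  qed
  \<comment> \<open>The end of the support of \<open>Y l\<close> is where the next near-maximiser
    starts; iterating \<open>top\<close> yields successive blocks.\<close>
  then obtain top where top: "\<And>l. l \<le> top l" "\<And>l j. top l \<le> j \<Longrightarrow> Y l j = 0" by metis
  define a where "a i = (top ^^ i) k0" for i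
  have a_Suc: "a (Suc i) = top (a i)" for i by (simp add: a_def)
  have a_mono: "a i \<le> a j" if "i \<le> j" for i j
    using that by (rule lift_Suc_mono_le[rotated]) (simp add: a_Suc top(1))
  have a_ge: "k0 \<le> a i" for i using a_mono[of 0 i] by (simp add: a_def)
  define z where "z i = Y (a i)" for i
  have zA: "z i \<in> tail_ball (a i)" for i by (simp add: z_def Y(1))
  have z: "z i \<in> c00" "p (z i) \<le> 1" for i using zA[of i] by (auto simp: tail_ball_def)
  have z_supp: "z i k = 0" if "k < a i \<or> a (Suc i) \<le> k" for i k
    using that zA[of i] top(2)[of "a i" k] by (auto simp: tail_ball_def z_def a_Suc)
  \<comment> \<open>Labels do not exceed codes, so for all relevant nodes \<open>t < K2\<close> the
    label is at most \<open>K2\<close>, and one number of blocks serves them all.\<close>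
  obtain M0 :: nat where M0: "(4 * (real K2 + 1) / \<delta>)\<^sup>2 \<le> real M0" using real_arch_simple by blast
  define M where "M = Suc M0"
  have M: "0 < M" "(4 * (real K2 + 1) / \<delta>)\<^sup>2 \<le> real M" using M0 by (auto simp: M_def)
  define y where "y = (\<lambda>k. (\<Sum>i<M. z i k) / real M)"
  have y_eq: "y = (\<lambda>k. (1 / real M) * (\<Sum>i<M. z i k))" by (simp add: y_def)
  have yc: "y \<in> c00" unfolding y_eq by (intro c00_mult c00_sum z)
  have y0: "y k = 0" if "k < k0" for k
    using that a_ge z_supp by (simp add: y_def) (metis (no_types, lifting) less_le_trans sum.neutral)
  have "p y = 1 / real M * p (\<lambda>k. \<Sum>i<M. z i k)"
    unfolding y_eq by (subst seminorm00_scale[OF seminorm_p]) (auto intro: c00_sum z)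
  also have "\<dots> \<le> 1 / real M * (\<Sum>i<M. p (z i))"
    by (intro mult_left_mono seminorm00_sum[OF seminorm_p] z) auto
  also have "\<dots> \<le> 1 / real M * (\<Sum>i<M. 1)"
    by (intro mult_left_mono sum_mono z) auto
  finally have py: "p y \<le> 1" using M(1) by simp
  have "1 / real M * (\<Sum>i<M. ?d - \<epsilon>) \<le> 1 / real M * (\<Sum>i<M. pair \<phi> (z i))"
    by (intro mult_left_mono sum_mono) (auto simp: z_def Y(2))
  also have "\<dots> = pair \<phi> y"
    unfolding y_eq by (subst pair_scale) (auto simp: pair_sum z intro: c00_sum)
  finally have \<phi>y: "?d - \<epsilon> \<le> pair \<phi> y" using M(1) by simp
  have "y \<in> tail_ball k1" "y \<in> tail_ball k2" using yc py y0 by (auto simp: tail_ball_def k0_def)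
  then have tails: "tail_nu K1 y \<le> g" "tail_nu K2 y \<le> \<eta>" using 1(3) 2(3) \<phi>y \<epsilon> by auto
  have "q v y \<le> r" if "v < K1" for v
  proof -
    have "q v y \<le> (real n + 1) * 2 ^ n * \<eta> + \<delta>"
    proof (rule q_le_levelwise[OF yc, of K2])
      show "y k = 0" if "k < K2" for k using y0 that by (simp add: k0_def)
      show "nu y t \<le> \<eta>" if "K2 \<le> t" for t using nu_le_tail[OF yc that] tails(2) by simp
      show "q t y \<le> \<delta>" if t: "t < K2" "lev t = n" for t
        unfolding y_def
      proof (rule q_block_average_small[OF z z_supp a_mono n(3)])
        have "(4 * (real (label t) + 1) / \<delta>)\<^sup>2 \<le> (4 * (real K2 + 1) / \<delta>)\<^sup>2"
          using label_le[of t] t n(3) by (intro power_mono divide_right_mono) auto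
        then show "(4 * (real (label t) + 1) / \<delta>)\<^sup>2 \<le> real M" using M(2) by simp
      qed (use n(5) t M(1) in auto)
      show "lev v \<le> n" using lev_le[of v] that n(1) by simp
    qed (use n in auto)
    then show ?thesis using n(4) by simp
  qed
  then have "p y \<le> real K1 * 2 ^ Suc K1 * r + g" using p_le_head_tail[OF yc _ tails(1)] by blast
  also have "real K1 * 2 ^ Suc K1 * r \<le> (real K1 * 2 ^ Suc K1 + 1) * r"
    using \<open>0 < r\<close> by (intro mult_right_mono) auto
  also have "(real K1 * 2 ^ Suc K1 + 1) * r = g"
  proof -
    have "d * (g / d) = g" if "0 < d" for d :: real using that by simp
    then show ?thesis unfolding r_def using den by blast
  qed
  finally have "p y \<le> 2 * g" by simp
  then have "pair \<phi> y \<le> (\<bar>C\<bar> + 1) * (2 * g)"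
    using pair_le_C[OF yc] mult_mono[of "\<bar>C\<bar>" "\<bar>C\<bar> + 1" "p y" "2 * g"] p_nonneg[OF yc] by linarith
  also have "\<dots> = ?d / 4"
  proof -
    have "c * (2 * (?d / (8 * c))) = ?d / 4" if "0 < c" for c :: real using that by simp
    moreover have "0 < \<bar>C\<bar> + 1" by simp
    ultimately show ?thesis unfolding g_def by blast
  qed
  finally show False using \<phi>y \<epsilon> 1(2) limit_norm_pos by linarith
qed

end

theorem p_shrinking:
  assumes "\<And>x. x \<in> c00 \<Longrightarrow> \<bar>pair \<phi> x\<bar> \<le> C * p x" "0 < e"
  shows "\<exists>n. \<forall>x\<in>c00. (\<forall>k<n. x k = 0) \<longrightarrow> \<bar>pair \<phi> x\<bar> \<le> e * p x"
proof (rule ccontr)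
  assume "\<not> ?thesis"
  then have "\<exists>x\<in>c00. (\<forall>k<n. x k = 0) \<and> e * p x < \<bar>pair \<phi> x\<bar>" for n
    by (auto simp: not_le)
  with assms show False by (rule not_shrinking_False)
qed

sublocale basis_norm p
  by unfold_locales
    (auto intro: seminorm_p p_unit_pos p_trunc_le p_shrinking p_boundedly_complete)

end

subsection \<open>The Haar system\<close>

abbreviation I01 :: "real measure" where
  "I01 \<equiv> restrict_space lborel {0..1}"

lemma space_I01 [simp]: "space I01 = {0..1}"
  by (simp add: space_restrict_space)

lemma measure_I01: "A \<subseteq> {0..1} \<Longrightarrow> measure I01 A = measure lborel A"
  by (rule measure_restrict_space) auto

lemma finite_measure_I01: "finite_measure I01"
  by (rule finite_measureI) (simp add: emeasure_restrict_space)

interpretation I01: finite_measure I01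
  by (rule finite_measure_I01)

lemma measurable_I01: "f \<in> borel_measurable borel \<Longrightarrow> f \<in> borel_measurable I01"
  by (intro measurable_restrict_space1) simp

lemma integrable_I01_bounded:
  fixes f :: "real \<Rightarrow> real"
  assumes "f \<in> borel_measurable I01" "\<And>t. t \<in> {0..1} \<Longrightarrow> \<bar>f t\<bar> \<le> B"
  shows "integrable I01 f"
  by (rule I01.integrable_const_bound[of _ B]) (use assms in auto)

lemma integrable_I01_mult_bounded:
  fixes f g :: "real \<Rightarrow> real"
  assumes "integrable I01 f" "g \<in> borel_measurable I01" "\<And>t. t \<in> {0..1} \<Longrightarrow> \<bar>g t\<bar> \<le> B"
  shows "integrable I01 (\<lambda>t. f t * g t)"
proof (rule Bochner_Integration.integrable_bound)
  show "integrable I01 (\<lambda>t. B * f t)" using assms(1) by simp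
  show "(\<lambda>t. f t * g t) \<in> borel_measurable I01"
    using assms(1,2) by (intro borel_measurable_times) auto
  have "0 \<le> B" using assms(3)[of 0] by simp
  have "norm (f t * g t) \<le> norm (B * f t)" if "t \<in> {0..1}" for t
    using mult_left_mono[OF assms(3)[OF that], of "\<bar>f t\<bar>"] \<open>0 \<le> B\<close> by (simp add: abs_mult mult.commute)
  then show "AE t in I01. norm (f t * g t) \<le> norm (B * f t)" by (intro AE_I2) simp
qed

lemma integral_mult_le:
  fixes f g :: "real \<Rightarrow> real"
  assumes "integrable I01 f" "g \<in> borel_measurable I01" "\<And>t. t \<in> {0..1} \<Longrightarrow> \<bar>g t\<bar> \<le> B"
  shows "\<bar>LINT t|I01. f t * g t\<bar> \<le> B * (LINT t|I01. \<bar>f t\<bar>)"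
proof -
  have "\<bar>LINT t|I01. f t * g t\<bar> \<le> (LINT t|I01. \<bar>f t * g t\<bar>)"
    by (rule integral_abs_bound)
  also have "\<dots> \<le> (LINT t|I01. B * \<bar>f t\<bar>)"
  proof (rule integral_mono)
    show "integrable I01 (\<lambda>t. \<bar>f t * g t\<bar>)"
      using integrable_I01_mult_bounded[OF assms] by simp
    show "integrable I01 (\<lambda>t. B * \<bar>f t\<bar>)" using assms(1) by simp
    show "\<bar>f t * g t\<bar> \<le> B * \<bar>f t\<bar>" if "t \<in> space I01" for t
      using mult_left_mono[OF assms(3), of t "\<bar>f t\<bar>"] that by (simp add: abs_mult mult.commute)
  qed
  finally show ?thesis using assms(1) by simp
qed

text \<open>The point \<open>1\<close> is put into the last dyadic interval.\<close>

definition idx :: "nat \<Rightarrow> real \<Rightarrow> nat" where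
  "idx n t = (if t < 1 then nat \<lfloor>2 ^ n * t\<rfloor> else 2 ^ n - 1)"

lemma idx_eq_iff:
  assumes "0 \<le> t" "t < 1"
  shows "idx n t = i \<longleftrightarrow> real i \<le> 2 ^ n * t \<and> 2 ^ n * t < real i + 1"
proof -
  have "0 \<le> \<lfloor>2 ^ n * t\<rfloor>" using assms by simp
  then have "idx n t = i \<longleftrightarrow> \<lfloor>2 ^ n * t\<rfloor> = int i" using assms by (auto simp: idx_def)
  then show ?thesis by (simp add: floor_eq_iff)
qed

lemma idx_le: "0 \<le> t \<Longrightarrow> t \<le> 1 \<Longrightarrow> real (idx n t) \<le> 2 ^ n * t"
  and less_idx: "0 \<le> t \<Longrightarrow> t \<le> 1 \<Longrightarrow> 2 ^ n * t \<le> real (idx n t) + 1"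
  using idx_eq_iff[of t n "idx n t"] by (cases "t < 1"; force simp: idx_def of_nat_diff)+

lemma idx_less:
  assumes "0 \<le> t" "t \<le> 1" shows "idx n t < 2 ^ n"
proof (cases "t < 1")
  case True
  have "real (idx n t) \<le> 2 ^ n * t" using idx_le assms by blast
  also have "\<dots> < 2 ^ n" using True by simp
  finally have "real (idx n t) < real (2 ^ n)" by simp
  then show ?thesis by (simp only: of_nat_less_iff)
qed (simp add: idx_def)

lemma idx_Suc:
  assumes "0 \<le> t" "t \<le> 1" shows "idx (Suc n) t div 2 = idx n t"
proof (cases "t < 1")
  case True
  have "\<lfloor>2 ^ Suc n * t\<rfloor> div 2 = \<lfloor>2 ^ n * t\<rfloor>"
    using floor_divide_real_eq_div[of 2 "2 ^ Suc n * t"] by simp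
  then show ?thesis using True assms by (simp add: idx_def nat_div_distrib[symmetric] del: power_Suc)
next
  case False
  have "(2 * (2::nat) ^ n - 1) div 2 = 2 ^ n - 1"
    by (cases "(2::nat) ^ n") auto
  then show ?thesis using False by (simp add: idx_def)
qed

lemma idx_coarser:
  assumes "0 \<le> t" "t \<le> 1" "n \<le> m" shows "idx n t = idx m t div 2 ^ (m - n)"
  using assms(3)
proof (induction m rule: dec_induct)
  case (step m)
  then have "idx n t = idx (Suc m) t div 2 div 2 ^ (m - n)" using idx_Suc[OF assms(1,2)] by simp
  then show ?case using step by (simp add: Suc_diff_le div_mult2_eq)
qed simp

lemma idx_mono:
  assumes "0 \<le> s" "s \<le> t" "t \<le> 1" shows "idx n s \<le> idx n t"
proof (cases "t < 1")
  case True
  then show ?thesis using assms by (auto simp: idx_def intro!: nat_mono floor_mono mult_left_mono)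
next
  case False
  then show ?thesis using idx_less[of s n] assms by (simp add: idx_def)
qed

lemma measurable_idx: "idx n \<in> measurable borel (count_space UNIV)"
  unfolding idx_def by measurable

lemma measurable_idx_I01 [measurable]: "idx n \<in> measurable I01 (count_space UNIV)"
  by (intro measurable_restrict_space1) (simp add: measurable_idx)

lemma measurable_indicator_idx: "(\<lambda>t. indicator {t. P (idx n t)} t :: real) \<in> borel_measurable I01"
proof -
  have "(\<lambda>i. if P i then 1 else 0 :: real) \<in> measurable (count_space UNIV) borel" by simp
  from measurable_compose[OF measurable_idx_I01 this] show ?thesis
    by (simp add: indicator_def[abs_def] of_bool_def)
qed

lemma dyadic_set: "{t \<in> {0..1}. idx n t = i} \<in> sets I01"
proof -
  have "{t \<in> space I01. idx n t = i} \<in> sets I01" by measurable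
  then show ?thesis by simp
qed

lemma measure_dyadic:
  assumes "i < 2 ^ n"
  shows "measure I01 {t \<in> {0..1}. idx n t = i} = 1 / 2 ^ n"
proof -
  let ?S = "{t \<in> {0..1}. idx n t = i}"
  have S: "?S \<in> sets lborel"
  proof -
    have "{t \<in> space borel. idx n t = i} \<in> sets borel"
      using measurable_sets[OF measurable_idx, of "{i}" n] by (simp add: vimage_def)
    then have "{0..1} \<inter> {t \<in> space borel. idx n t = i} \<in> sets borel" by (intro sets.Int) auto
    then show ?thesis by (simp add: Int_def conj_commute)
  qed
  have i: "(real i + 1) / 2 ^ n \<le> 1"
  proof -
    have "real (Suc i) \<le> real (2 ^ n)" using assms by (simp only: of_nat_le_iff Suc_le_eq)
    then show ?thesis by (simp add: add.commute)
  qed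
  have len: "(real i + 1) / 2 ^ n - real i / 2 ^ n = 1 / 2 ^ n" by (simp add: field_simps)
  have le: "real i / 2 ^ n \<le> (real i + 1) / 2 ^ n" by (simp add: divide_right_mono)
  have sub1: "{real i / 2 ^ n<..<(real i + 1) / 2 ^ n} \<subseteq> ?S"
  proof
    fix t assume t: "t \<in> {real i / 2 ^ n<..<(real i + 1) / 2 ^ n}"
    have "0 \<le> real i / 2 ^ n" by simp
    then have t0: "0 \<le> t" using t by (metis greaterThanLessThan_iff less_imp_le order_trans)
    have t1: "t < 1" using t less_le_trans[OF _ i] by simp
    have "idx n t = i" unfolding idx_eq_iff[OF t0 t1] using t by (simp add: field_simps)
    then show "t \<in> ?S" using t0 t1 by simp
  qed
  have sub2: "?S \<subseteq> {real i / 2 ^ n..(real i + 1) / 2 ^ n}"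
  proof
    fix t assume t: "t \<in> ?S"
    then show "t \<in> {real i / 2 ^ n..(real i + 1) / 2 ^ n}"
      using idx_le[of t n] less_idx[of t n] by (auto simp: field_simps)
  qed
  have fin: "emeasure lborel ?S \<noteq> \<infinity>"
    using emeasure_mono[OF sub2, of lborel] le by (auto simp: top_unique)
  have "1 / 2 ^ n = measure lborel {real i / 2 ^ n<..<(real i + 1) / 2 ^ n}" using le len by simp
  also have "\<dots> \<le> measure lborel ?S"
    using fin S sub1 by (intro measure_mono_fmeasurable) (auto simp: fmeasurable_def top.not_eq_extremum)
  finally have "1 / 2 ^ n \<le> measure lborel ?S" .
  moreover have "measure lborel ?S \<le> measure lborel {real i / 2 ^ n..(real i + 1) / 2 ^ n}"
    using sub2 S le by (intro measure_mono_fmeasurable) (auto simp: fmeasurable_def ennreal_less_top)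
  moreover have "measure lborel {real i / 2 ^ n..(real i + 1) / 2 ^ n} = 1 / 2 ^ n" using le len by simp
  ultimately show ?thesis by (subst measure_I01) auto
qed

lemma integral_dyadic:
  assumes "0 \<le> x" "x \<le> 1"
  shows "(LINT y|I01. (if idx n y = idx n x then 2 ^ n else 0)) = (1::real)"
proof -
  let ?S = "{y \<in> {0..1}. idx n y = idx n x}"
  have "(LINT y|I01. (if idx n y = idx n x then 2 ^ n else 0)) = (LINT y|I01. 2 ^ n * (indicator ?S y :: real))"
    by (rule Bochner_Integration.integral_cong) auto
  also have "\<dots> = 2 ^ n * measure I01 (?S \<inter> space I01)"
    using dyadic_set[of n "idx n x"] by simp
  also have "?S \<inter> space I01 = ?S" by auto
  also have "2 ^ n * measure I01 ?S = 1" using measure_dyadic[OF idx_less[OF assms]] by simp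
  finally show ?thesis .
qed

text \<open>Index \<open>2 ^ n + j\<close> belongs to the \<open>j\<close>-th dyadic interval of
  level \<open>n\<close>, with sign plus on its left half; the normalisation is that of
  \<open>L2\<close>.\<close>

definition haar :: "nat \<Rightarrow> real \<Rightarrow> real" where
  "haar k t = (if k = 0 then 1 else
     let n = floor_log k in
     if idx n t = k - 2 ^ n then sqrt (2 ^ n) * (if even (idx (Suc n) t) then 1 else - 1) else 0)"

lemma haar_0 [simp]: "haar 0 t = 1"
  by (simp add: haar_def)

lemma measurable_haar [measurable]: "haar k \<in> borel_measurable I01"
  unfolding haar_def[abs_def] Let_def by measurable

lemma abs_haar_le: "\<bar>haar k t\<bar> \<le> max 1 (sqrt (2 ^ floor_log k))"
  by (auto simp: haar_def Let_def abs_mult)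

text \<open>The partial sums of the Haar system are averages over the atoms of a partition: the
  intervals of level \<open>n\<close> with index at least \<open>j\<close>, and of level \<open>n + 1\<close> for those already split.\<close>

definition haar_kernel :: "nat \<Rightarrow> nat \<Rightarrow> real \<Rightarrow> real \<Rightarrow> real" where
  "haar_kernel n j x y = (if idx n x < j then (if idx (Suc n) y = idx (Suc n) x then 2 ^ Suc n else 0)
     else (if idx n y = idx n x then 2 ^ n else 0))"

text \<open>Adding the Haar function of an interval splits this atom into its halves: the product of
  its values is \<open>2 ^ n\<close> for points in the same half and \<open>- (2 ^ n)\<close>
  otherwise, which turns the weight \<open>2 ^ n\<close> into \<open>2 ^ Suc n\<close> or 0.\<close>

lemma haar_kernel_step:
  assumes x: "0 \<le> x" "x \<le> 1" and y: "0 \<le> y" "y \<le> 1" and j: "j < 2 ^ n"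
  shows "haar_kernel n j x y + haar (2 ^ n + j) x * haar (2 ^ n + j) y = haar_kernel n (Suc j) x y"
proof -
  have fl: "floor_log (2 ^ n + j) = n"
    using j by (intro floor_log_eqI) auto
  have h: "haar (2 ^ n + j) t = (if idx n t = j then sqrt (2 ^ n) * (if even (idx (Suc n) t) then 1 else - 1) else 0)"
    for t using fl by (simp add: haar_def Let_def)
  have s: "sqrt (2 ^ n) * sqrt (2 ^ n) = (2::real) ^ n" by simp
  have eq: "idx (Suc n) x = idx (Suc n) y \<longleftrightarrow> idx n x = idx n y \<and> (even (idx (Suc n) x) \<longleftrightarrow> even (idx (Suc n) y))"
    using idx_Suc[OF x, of n] idx_Suc[OF y, of n] by presburger
  show ?thesis
    unfolding haar_kernel_def h eq[symmetric] less_Suc_eq using s eq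
    by (auto simp: eq_commute[of "idx _ y"])
qed

lemma haar_kernel_sum:
  assumes x: "0 \<le> x" "x \<le> 1" and y: "0 \<le> y" "y \<le> 1" and j: "j \<le> 2 ^ n"
  shows "(\<Sum>k<2 ^ n + j. haar k x * haar k y) = haar_kernel n j x y"
proof -
  have step: "(\<Sum>k<2 ^ n + j. haar k x * haar k y) = haar_kernel n j x y"
    if "(\<Sum>k<2 ^ n. haar k x * haar k y) = haar_kernel n 0 x y" "j \<le> 2 ^ n" for n j
    using that(2)
  proof (induction j)
    case (Suc j)
    then show ?case using haar_kernel_step[OF x y, of j n] by simp
  qed (simp add: that)
  have "(\<Sum>k<2 ^ n. haar k x * haar k y) = haar_kernel n 0 x y" for n
  proof (induction n)
    case 0
    have "idx 0 x = 0" "idx 0 y = 0" using idx_less[OF x, of 0] idx_less[OF y, of 0] by simp_all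
    then show ?case by (simp add: haar_kernel_def)
  next
    case (Suc n)
    have "(\<Sum>k<2 ^ n + 2 ^ n. haar k x * haar k y) = haar_kernel n (2 ^ n) x y"
      by (rule step[OF Suc]) simp
    moreover have "haar_kernel n (2 ^ n) x y = haar_kernel (Suc n) 0 x y"
      using idx_less[OF x, of n] by (simp add: haar_kernel_def)
    ultimately show ?case by (simp add: mult_2)
  qed
  then show ?thesis by (intro step j)
qed

text \<open>For fixed \<open>x\<close> only the atom containing \<open>x\<close> matters;
  \<open>m\<close> is its level, at least \<open>n\<close> as soon as the first \<open>2 ^ n\<close>
  functions are included.\<close>

lemma haar_sum_eq_average:
  assumes x: "0 \<le> x" "x \<le> 1" and N: "2 ^ n \<le> N"
  obtains m where "n \<le> m"
    "\<forall>y\<in>{0..1}. (\<Sum>k<N. haar k x * haar k y) = (if idx m y = idx m x then 2 ^ m else 0)"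
proof -
  define l j where "l = floor_log N" and "j = N - 2 ^ l"
  have "(0::nat) < 2 ^ n" by simp
  then have "0 < N" using N by linarith
  then have l: "2 ^ l \<le> N" "N < 2 * 2 ^ l" unfolding l_def by (simp_all add: floor_log_exp2_le floor_log_exp2_gt)
  have N_eq: "N = 2 ^ l + j" "j \<le> 2 ^ l" using l by (auto simp: j_def)
  have "n \<le> l" using floor_log_le_iff[OF N] by (simp add: l_def)
  define m where "m = (if idx l x < j then Suc l else l)"
  have "\<forall>y\<in>{0..1}. (\<Sum>k<N. haar k x * haar k y) = (if idx m y = idx m x then 2 ^ m else 0)"
    unfolding N_eq(1) using haar_kernel_sum[OF x _ _ N_eq(2)] by (auto simp: haar_kernel_def m_def)
  then show thesis using \<open>n \<le> l\<close> by (intro that[of m]) (auto simp: m_def)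
qed

definition haar_coef :: "(real \<Rightarrow> real) \<Rightarrow> nat \<Rightarrow> real" where
  "haar_coef f k = (LINT t|I01. f t * haar k t)"

lemma integrable_haar_mult: "integrable I01 f \<Longrightarrow> integrable I01 (\<lambda>t. f t * haar k t)"
  by (rule integrable_I01_mult_bounded[OF _ measurable_haar abs_haar_le])

lemma integrable_haar: "integrable I01 (haar k)"
  by (rule integrable_I01_bounded[OF measurable_haar abs_haar_le])

lemma integrable_haar_sum: "integrable I01 (\<lambda>t. \<Sum>k<N. a k * haar k t)"
  by (intro Bochner_Integration.integrable_sum integrable_mult_right integrable_haar)

lemma measurable_haar_sum: "(\<lambda>t. \<Sum>k<N. a k * haar k t) \<in> borel_measurable I01"
  using integrable_haar_sum by (rule borel_measurable_integrable)

lemma integral_haar_sum: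
  assumes "integrable I01 s"
  shows "(LINT t|I01. s t * (\<Sum>k<N. a k * haar k t)) = (\<Sum>k<N. a k * haar_coef s k)"
proof -
  have "(LINT t|I01. s t * (\<Sum>k<N. a k * haar k t)) = (LINT t|I01. (\<Sum>k<N. a k * (s t * haar k t)))"
    by (rule Bochner_Integration.integral_cong) (auto simp: sum_distrib_left mult_ac)
  also have "\<dots> = (\<Sum>k<N. a k * haar_coef s k)"
    using integrable_haar_mult[OF assms] by (simp add: haar_coef_def Bochner_Integration.integral_sum)
  finally show ?thesis .
qed

lemma haar_projection_eq:
  assumes "integrable I01 s"
  shows "(\<Sum>k<N. haar_coef s k * haar k x) = (LINT y|I01. s y * (\<Sum>k<N. haar k x * haar k y))"
  using integral_haar_sum[OF assms, where a = "\<lambda>k. haar k x"] by (simp add: mult.commute)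

lemma haar_projection_bounded:
  assumes s: "s \<in> borel_measurable I01" "\<And>t. t \<in> {0..1} \<Longrightarrow> \<bar>s t\<bar> \<le> B"
    and x: "0 \<le> x" "x \<le> 1"
  shows "\<bar>\<Sum>k<N. haar_coef s k * haar k x\<bar> \<le> B"
proof (cases "N = 0")
  case True
  then show ?thesis using s(2)[of 0] by simp
next
  case False
  then obtain m where m: "\<forall>y\<in>{0..1}. (\<Sum>k<N. haar k x * haar k y) = (if idx m y = idx m x then 2 ^ m else 0)"
    using haar_sum_eq_average[OF x, of 0 N] by auto
  have "(\<Sum>k<N. haar_coef s k * haar k x) = (LINT y|I01. s y * (\<Sum>k<N. haar k x * haar k y))"
    by (rule haar_projection_eq[OF integrable_I01_bounded[OF s]])
  also have "\<dots> = (LINT y|I01. (if idx m y = idx m x then 2 ^ m else 0) * s y)"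
    using m by (intro Bochner_Integration.integral_cong) auto
  also have "\<bar>\<dots>\<bar> \<le> B * (LINT y|I01. \<bar>if idx m y = idx m x then 2 ^ m else (0::real)\<bar>)"
    by (rule integral_mult_le[OF integrable_I01_bounded[where B = "2 ^ m"] s]) auto
  also have "(LINT y|I01. \<bar>if idx m y = idx m x then 2 ^ m else (0::real)\<bar>)
      = (LINT y|I01. (if idx m y = idx m x then 2 ^ m else 0))"
    by (rule Bochner_Integration.integral_cong) auto
  finally show ?thesis using integral_dyadic[OF x, of m] by simp
qed

text \<open>Duality: the kernel is symmetric, so the projection can be moved from \<open>f\<close>
  to the sign of the partial sum, where it preserves the bound 1.\<close>

lemma haar_projection_L1:
  assumes f: "integrable I01 f"
  shows "(LINT t|I01. \<bar>\<Sum>k<N. haar_coef f k * haar k t\<bar>) \<le> (LINT t|I01. \<bar>f t\<bar>)"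
proof -
  let ?g = "\<lambda>t. \<Sum>k<N. haar_coef f k * haar k t"
  define s where "s t = sgn (?g t)" for t
  have s: "s \<in> borel_measurable I01" "\<And>t. \<bar>s t\<bar> \<le> 1"
    using measurable_compose[OF measurable_haar_sum borel_measurable_sgn] by (simp_all add: s_def[abs_def] sgn_if)
  have "(LINT t|I01. \<bar>?g t\<bar>) = (LINT t|I01. s t * ?g t)"
    by (simp add: s_def abs_sgn mult.commute)
  also have "\<dots> = (\<Sum>k<N. haar_coef f k * haar_coef s k)"
    by (rule integral_haar_sum[OF integrable_I01_bounded[OF s]])
  also have "\<dots> = (LINT t|I01. f t * (\<Sum>k<N. haar_coef s k * haar k t))"
    using integral_haar_sum[OF f, where a = "haar_coef s"] by (simp add: mult.commute)
  also have "\<dots> \<le> 1 * (LINT t|I01. \<bar>f t\<bar>)"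
    by (rule order_trans[OF abs_ge_self integral_mult_le[OF f measurable_haar_sum]])
      (use haar_projection_bounded[OF s] in auto)
  finally show ?thesis by simp
qed

text \<open>The sum of squares is the integral of \<open>u\<close> against its own partial sum, and
  the latter is an average of \<open>u\<close>, hence bounded by \<open>B\<close>.\<close>

lemma haar_bessel:
  assumes u: "u \<in> borel_measurable I01" "\<And>t. t \<in> {0..1} \<Longrightarrow> \<bar>u t\<bar> \<le> B"
  shows "(\<Sum>k<N. (haar_coef u k)\<^sup>2) \<le> B\<^sup>2"
proof -
  have i: "integrable I01 u" by (rule integrable_I01_bounded[OF u])
  have "(\<Sum>k<N. (haar_coef u k)\<^sup>2) = (LINT t|I01. u t * (\<Sum>k<N. haar_coef u k * haar k t))"
    using integral_haar_sum[OF i, where a = "haar_coef u"] by (simp add: power2_eq_square)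
  also have "\<dots> \<le> B * (LINT t|I01. \<bar>u t\<bar>)"
    by (rule order_trans[OF abs_ge_self integral_mult_le[OF i measurable_haar_sum]])
      (use haar_projection_bounded[OF u] in auto)
  also have "(LINT t|I01. \<bar>u t\<bar>) \<le> (LINT t|I01. B)"
    using i u(2) by (intro integral_mono) auto
  also have "(LINT t|I01. B) = B" by (simp add: measure_I01)
  finally show ?thesis using u(2)[of 0] by (simp add: power2_eq_square mult_left_mono)
qed

text \<open>Pair with the sign of the sum and apply Cauchy-Schwarz; the coefficients of the sign
  have Hilbert norm at most 1 by \<open>haar_bessel\<close>.\<close>

lemma haar_sum_L1_le_l2:
  "(LINT t|I01. \<bar>\<Sum>k<N. a k * haar k t\<bar>) \<le> L2_set a {..<N}"
proof -
  let ?g = "\<lambda>t. \<Sum>k<N. a k * haar k t"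
  define s where "s t = sgn (?g t)" for t
  have s: "s \<in> borel_measurable I01" "\<And>t. \<bar>s t\<bar> \<le> 1"
    using measurable_compose[OF measurable_haar_sum borel_measurable_sgn] by (simp_all add: s_def[abs_def] sgn_if)
  have "(LINT t|I01. \<bar>?g t\<bar>) = (LINT t|I01. s t * ?g t)"
    by (simp add: s_def abs_sgn mult.commute)
  also have "\<dots> = (\<Sum>k<N. a k * haar_coef s k)"
    by (rule integral_haar_sum[OF integrable_I01_bounded[OF s]])
  also have "\<dots> \<le> (\<Sum>k<N. \<bar>a k\<bar> * \<bar>haar_coef s k\<bar>)"
    by (rule sum_mono) (metis abs_ge_self abs_mult)
  also have "\<dots> \<le> L2_set a {..<N} * L2_set (haar_coef s) {..<N}"
    by (rule L2_set_mult_ineq)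
  also have "L2_set (haar_coef s) {..<N} \<le> 1"
    unfolding L2_set_def using haar_bessel[of s 1 N] s by simp
  finally show ?thesis by (simp add: mult_left_mono)
qed

text \<open>Moved to the indicator, the projection averages over atoms of level at least
  \<open>n\<close>, on which the indicator is constant, and so reproduces it.\<close>

lemma haar_projection_dyadic:
  assumes f: "integrable I01 f" and N: "2 ^ n \<le> N"
  shows "(LINT t|I01. indicator {t. idx n t = i} t * (\<Sum>k<N. haar_coef f k * haar k t))
    = (LINT t|I01. indicator {t. idx n t = i} t * f t)"
proof -
  let ?d = "\<lambda>t. indicator {t. idx n t = i} t :: real"
  have d: "?d \<in> borel_measurable I01" "\<And>t. \<bar>?d t\<bar> \<le> 1"
    using measurable_indicator_idx[of "\<lambda>j. j = i" n] by (simp_all add: indicator_def)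
  have id: "integrable I01 ?d" by (rule integrable_I01_bounded[OF d])
  have "(\<Sum>k<N. haar_coef ?d k * haar k x) = ?d x" if x: "0 \<le> x" "x \<le> 1" for x
  proof -
    obtain m where m: "n \<le> m"
      "\<forall>y\<in>{0..1}. (\<Sum>k<N. haar k x * haar k y) = (if idx m y = idx m x then 2 ^ m else 0)"
      using haar_sum_eq_average[OF x N] by blast
    have "(\<Sum>k<N. haar_coef ?d k * haar k x) = (LINT y|I01. ?d y * (\<Sum>k<N. haar k x * haar k y))"
      by (rule haar_projection_eq[OF id])
    also have "\<dots> = (LINT y|I01. ?d x * (if idx m y = idx m x then 2 ^ m else 0))"
    proof (rule Bochner_Integration.integral_cong)
      fix y assume "y \<in> space I01"
      then have y: "0 \<le> y" "y \<le> 1" by auto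
      have "idx n y = idx n x" if "idx m y = idx m x"
        using that idx_coarser[OF x m(1)] idx_coarser[OF y m(1)] by simp
      then show "?d y * (\<Sum>k<N. haar k x * haar k y) = ?d x * (if idx m y = idx m x then 2 ^ m else 0)"
        using m(2) y by (auto simp: indicator_def)
    qed simp
    also have "\<dots> = ?d x * (LINT y|I01. (if idx m y = idx m x then 2 ^ m else 0))"
      by (rule integral_mult_right_zero)
    finally show ?thesis using integral_dyadic[OF x, of m] by simp
  qed
  then have "(LINT t|I01. f t * ?d t) = (LINT t|I01. f t * (\<Sum>k<N. haar_coef ?d k * haar k t))"
    by (intro Bochner_Integration.integral_cong) auto
  also have "\<dots> = (LINT t|I01. ?d t * (\<Sum>k<N. haar_coef f k * haar k t))"
    using integral_haar_sum[OF f, where a = "haar_coef ?d"] integral_haar_sum[OF id, where a = "haar_coef f"]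
    by (simp add: mult.commute)
  finally show ?thesis by (simp add: mult.commute)
qed

lemma haar_L1_pos: "0 < (LINT t|I01. \<bar>haar k t\<bar>)"
proof -
  define n where "n = (if k = 0 then 0 else floor_log k)"
  define j where "j = (if k = 0 then 0 else k - 2 ^ n)"
  have j: "j < 2 ^ n"
    using floor_log_exp2_le[of k] floor_log_exp2_gt[of k] by (auto simp: j_def n_def)
  let ?S = "{t \<in> {0..1}. idx n t = j}"
  have "1 / 2 ^ n = (LINT t|I01. (indicator ?S t :: real))"
  proof -
    have "?S \<inter> space I01 = ?S" by auto
    then show ?thesis using measure_dyadic[OF j] dyadic_set[of n j] by simp
  qed
  also have "\<dots> \<le> (LINT t|I01. \<bar>haar k t\<bar>)"
  proof (rule integral_mono)
    show "integrable I01 (indicator ?S :: real \<Rightarrow> real)"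
      using dyadic_set by (intro integrable_I01_bounded[where B = 1]) (auto simp: indicator_def)
    show "integrable I01 (\<lambda>t. \<bar>haar k t\<bar>)" using integrable_haar by simp
    show "indicator ?S t \<le> \<bar>haar k t\<bar>" for t
      by (auto simp: haar_def n_def j_def Let_def indicator_def abs_mult)
  qed
  finally show ?thesis by (rule less_le_trans[rotated]) simp
qed

text \<open>Finite unions of dyadic intervals give the sets where \<open>idx n t < idx n x\<close>;
  these converge to the half-line below \<open>x\<close>, since \<open>idx\<close> separates two
  points once \<open>2 ^ n\<close> times their distance exceeds 1. Half-lines are stable under
  intersection and generate the Borel sets, so Dynkin's argument applies.\<close>

lemma AE_eq_0_if_dyadic:
  fixes g :: "real \<Rightarrow> real"
  assumes g: "integrable I01 g"
    and dyadic: "\<And>n i. (LINT t|I01. indicator {t. idx n t = i} t * g t) = 0"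
  shows "AE t in I01. g t = 0"
proof (rule I01.density_zero[OF g])
  fix A assume "A \<in> sets I01"
  then obtain B where B: "B \<in> sets borel" "A = {0..1} \<inter> B"
    by (auto simp: sets_restrict_space)
  let ?P = "\<lambda>B. (LINT t|I01. indicator B t * g t) = 0"
  have mult: "integrable I01 (\<lambda>t. indicator B t * g t)" if "B \<in> sets borel" for B
    using integrable_I01_mult_bounded[OF g measurable_I01[OF borel_measurable_indicator[OF that]], of 1]
    by (simp add: mult.commute)
  have prefix0: "(LINT t|I01. indicator {t. idx n t < i} t * g t) = 0" for n i
  proof (induction i)
    case (Suc i)
    have m: "integrable I01 (\<lambda>t. indicator {t. idx n t < i} t * g t)"
      "integrable I01 (\<lambda>t. indicator {t. idx n t = i} t * g t)"
      using integrable_I01_mult_bounded[OF g measurable_indicator_idx, of _ _ 1]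
      by (simp_all add: mult.commute)
    have "(\<lambda>t. indicator {t. idx n t < Suc i} t * g t)
        = (\<lambda>t. indicator {t. idx n t < i} t * g t + indicator {t. idx n t = i} t * g t)"
      by (auto simp: indicator_def fun_eq_iff)
    then show ?case using Suc dyadic m by (simp add: Bochner_Integration.integral_add)
  qed simp
  have basic: "?P {..<x}" for x
  proof -
    consider "x \<le> 0" | "1 < x" | "0 < x" "x \<le> 1" by linarith
    then show ?thesis
    proof cases
      case 1
      then have "(LINT t|I01. indicator {..<x} t * g t) = (LINT t|I01. 0)"
        by (intro Bochner_Integration.integral_cong) auto
      then show ?thesis by simp
    next
      case 2
      have "(LINT t|I01. indicator {..<x} t * g t) = (LINT t|I01. indicator {t. idx 0 t < 1} t * g t)"
        using 2 idx_less[of _ 0] by (intro Bochner_Integration.integral_cong) (auto simp: indicator_def)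
      then show ?thesis using prefix0[of 0 1] by (rule trans)
    next
      case 3
      have "(\<lambda>n. LINT t|I01. indicator {t. idx n t < idx n x} t * g t) \<longlonglongrightarrow> (LINT t|I01. indicator {..<x} t * g t)"
      proof (rule integral_dominated_convergence[where w = "\<lambda>t. \<bar>g t\<bar>"])
        show "(\<lambda>t. indicator {..<x} t * g t) \<in> borel_measurable I01" using mult[of "{..<x}"] by auto
        show "(\<lambda>t. indicator {t. idx n t < idx n x} t * g t) \<in> borel_measurable I01" for n
          using integrable_I01_mult_bounded[OF g measurable_indicator_idx, of "\<lambda>i. i < idx n x" n 1]
          by (simp add: mult.commute borel_measurable_integrable)
        show "AE t in I01. (\<lambda>n. indicator {t. idx n t < idx n x} t * g t) \<longlonglongrightarrow> indicator {..<x} t * g t"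
        proof (rule AE_I2)
          fix t assume "t \<in> space I01"
          then have t: "0 \<le> t" "t \<le> 1" by auto
          show "(\<lambda>n. indicator {t. idx n t < idx n x} t * g t) \<longlonglongrightarrow> indicator {..<x} t * g t"
          proof (cases "t < x")
            case True
            obtain n0 where n0: "1 / (x - t) < 2 ^ n0" using real_arch_pow[of 2 "1 / (x - t)"] by auto
            have "idx n t < idx n x" if "n0 \<le> n" for n
            proof -
              have "1 / (x - t) < 2 ^ n"
                by (rule less_le_trans[OF n0 power_increasing[OF that]]) simp
              then have "1 < 2 ^ n * (x - t)" using True by (simp add: field_simps)
              then have "2 ^ n * t + 1 < 2 ^ n * x" by (simp add: algebra_simps)
              then have "real (idx n t) < real (idx n x)"
                using idx_le[OF t, of n] less_idx[of x n] 3 by linarith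
              then show ?thesis by simp
            qed
            then show ?thesis using True
              by (intro tendsto_eventually) (auto simp: eventually_sequentially indicator_def intro!: exI[of _ n0])
          next
            case False
            then have "\<not> idx n t < idx n x" for n using idx_mono[of x t n] 3 t by (simp add: not_less)
            then show ?thesis using False by simp
          qed
        qed
        show "AE t in I01. norm (indicator {t. idx n t < idx n x} t * g t) \<le> \<bar>g t\<bar>" for n
          by (intro AE_I2) (auto simp: indicator_def)
      qed (use g in auto)
      then show ?thesis using prefix0 by (simp add: LIMSEQ_const_iff)
    qed
  qed
  have total: "?P UNIV"
    using prefix0[of 0 1] idx_less[of _ 0]
    by (subst (asm) Bochner_Integration.integral_cong[where g = "\<lambda>t. indicator UNIV t * g t"])
      (auto simp: indicator_def)
  have "sets borel = sigma_sets UNIV (range (lessThan :: real \<Rightarrow> real set))"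
    unfolding borel_Iio by simp
  with B(1) have B_sig: "B \<in> sigma_sets UNIV (range (lessThan :: real \<Rightarrow> real set))" by simp
  have stable: "Int_stable (range (lessThan :: real \<Rightarrow> real set))"

  proof (rule Int_stableI)
    show "a \<inter> b \<in> range lessThan" if "a \<in> range lessThan" "b \<in> range lessThan" for a b :: "real set"
    proof -
      obtain u v where "a = {..<u}" "b = {..<v}" using \<open>a \<in> range lessThan\<close> \<open>b \<in> range lessThan\<close> by blast
      then have "a \<inter> b = {..<min u v}" by auto
      then show ?thesis by blast
    qed
  qed
  have "range lessThan \<subseteq> Pow (UNIV :: real set)" by simp
  from stable this B_sig have "?P B"
  proof (induction rule: sigma_sets_induct_disjoint)
    case (compl A)
    then have A: "A \<in> sets borel" unfolding borel_Iio by simp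
    have "(\<lambda>t. indicator (UNIV - A) t * g t) = (\<lambda>t. indicator UNIV t * g t - indicator A t * g t)"
      by (auto simp: indicator_def fun_eq_iff)
    then show ?case using mult[OF A] mult[of UNIV] compl total by (simp add: Bochner_Integration.integral_diff)
  next
    case (union A)
    then have A: "\<And>i. A i \<in> sets borel" unfolding borel_Iio by auto
    have "(\<lambda>n. LINT t|I01. indicator (\<Union>i<n. A i) t * g t) \<longlonglongrightarrow> (LINT t|I01. indicator (\<Union>i. A i) t * g t)"
    proof (rule integral_dominated_convergence[where w = "\<lambda>t. \<bar>g t\<bar>"])
      show "(\<lambda>t. indicator (\<Union>i. A i) t * g t) \<in> borel_measurable I01"
        using mult[of "\<Union>i. A i"] A by auto
      show "(\<lambda>t. indicator (\<Union>i<n. A i) t * g t) \<in> borel_measurable I01" for n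
        using mult[of "\<Union>i<n. A i"] A by auto
      show "AE t in I01. (\<lambda>n. indicator (\<Union>i<n. A i) t * g t) \<longlonglongrightarrow> indicator (\<Union>i. A i) t * g t"
        by (intro AE_I2 tendsto_mult LIMSEQ_indicator_UN tendsto_const)
      show "AE t in I01. norm (indicator (\<Union>i<n. A i) t * g t) \<le> \<bar>g t\<bar>" for n
        by (intro AE_I2) (auto simp: indicator_def)
    qed (use g in auto)
    moreover have "(LINT t|I01. indicator (\<Union>i<n. A i) t * g t) = 0" for n
    proof (induction n)
      case (Suc n)
      have "A n \<inter> A i = {}" if "i < n" for i
        using union(1) that unfolding disjoint_family_on_def by (metis UNIV_I less_irrefl)
      then have "A n \<inter> (\<Union>i<n. A i) = {}" by blast
      then have "(\<lambda>t. indicator (\<Union>i<Suc n. A i) t * g t)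
          = (\<lambda>t. indicator (\<Union>i<n. A i) t * g t + indicator (A n) t * g t)"
        by (auto simp: indicator_def fun_eq_iff lessThan_Suc)
      then show ?case using Suc union(3)[of n] mult[OF A[of n]] mult[of "\<Union>i<n. A i"] A
        by (simp add: Bochner_Integration.integral_add)
    qed simp
    ultimately show ?case by (simp add: LIMSEQ_const_iff)
  qed (use basic in auto)
  moreover have "set_lebesgue_integral I01 A g = (LINT t|I01. indicator B t * g t)"
    unfolding set_lebesgue_integral_def using B(2)
    by (intro Bochner_Integration.integral_cong) (auto simp: indicator_def)
  ultimately show "set_lebesgue_integral I01 A g = 0" by simp
qed

subsection \<open>Weakly compact sets are uniformly integrable\<close>

text \<open>If there were none, each point of \<open>K\<close> would have a weak neighbourhood that
  the sequence avoids from some index on; finitely many of these cover \<open>K\<close>, and a late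
  enough term would lie in none of them. In the proof, \<open>w z\<close> packs the functionals, the
  radius and the index.\<close>

lemma weakly_compact_cluster_point:
  assumes K: "compactin (weak_topology Y) K" "K \<subseteq> Y" and y: "\<And>n. y n \<in> K"
  shows "\<exists>z\<in>K. \<forall>H e N. finite H \<and> H \<subseteq> dual Y \<and> 0 < (e::real) \<longrightarrow>
    (\<exists>n\<ge>(N::nat). \<forall>\<phi>\<in>H. \<bar>\<phi> (y n) - \<phi> z\<bar> < e)"
proof (rule ccontr)
  assume "\<not> ?thesis"
  then have "\<forall>z\<in>K. \<exists>w. finite (fst w) \<and> fst w \<subseteq> dual Y \<and> 0 < fst (snd w) \<and>
      (\<forall>n\<ge>snd (snd w). \<not> (\<forall>\<phi>\<in>fst w. \<bar>\<phi> (y n) - \<phi> z\<bar> < fst (snd w)))"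
    by (simp add: Bex_def)
  from bchoice[OF this] obtain w where w: "\<And>z. z \<in> K \<Longrightarrow> finite (fst (w z)) \<and> fst (w z) \<subseteq> dual Y \<and>
      0 < fst (snd (w z)) \<and> (\<forall>n\<ge>snd (snd (w z)). \<not> (\<forall>\<phi>\<in>fst (w z). \<bar>\<phi> (y n) - \<phi> z\<bar> < fst (snd (w z))))"
    by blast
  define U where "U z = (\<Inter>\<phi>\<in>fst (w z). {x \<in> Y. \<phi> x \<in> ball (\<phi> z) (fst (snd (w z)))})" for z
  have U: "openin (weak_topology Y) (U z)" if "z \<in> K" for z
  proof -
    \<comment> \<open>For an empty set of functionals the negated condition could not hold;
      nonemptiness makes the intersection \<open>U z\<close> a proper finite intersection of
      subbasic sets.\<close>
    have "fst (w z) \<noteq> {}" using w[OF that] by auto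
    then show ?thesis
      unfolding U_def weak_topology_def
    proof (intro openin_INT2 topology_generated_by_Basis)
      show "{x \<in> Y. \<phi> x \<in> ball (\<phi> z) (fst (snd (w z)))} \<in> {{x \<in> Y. \<phi> x \<in> U} |\<phi> U. \<phi> \<in> dual Y \<and> open U}"
        if "\<phi> \<in> fst (w z)" for \<phi>
        using that w[OF \<open>z \<in> K\<close>] open_ball[of "\<phi> z" "fst (snd (w z))"] by blast
    qed (use w[OF that] in auto)
  qed
  have "K \<subseteq> \<Union> (U ` K)"
    using w K(2) by (auto simp: U_def intro!: bexI)
  then have "\<exists>F. finite F \<and> F \<subseteq> U ` K \<and> K \<subseteq> \<Union> F"
    using conjunct2[OF K(1)[unfolded compactin_def], rule_format, of "U ` K"] U by blast
  then obtain F where F: "finite F" "F \<subseteq> U ` K" "K \<subseteq> \<Union> F" by blast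
  then obtain Z where Z: "finite Z" "Z \<subseteq> K" "F = U ` Z"
    using finite_subset_image[OF F(1,2)] by blast
  define n where "n = Max (insert 0 ((\<lambda>z. snd (snd (w z))) ` Z))"
  have n: "snd (snd (w z)) \<le> n" if "z \<in> Z" for z
    unfolding n_def using Z(1) that by (intro Max_ge) auto
  obtain z where z: "z \<in> Z" "y n \<in> U z" using F(3) Z(3) y[of n] by blast
  have "\<bar>\<phi> (y n) - \<phi> z\<bar> < fst (snd (w z))" if "\<phi> \<in> fst (w z)" for \<phi>
    using z(2) that by (auto simp: U_def dist_real_def abs_minus_commute)
  then show False using w[of z] n[OF z(1)] z(1) Z(2) by blast
qed

lemma integrable_indicator_I01: "A \<in> sets I01 \<Longrightarrow> integrable I01 (indicator A :: real \<Rightarrow> real)"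
  by (rule integrable_I01_bounded[of _ 1]) (auto simp: indicator_def)

text \<open>Absolute continuity of the integral: the part where the absolute value of
  \<open>g\<close> exceeds \<open>c\<close> is small by dominated convergence, the rest is at most
  \<open>c\<close> times the measure.\<close>

lemma integral_small_sets:
  fixes g :: "real \<Rightarrow> real"
  assumes g: "integrable I01 g" and E: "\<And>n. E n \<in> sets I01"
    and lim: "(\<lambda>n. measure I01 (E n)) \<longlonglongrightarrow> 0"
  shows "(\<lambda>n. LINT t|I01. indicator (E n) t * \<bar>g t\<bar>) \<longlonglongrightarrow> 0"
proof (rule LIMSEQ_I)
  fix e :: real assume e: "0 < e"
  have gm: "g \<in> borel_measurable I01" using g by auto
  have ind: "integrable I01 (\<lambda>t. indicator A t * \<bar>g t\<bar>)" if "A \<in> sets I01" for A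
    using integrable_I01_mult_bounded[of "\<lambda>t. \<bar>g t\<bar>" "indicator A" 1] g that
    by (simp add: mult.commute indicator_def)
  have big: "{t \<in> {0..1}. c < \<bar>g t\<bar>} \<in> sets I01" for c
  proof -
    have "{t \<in> space I01. c < \<bar>g t\<bar>} \<in> sets I01" using gm by measurable
    then show ?thesis by simp
  qed
  have "(\<lambda>c. LINT t|I01. indicator {t \<in> {0..1}. real c < \<bar>g t\<bar>} t * \<bar>g t\<bar>) \<longlonglongrightarrow> (LINT t|I01. 0)"
  proof (rule integral_dominated_convergence[where w = "\<lambda>t. \<bar>g t\<bar>"])
    show "AE t in I01. (\<lambda>c. indicator {t \<in> {0..1}. real c < \<bar>g t\<bar>} t * \<bar>g t\<bar>) \<longlonglongrightarrow> 0"
    proof (rule AE_I2)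
      fix t
      obtain c0 :: nat where c0: "\<bar>g t\<bar> \<le> real c0" using real_arch_simple by blast
      have "\<not> real c < \<bar>g t\<bar>" if "c0 \<le> c" for c
        using c0 of_nat_mono[OF that, where 'a = real] by linarith
      then show "(\<lambda>c. indicator {t \<in> {0..1}. real c < \<bar>g t\<bar>} t * \<bar>g t\<bar>) \<longlonglongrightarrow> 0"
        by (intro tendsto_eventually eventually_sequentiallyI[of c0]) (simp add: indicator_def)
    qed
    show "AE t in I01. norm (indicator {t \<in> {0..1}. real c < \<bar>g t\<bar>} t * \<bar>g t\<bar>) \<le> \<bar>g t\<bar>" for c
      by (intro AE_I2) (auto simp: indicator_def)
    show "(\<lambda>t. indicator {t \<in> {0..1}. real c < \<bar>g t\<bar>} t * \<bar>g t\<bar>) \<in> borel_measurable I01" for c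
      using ind[OF big] by auto
  qed (use g in auto)
  then obtain c :: nat where c: "(LINT t|I01. indicator {t \<in> {0..1}. real c < \<bar>g t\<bar>} t * \<bar>g t\<bar>) < e / 2"
    using order_tendstoD(2)[of _ "0::real" sequentially "e / 2"] e
    by (auto simp: eventually_sequentially)
  obtain n0 where n0: "\<And>n. n0 \<le> n \<Longrightarrow> measure I01 (E n) < e / (2 * (real c + 1))"
    using order_tendstoD(2)[OF lim, of "e / (2 * (real c + 1))"] e by (auto simp: eventually_sequentially)
  have "norm ((LINT t|I01. indicator (E n) t * \<bar>g t\<bar>) - 0) < e" if "n0 \<le> n" for n
  proof -
    have "(LINT t|I01. indicator (E n) t * \<bar>g t\<bar>)
        \<le> (LINT t|I01. real c * indicator (E n) t + indicator {t \<in> {0..1}. real c < \<bar>g t\<bar>} t * \<bar>g t\<bar>)"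
    proof (rule integral_mono)
      show "integrable I01 (\<lambda>t. real c * indicator (E n) t + indicator {t \<in> {0..1}. real c < \<bar>g t\<bar>} t * \<bar>g t\<bar>)"
        using E by (intro Bochner_Integration.integrable_add integrable_mult_right ind[OF big] integrable_indicator_I01)
    qed (use ind[OF E] in \<open>auto simp: indicator_def\<close>)
    also have "\<dots> = real c * measure I01 (E n) + (LINT t|I01. indicator {t \<in> {0..1}. real c < \<bar>g t\<bar>} t * \<bar>g t\<bar>)"
      using ind[OF big] E integrable_indicator_I01[OF E] sets.sets_into_space[OF E[of n]]
      by (subst Bochner_Integration.integral_add) (auto simp: Int_absorb2)
    also have "real c * measure I01 (E n) \<le> (real c + 1) * (e / (2 * (real c + 1)))"
      using n0[OF that] by (intro mult_mono) auto
    also have "(real c + 1) * (e / (2 * (real c + 1))) = e / 2"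
    proof -
      have "d * (e / (2 * d)) = e / 2" if "0 < d" for d :: real using that by simp
      then show ?thesis by (meson add_nonneg_pos of_nat_0_le_iff zero_less_one)
    qed
    finally have "(LINT t|I01. indicator (E n) t * \<bar>g t\<bar>) < e" using c by simp
    moreover have "0 \<le> (LINT t|I01. indicator (E n) t * \<bar>g t\<bar>)" by (intro integral_nonneg_AE AE_I2) auto
    ultimately show ?thesis by simp
  qed
  then show "\<exists>n0. \<forall>n\<ge>n0. norm ((LINT t|I01. indicator (E n) t * \<bar>g t\<bar>) - 0) < e" by blast
qed

text \<open>The isomorphism onto \<open>L1\<close> of the definition, with integrals taken over \<open>I01\<close>.\<close>

locale L1_isomorphism =
  fixes Y :: "cfun set" and T :: "cfun \<Rightarrow> real \<Rightarrow> real" and c C :: real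
  assumes Y: "Y \<in> SB" and c: "0 < c"
    and integrable_T: "y \<in> Y \<Longrightarrow> integrable I01 (T y)"
    and T_lower: "y \<in> Y \<Longrightarrow> c * supnorm y \<le> (LINT t|I01. \<bar>T y t\<bar>)"
    and T_upper: "y \<in> Y \<Longrightarrow> (LINT t|I01. \<bar>T y t\<bar>) \<le> C * supnorm y"
    and T_add: "y \<in> Y \<Longrightarrow> z \<in> Y \<Longrightarrow> AE t in I01. T (fadd y z) t = T y t + T z t"
    and T_scale: "y \<in> Y \<Longrightarrow> AE t in I01. T (fscale a y) t = a * T y t"
    and T_onto: "integrable I01 f \<Longrightarrow> \<exists>y\<in>Y. AE t in I01. T y t = f t"
begin

text \<open>The functional on \<open>Y\<close> that corresponds to the element \<open>h\<close> of
  the dual of \<open>L1\<close>; \<open>dual\<close> demands the value 0 off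
  \<open>Y\<close>.\<close>

definition T_functional :: "(real \<Rightarrow> real) \<Rightarrow> cfun \<Rightarrow> real" where
  "T_functional h y = (if y \<in> Y then LINT t|I01. T y t * h t else 0)"

context
  fixes h :: "real \<Rightarrow> real" and B :: real
  assumes h: "h \<in> borel_measurable I01" "\<And>t. t \<in> {0..1} \<Longrightarrow> \<bar>h t\<bar> \<le> B"
begin

lemma integrable_T_mult: "y \<in> Y \<Longrightarrow> integrable I01 (\<lambda>t. T y t * h t)"
  by (rule integrable_I01_mult_bounded[OF integrable_T h])

lemma integral_T_add:
  assumes "y \<in> Y" "z \<in> Y"
  shows "(LINT t|I01. T (fadd y z) t * h t) = (LINT t|I01. T y t * h t) + (LINT t|I01. T z t * h t)"
proof -
  have "(LINT t|I01. T (fadd y z) t * h t) = (LINT t|I01. T y t * h t + T z t * h t)"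
    using T_add[OF assms] integrable_T_mult SB_add[OF Y assms] assms
    by (intro integral_cong_AE) (auto simp: distrib_right)
  then show ?thesis using integrable_T_mult assms by simp
qed

lemma integral_T_scale:
  assumes "y \<in> Y"
  shows "(LINT t|I01. T (fscale a y) t * h t) = a * (LINT t|I01. T y t * h t)"
proof -
  have "(LINT t|I01. T (fscale a y) t * h t) = (LINT t|I01. a * (T y t * h t))"
    using T_scale[OF assms, of a] integrable_T_mult SB_scale[OF Y assms] assms
    by (intro integral_cong_AE) auto
  then show ?thesis by simp
qed

lemma T_functional_dual: "T_functional h \<in> dual Y"
proof -
  have B: "0 \<le> B" using h(2)[of 0] by simp
  have "\<bar>T_functional h y\<bar> \<le> (B * C) * supnorm y" if "y \<in> Y" for y
    using integral_mult_le[OF integrable_T[OF that] h] mult_left_mono[OF T_upper[OF that] B] that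
    by (simp add: T_functional_def)
  then show ?thesis
    unfolding dual_def using SB_add[OF Y] SB_scale[OF Y]
    by (intro CollectI conjI exI[of _ "B * C"])
      (auto simp: T_functional_def integral_T_add integral_T_scale)
qed

end

text \<open>Gliding hump: if the \<open>T (y n)\<close> are not uniformly integrable, one builds a bounded \<open>h\<close> by
  successively changing it to \<open>\<plusminus> sgn\<close> on the sets where a chosen \<open>T (y n)\<close> is large; the functional
  of \<open>h\<close> stays away from its value at a cluster point although those of all approximations
  to \<open>h\<close> do not.\<close>

context
  fixes K W :: "cfun set" and R e :: real
  assumes K: "compactin (weak_topology Y) K" "K \<subseteq> Y" and W: "W \<subseteq> K"
    and R: "\<And>y. y \<in> W \<Longrightarrow> (LINT t|I01. \<bar>T y t\<bar>) \<le> R" and e: "0 < e"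
    and not_ui: "\<And>n::nat. \<exists>y\<in>W. e < (LINT t|I01. indicator {t \<in> {0..1}. real n < \<bar>T y t\<bar>} t * \<bar>T y t\<bar>)"
begin

lemma not_ui_False: False
proof -
  have "\<forall>n. \<exists>y. y \<in> W \<and> e < (LINT t|I01. indicator {t \<in> {0..1}. real n < \<bar>T y t\<bar>} t * \<bar>T y t\<bar>)"
    using not_ui by blast
  from choice[OF this] obtain y where yW: "\<And>n. y n \<in> W"
    and y: "\<And>n. e < (LINT t|I01. indicator {t \<in> {0..1}. real n < \<bar>T (y n) t\<bar>} t * \<bar>T (y n) t\<bar>)"
    by blast
  have yY: "y n \<in> Y" "y n \<in> K" for n using yW W K(2) by auto
  define E where "E n = {t \<in> {0..1}. real n < \<bar>T (y n) t\<bar>}" for n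
  have E: "E n \<in> sets I01" for n
  proof -
    have "{t \<in> space I01. real n < \<bar>T (y n) t\<bar>} \<in> sets I01"
      using borel_measurable_integrable[OF integrable_T[OF yY(1)[of n]]] by measurable
    then show ?thesis by (simp add: E_def)
  qed
  have ind: "integrable I01 (\<lambda>t. indicator A t * \<bar>g t\<bar>)"
    if "A \<in> sets I01" "integrable I01 g" for A and g :: "real \<Rightarrow> real"
    using integrable_I01_mult_bounded[of "\<lambda>t. \<bar>g t\<bar>" "indicator A" 1] that
    by (simp add: mult.commute indicator_def)
  \<comment> \<open>Chebyshev's inequality gives \<open>R / n\<close>; the bound is written with
    \<open>Suc n\<close> and the factor 2 so that it also covers \<open>n = 0\<close>.\<close>
  have E_small: "(\<lambda>n. measure I01 (E n)) \<longlonglongrightarrow> 0"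
  proof (rule nonneg_null_squeeze)
    have "0 \<le> (LINT t|I01. \<bar>T (y 0) t\<bar>)" by (rule integral_nonneg_AE) simp
    then have R0: "0 \<le> R" using R[OF yW[of 0]] by linarith
    show "measure I01 (E n) \<le> (R + 1) * inverse (real (Suc n)) * 2" for n
    proof (cases "n = 0")
      case True
      have "measure I01 (E n) \<le> measure I01 (space I01)" by (rule I01.bounded_measure)
      then show ?thesis using True R0 by (simp add: measure_I01)
    next
      case False
      have "real n * measure I01 (E n) = (LINT t|I01. real n * indicator (E n) t)"
        using sets.sets_into_space[OF E[of n]] by (simp add: Int_absorb2)
      also have "\<dots> \<le> (LINT t|I01. \<bar>T (y n) t\<bar>)"
      proof (rule integral_mono)
        show "integrable I01 (\<lambda>t. real n * indicator (E n) t)"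
          by (intro integrable_mult_right integrable_indicator_I01 E)
      qed (use integrable_T[OF yY(1)] in \<open>auto simp: E_def indicator_def\<close>)
      also have "\<dots> \<le> R" by (rule R[OF yW])
      finally have "measure I01 (E n) \<le> R / real n" using False by (simp add: field_simps)
      also have "\<dots> \<le> (R + 1) * inverse (real (Suc n)) * 2"
      proof -
        have "R * (1 + real n) \<le> R * (2 * real n)" using R0 False by (intro mult_left_mono) auto
        also have "\<dots> \<le> (R + 1) * (2 * real n)" using R0 by (intro mult_right_mono) auto
        finally show ?thesis using False by (simp add: field_simps)
      qed
      finally show ?thesis .
    qed
    show "(\<lambda>n. (R + 1) * inverse (real (Suc n)) * 2) \<longlonglongrightarrow> 0"
      by (intro tendsto_mult_left_zero tendsto_mult_right_zero LIMSEQ_inverse_real_of_nat)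
  qed simp
  obtain z where zK: "z \<in> K" and z: "\<forall>H e N. finite H \<and> H \<subseteq> dual Y \<and> 0 < (e::real) \<longrightarrow>
      (\<exists>n\<ge>(N::nat). \<forall>\<phi>\<in>H. \<bar>\<phi> (y n) - \<phi> z\<bar> < e)"
    by (rule bexE[OF weakly_compact_cluster_point[OF K yY(2)]])
  have zY: "z \<in> Y" using zK K(2) by auto
  define f where "f n t = T (y n) t - T z t" for n t
  have f: "integrable I01 (f n)" for n unfolding f_def[abs_def] using integrable_T yY zY by simp
  define good where "good u \<longleftrightarrow> u \<in> borel_measurable I01 \<and> (\<forall>t. \<bar>u t\<bar> \<le> 1)" for u :: "real \<Rightarrow> real"
  have goodD: "u \<in> borel_measurable I01" "\<And>t. t \<in> {0..1} \<Longrightarrow> \<bar>u t\<bar> \<le> 1" if "good u" for u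
    using that by (auto simp: good_def)
  have good_dual: "T_functional u \<in> dual Y" if "good u" for u
    by (rule T_functional_dual[of u 1]) (use goodD[OF that] in auto)
  have fu: "(LINT t|I01. f n t * u t) = T_functional u (y n) - T_functional u z" if "good u" for n u
    using integrable_T_mult[OF goodD[OF that]] yY zY
    by (simp add: f_def left_diff_distrib T_functional_def)
  have int_fu: "integrable I01 (\<lambda>t. g t * u t)" if "good u" "integrable I01 g" for g u
    by (rule integrable_I01_mult_bounded[OF that(2) goodD[OF that(1)]])
  \<comment> \<open>A state consists of the last chosen index \<open>n\<close>, the current function
    \<open>h\<close>, the finite set \<open>H\<close> of all functions so far, and the sum
    \<open>G\<close> of the absolute values of all chosen \<open>f\<close>.\<close>
  define P where "P k S = (case S of (n :: nat, h, H, G) \<Rightarrow> h \<in> H \<and> finite H \<and> (\<forall>u\<in>H. good u) \<and>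
      integrable I01 G \<and> (\<forall>t. 0 \<le> G t))" for k :: nat and S :: "nat \<times> (real \<Rightarrow> real) \<times> (real \<Rightarrow> real) set \<times> (real \<Rightarrow> real)"
  \<comment> \<open>The new \<open>f\<close> nearly annihilates all earlier functions, while the new
    set \<open>E\<close> is so small that changing \<open>h\<close> on it hardly affects the
    integrals against earlier \<open>f\<close>; yet the integral of the new \<open>f\<close> against
    the new \<open>h\<close> is large.\<close>
  define Q where "Q k S S' = (case (S, S') of ((n, h, H, G), (n', h', H', G')) \<Rightarrow>
      H' = insert h' H \<and> G' = (\<lambda>t. G t + \<bar>f n' t\<bar>) \<and>
      (\<forall>u\<in>H. \<bar>LINT t|I01. f n' t * u t\<bar> \<le> (1/2) ^ k) \<and>
      (LINT t|I01. indicator (E n') t * G t) \<le> e / 32 * (1/2) ^ k \<and>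
      measure I01 (E n') \<le> (1/2) ^ k \<and> (\<forall>t. t \<notin> E n' \<longrightarrow> h' t = h t) \<and>
      3 / 4 * e \<le> \<bar>LINT t|I01. f n' t * h' t\<bar>)" for k :: nat and S S' :: "nat \<times> (real \<Rightarrow> real) \<times> (real \<Rightarrow> real) set \<times> (real \<Rightarrow> real)"
  have step: "\<exists>S'. P (Suc k) S' \<and> Q k S S'" if "P k S" for k S
  proof -
    obtain n h H G where S: "S = (n, h, H, G)" by (cases S) auto
    have h: "good h" and H: "finite H" "\<And>u. u \<in> H \<Longrightarrow> good u" "h \<in> H" and G: "integrable I01 G" "\<And>t. 0 \<le> G t"
      using that by (auto simp: P_def S)
    define d where "d = min (e / 32) 1 * (1/2) ^ k"
    have d: "0 < d" using e by (simp add: d_def)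
    have "eventually (\<lambda>n. (LINT t|I01. indicator (E n) t * \<bar>G t\<bar>) < d \<and> measure I01 (E n) < d \<and>
        (LINT t|I01. indicator (E n) t * \<bar>T z t\<bar>) < e / 4) sequentially"
      using d e by (intro eventually_conj order_tendstoD(2)[OF integral_small_sets[OF G(1) E E_small]]
          order_tendstoD(2)[OF E_small] order_tendstoD(2)[OF integral_small_sets[OF integrable_T[OF zY] E E_small]]) auto
    then obtain N where N: "\<And>n. N \<le> n \<Longrightarrow> (LINT t|I01. indicator (E n) t * \<bar>G t\<bar>) < d"
      "\<And>n. N \<le> n \<Longrightarrow> measure I01 (E n) < d" "\<And>n. N \<le> n \<Longrightarrow> (LINT t|I01. indicator (E n) t * \<bar>T z t\<bar>) < e / 4"
      unfolding eventually_sequentially by blast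
    have "T_functional ` H \<subseteq> dual Y" using good_dual H(2) by blast
    then obtain m where m: "N \<le> m" "\<And>u. u \<in> H \<Longrightarrow> \<bar>T_functional u (y m) - T_functional u z\<bar> < (1/2) ^ k"
      using z[rule_format, of "T_functional ` H" "(1/2) ^ k" N] H(1) by auto
    have large: "3 / 4 * e \<le> (LINT t|I01. indicator (E m) t * \<bar>f m t\<bar>)"
    proof -
      have "(LINT t|I01. indicator (E m) t * \<bar>T (y m) t\<bar>)
          \<le> (LINT t|I01. indicator (E m) t * \<bar>f m t\<bar> + indicator (E m) t * \<bar>T z t\<bar>)"
        using ind[OF E f] ind[OF E integrable_T[OF zY]] ind[OF E integrable_T[OF yY(1)]]
        by (intro integral_mono) (auto simp: f_def indicator_def)
      also have "\<dots> = (LINT t|I01. indicator (E m) t * \<bar>f m t\<bar>) + (LINT t|I01. indicator (E m) t * \<bar>T z t\<bar>)"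
        using ind[OF E f] ind[OF E integrable_T[OF zY]] by (rule Bochner_Integration.integral_add)
      finally show ?thesis using y[of m] N(3)[OF m(1)] unfolding E_def[symmetric] by linarith
    qed
    \<comment> \<open>The integrals for the two signs differ by twice the integral of the absolute
      value of \<open>f m\<close> over \<open>E m\<close>, at least \<open>3 / 2 * e\<close>, so one
      of them is at least \<open>3 / 4 * e\<close> in absolute value.\<close>
    define h1 where "h1 \<sigma> t = (if t \<in> E m then \<sigma> * sgn (f m t) else h t)" for \<sigma> t :: real
    have h1: "good (h1 \<sigma>)" if "\<bar>\<sigma>\<bar> \<le> 1" for \<sigma>
    proof -
      have "h1 \<sigma> = (\<lambda>t. indicator (E m) t * (\<sigma> * sgn (f m t)) + (1 - indicator (E m) t) * h t)"
        by (auto simp: h1_def indicator_def)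
      moreover have "\<dots> \<in> borel_measurable I01"
        using E[of m] borel_measurable_integrable[OF f[of m]] goodD(1)[OF h] by measurable
      ultimately have "h1 \<sigma> \<in> borel_measurable I01" by (simp only:)
      moreover have "\<bar>h1 \<sigma> t\<bar> \<le> 1" for t
        using that h by (cases "t \<in> E m") (auto simp: good_def h1_def abs_mult sgn_if)
      ultimately show ?thesis by (simp add: good_def)
    qed
    have "(LINT t|I01. f m t * h1 1 t) - (LINT t|I01. f m t * h1 (- 1) t)
        = (LINT t|I01. f m t * h1 1 t - f m t * h1 (- 1) t)"
      using int_fu[OF h1 f] by simp
    also have "\<dots> = (LINT t|I01. 2 * (indicator (E m) t * \<bar>f m t\<bar>))"
      by (intro Bochner_Integration.integral_cong) (auto simp: h1_def indicator_def sgn_if)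
    also have "\<dots> = 2 * (LINT t|I01. indicator (E m) t * \<bar>f m t\<bar>)" by simp
    finally have "\<exists>\<sigma>\<in>{1, - 1}. 3 / 4 * e \<le> \<bar>LINT t|I01. f m t * h1 \<sigma> t\<bar>"
      using large by (simp add: abs_if) linarith
    then obtain \<sigma> where "\<sigma> \<in> {1, - 1}" "3 / 4 * e \<le> \<bar>LINT t|I01. f m t * h1 \<sigma> t\<bar>" by (rule bexE)
    then have \<sigma>: "\<bar>\<sigma>\<bar> \<le> 1" "3 / 4 * e \<le> \<bar>LINT t|I01. f m t * h1 \<sigma> t\<bar>" by auto
    have "(LINT t|I01. indicator (E m) t * G t) \<le> e / 32 * (1/2) ^ k" "measure I01 (E m) \<le> (1/2) ^ k"
    proof -
      have "d \<le> e / 32 * (1/2) ^ k" "d \<le> 1 * (1/2) ^ k"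
        unfolding d_def by (intro mult_right_mono; simp)+
      then show "(LINT t|I01. indicator (E m) t * G t) \<le> e / 32 * (1/2) ^ k" "measure I01 (E m) \<le> (1/2) ^ k"
        using N(1,2)[OF m(1)] G(2) by simp_all
    qed
    then have "Q k S (m, h1 \<sigma>, insert (h1 \<sigma>) H, \<lambda>t. G t + \<bar>f m t\<bar>)"
      unfolding Q_def S using m(2) \<sigma>(2) fu[OF H(2)] by (auto simp: h1_def less_imp_le)
    moreover have "P (Suc k) (m, h1 \<sigma>, insert (h1 \<sigma>) H, \<lambda>t. G t + \<bar>f m t\<bar>)"
      unfolding P_def using h1[OF \<sigma>(1)] H G f by auto
    ultimately show ?thesis by blast
  qed
  have "P 0 (0, \<lambda>_. 0, {\<lambda>_. 0}, \<lambda>_. 0)" by (simp add: P_def good_def)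
  then obtain F where F: "\<And>k. P k (F k)" "\<And>k. Q k (F k) (F (Suc k))"
    using dependent_nat_choice[of P Q] step by metis
  define n where "n k = fst (F (Suc k))" for k
  define h where "h k = fst (snd (F k))" for k
  define H where "H k = fst (snd (snd (F k)))" for k
  define G where "G k = snd (snd (snd (F k)))" for k
  have FP: "h k \<in> H k" "\<And>u. u \<in> H k \<Longrightarrow> good u" "integrable I01 (G k)" "\<And>t. 0 \<le> G k t" for k
    using F(1)[of k] by (auto simp: P_def h_def H_def G_def split: prod.splits)
  have FQ: "H (Suc k) = insert (h (Suc k)) (H k)" "G (Suc k) = (\<lambda>t. G k t + \<bar>f (n k) t\<bar>)"
    "\<And>u. u \<in> H k \<Longrightarrow> \<bar>LINT t|I01. f (n k) t * u t\<bar> \<le> (1/2) ^ k"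
    "(LINT t|I01. indicator (E (n k)) t * G k t) \<le> e / 32 * (1/2) ^ k"
    "measure I01 (E (n k)) \<le> (1/2) ^ k" "\<And>t. t \<notin> E (n k) \<Longrightarrow> h (Suc k) t = h k t"
    "3 / 4 * e \<le> \<bar>LINT t|I01. f (n k) t * h (Suc k) t\<bar>" for k
    using F(2)[of k] by (auto simp: Q_def h_def H_def G_def n_def split: prod.splits)
  have good_h: "good (h k)" for k using FP by blast
  have H_mono: "h j \<in> H k" if "j \<le> k" for j k
    using that by (induction k rule: dec_induct) (auto simp: FP FQ)
  have G_mono: "\<bar>f (n j) t\<bar> \<le> G k t" if "j < k" for j k t
    using that
  proof (induction k)
    case (Suc k)
    then show ?case using FP(4)[of k t] by (cases "j = k") (auto simp: FQ(2) add_increasing)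
  qed simp
  have f_on_E: "(LINT t|I01. indicator (E (n k)) t * \<bar>f (n j) t\<bar>) \<le> e / 32 * (1/2) ^ k" if "j < k" for j k
  proof -
    have "(LINT t|I01. indicator (E (n k)) t * \<bar>f (n j) t\<bar>) \<le> (LINT t|I01. indicator (E (n k)) t * \<bar>G k t\<bar>)"
      using ind[OF E f] ind[OF E FP(3)] G_mono[OF that] FP(4)
      by (intro integral_mono) (auto simp: indicator_def)
    also have "\<dots> = (LINT t|I01. indicator (E (n k)) t * G k t)" using FP(4) by simp
    finally show ?thesis using FQ(4)[of k] by simp
  qed
  \<comment> \<open>Clipping keeps the function bounded by 1 even where \<open>h k t\<close>
    diverges and \<open>lim\<close> is arbitrary.\<close>
  define hh where "hh t = max (- 1) (min 1 (lim (\<lambda>k. h k t)))" for t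
  have good_hh: "good hh"
  proof -
    have "(\<lambda>t. lim (\<lambda>k. h k t)) \<in> borel_measurable I01"
      using goodD(1)[OF good_h] by (rule borel_measurable_lim_metric)
    then have "hh \<in> borel_measurable I01" unfolding hh_def[abs_def] by measurable
    then show ?thesis by (auto simp: good_def hh_def)
  qed
  \<comment> \<open>The measures of the sets \<open>E (n k)\<close> are summable, so by
    Borel-Cantelli almost every point lies in finitely many of them and its value is eventually left
    alone.\<close>
  have "AE t in I01. eventually (\<lambda>k. t \<in> space I01 - E (n k)) sequentially"
  proof (rule borel_cantelli_AE1)
    have "summable (\<lambda>k. (1/2::real) ^ k)" by (rule summable_geometric) simp
    then show "summable (\<lambda>k. measure I01 (E (n k)))"
      by (rule summable_comparison_test'[where N = 0]) (use FQ(5) in simp)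
  qed (use E in \<open>auto simp: I01.emeasure_eq_measure\<close>)
  then have h_lim: "AE t in I01. (\<lambda>k. h k t) \<longlonglongrightarrow> hh t"
  proof eventually_elim
    case (elim t)
    then obtain k0 where k0: "\<And>k. k0 \<le> k \<Longrightarrow> t \<notin> E (n k)" by (auto simp: eventually_sequentially)
    have const: "h k t = h k0 t" if "k0 \<le> k" for k
      using that by (induction k rule: dec_induct) (auto simp: FQ(6) k0)
    have l: "(\<lambda>k. h k t) \<longlonglongrightarrow> h k0 t"
      by (intro tendsto_eventually eventually_sequentiallyI[of k0] const)
    then have "lim (\<lambda>k. h k t) = h k0 t" by (rule limI)
    moreover have "\<bar>h k0 t\<bar> \<le> 1" using good_h by (auto simp: good_def)
    ultimately have "hh t = h k0 t" by (auto simp: hh_def)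
    then show ?case using l by simp
  qed
  have int_lim: "(\<lambda>k. LINT t|I01. g t * h k t) \<longlonglongrightarrow> (LINT t|I01. g t * hh t)" if g: "integrable I01 g" for g
  proof (rule integral_dominated_convergence[where w = "\<lambda>t. \<bar>g t\<bar>"])
    show "AE t in I01. (\<lambda>k. g t * h k t) \<longlonglongrightarrow> g t * hh t"
      using h_lim by eventually_elim (intro tendsto_intros)
    show "AE t in I01. norm (g t * h k t) \<le> \<bar>g t\<bar>" for k
      using good_h[of k] by (intro AE_I2) (auto simp: good_def abs_mult mult_left_le)
  qed (use int_fu[OF good_h g] int_fu[OF good_hh g] g in auto)
  \<comment> \<open>After step \<open>j\<close> the changes of the integral against
    \<open>f (n j)\<close> form a geometric series with total at most \<open>e / 8\<close>, and
    \<open>3 / 4 * e\<close> minus this exceeds \<open>e / 2\<close>.\<close>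
  have stay: "e / 2 \<le> \<bar>LINT t|I01. f (n j) t * hh t\<bar>" for j
  proof -
    have change: "\<bar>(LINT t|I01. f (n j) t * h (Suc k) t) - (LINT t|I01. f (n j) t * h k t)\<bar> \<le> e / 16 * (1/2) ^ k"
      if "j < k" for k
    proof -
      have "(LINT t|I01. f (n j) t * h (Suc k) t) - (LINT t|I01. f (n j) t * h k t)
          = (LINT t|I01. f (n j) t * h (Suc k) t - f (n j) t * h k t)"
        using int_fu[OF good_h f] by simp
      also have "\<bar>\<dots>\<bar> \<le> (LINT t|I01. \<bar>f (n j) t * h (Suc k) t - f (n j) t * h k t\<bar>)"
        by (rule integral_abs_bound)
      also have "\<dots> \<le> (LINT t|I01. 2 * (indicator (E (n k)) t * \<bar>f (n j) t\<bar>))"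
      proof (rule integral_mono)
        show "integrable I01 (\<lambda>t. \<bar>f (n j) t * h (Suc k) t - f (n j) t * h k t\<bar>)"
          using int_fu[OF good_h f] by (intro integrable_abs Bochner_Integration.integrable_diff) auto
        show "integrable I01 (\<lambda>t. 2 * (indicator (E (n k)) t * \<bar>f (n j) t\<bar>))"
          using ind[OF E f] by (intro integrable_mult_right) auto
        fix t
        have "\<bar>h (Suc k) t - h k t\<bar> \<le> 2"
        proof -
          have "\<bar>h (Suc k) t\<bar> \<le> 1" "\<bar>h k t\<bar> \<le> 1" using good_h by (auto simp: good_def)
          then show ?thesis by linarith
        qed
        then have "\<bar>f (n j) t\<bar> * \<bar>h (Suc k) t - h k t\<bar> \<le> \<bar>f (n j) t\<bar> * 2"
          by (rule mult_left_mono) simp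
        then show "\<bar>f (n j) t * h (Suc k) t - f (n j) t * h k t\<bar> \<le> 2 * (indicator (E (n k)) t * \<bar>f (n j) t\<bar>)"
          using FQ(6)[of t k] by (cases "t \<in> E (n k)") (simp_all add: right_diff_distrib[symmetric] abs_mult)
      qed
      also have "\<dots> = 2 * (LINT t|I01. indicator (E (n k)) t * \<bar>f (n j) t\<bar>)" by simp
      also have "\<dots> \<le> e / 16 * (1/2) ^ k" using f_on_E[OF that] by simp
      finally show ?thesis .
    qed
    define a where "a m = (LINT t|I01. f (n j) t * h m t)" for m
    have inc: "\<bar>a (Suc k) - a k\<bar> \<le> e / 16 * (1/2) ^ k" if "j < k" for k
      unfolding a_def by (rule change[OF that])
    have "\<bar>a (Suc j + k) - a (Suc j)\<bar> \<le> e / 16 * (2 - 2 * (1/2) ^ k)" for k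
    proof (induction k)
      case (Suc k)
      have "j < Suc j + k" by simp
      note inc[OF this]
      also have "e / 16 * (1/2) ^ (Suc j + k) \<le> e / 16 * (1/2) ^ k"
        using e by (intro mult_left_mono power_decreasing) auto
      finally have "\<bar>a (Suc j + Suc k) - a (Suc j + k)\<bar> \<le> e / 16 * (1/2) ^ k" by simp
      moreover have "e / 16 * (2 - 2 * (1/2) ^ k) + e / 16 * (1/2) ^ k = e / 16 * (2 - 2 * (1/2) ^ Suc k)"
        by (simp add: algebra_simps)
      ultimately show ?case using Suc by linarith
    qed simp
    moreover have "e / 16 * (2 - 2 * (1/2) ^ k) \<le> e / 8" for k
      using e by (simp add: algebra_simps)
    ultimately have "\<bar>a (Suc j + k) - a (Suc j)\<bar> \<le> e / 8" for k by (meson order_trans)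
    moreover have "(\<lambda>k. \<bar>a (Suc j + k) - a (Suc j)\<bar>) \<longlonglongrightarrow> \<bar>(LINT t|I01. f (n j) t * hh t) - a (Suc j)\<bar>"
    proof -
      have "a \<longlonglongrightarrow> (LINT t|I01. f (n j) t * hh t)" unfolding a_def[abs_def] by (rule int_lim[OF f])
      from LIMSEQ_ignore_initial_segment[OF this, of "Suc j"] show ?thesis
        by (intro tendsto_intros) (simp add: add.commute)
    qed
    ultimately have "\<bar>(LINT t|I01. f (n j) t * hh t) - a (Suc j)\<bar> \<le> e / 8"
      by (intro LIMSEQ_le_const2) auto
    moreover have "3 / 4 * e \<le> \<bar>a (Suc j)\<bar>" using FQ(7)[of j] by (simp add: a_def)
    ultimately show ?thesis using e by linarith
  qed
  \<comment> \<open>A cluster point of the subsequence alone. Each \<open>h j\<close> takes the same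
    value at \<open>z'\<close> and \<open>z\<close>, since its integrals against
    \<open>f (n k)\<close> tend to 0; by dominated convergence so does \<open>hh\<close>. But along
    the subsequence \<open>hh\<close> comes close to its value at \<open>z'\<close>, contrary to
    \<open>stay\<close>.\<close>
  obtain z' where z'K: "z' \<in> K" and z': "\<forall>H e N. finite H \<and> H \<subseteq> dual Y \<and> 0 < (e::real) \<longrightarrow>
      (\<exists>k\<ge>(N::nat). \<forall>\<phi>\<in>H. \<bar>\<phi> (y (n k)) - \<phi> z'\<bar> < e)"
    by (rule bexE[OF weakly_compact_cluster_point[OF K, of "\<lambda>k. y (n k)"]]) (rule yY(2))
  have z'Y: "z' \<in> Y" using z'K K(2) by auto
  define g where "g t = T z' t - T z t" for t
  have g: "integrable I01 g" unfolding g_def[abs_def] using integrable_T z'Y zY by simp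
  have gu: "(LINT t|I01. g t * u t) = T_functional u z' - T_functional u z" if "good u" for u
    using integrable_T_mult[OF goodD[OF that]] z'Y zY
    by (simp add: g_def left_diff_distrib T_functional_def)
  have "(LINT t|I01. g t * h j t) = 0" for j
  proof (rule ccontr)
    assume "(LINT t|I01. g t * h j t) \<noteq> 0"
    then have d: "0 < \<bar>LINT t|I01. g t * h j t\<bar> / 2" by simp
    then obtain N where N: "(1/2) ^ N < \<bar>LINT t|I01. g t * h j t\<bar> / 2"
      using real_arch_pow_inv[OF d, of "1/2"] by auto
    obtain k where k: "max j N \<le> k" "\<bar>T_functional (h j) (y (n k)) - T_functional (h j) z'\<bar> < \<bar>LINT t|I01. g t * h j t\<bar> / 2"
      using z'[rule_format, of "{T_functional (h j)}" "\<bar>LINT t|I01. g t * h j t\<bar> / 2" "max j N"] d good_dual[OF good_h] by auto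
    have "\<bar>LINT t|I01. f (n k) t * h j t\<bar> \<le> (1/2) ^ k" using FQ(3)[OF H_mono] k(1) by simp
    also have "\<dots> \<le> (1/2) ^ N" using k(1) by (intro power_decreasing) auto
    finally have "\<bar>LINT t|I01. f (n k) t * h j t\<bar> \<le> (1/2) ^ N" .
    moreover have False if "\<bar>a - b\<bar> \<le> c" "\<bar>a - b'\<bar> < \<bar>b' - b\<bar> / 2" "c < \<bar>b' - b\<bar> / 2" for a b b' c :: real
    proof -
      have "\<bar>b' - b\<bar> \<le> \<bar>a - b\<bar> + \<bar>a - b'\<bar>"
        using abs_triangle_ineq4[of "a - b" "a - b'"] by simp
      also have "\<dots> < \<bar>b' - b\<bar> / 2 + \<bar>b' - b\<bar> / 2"
        using that(2) le_less_trans[OF that(1,3)] by (intro add_strict_mono)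
      finally show False by simp
    qed
    ultimately show False using k(2) N unfolding fu[OF good_h] gu[OF good_h] by blast
  qed
  then have "(LINT t|I01. g t * hh t) = 0" using int_lim[OF g] by (simp add: LIMSEQ_const_iff)
  then have eq: "T_functional hh z' = T_functional hh z" using gu[OF good_hh] by simp
  obtain k where "\<bar>T_functional hh (y (n k)) - T_functional hh z'\<bar> < e / 2"
    using z'[rule_format, of "{T_functional hh}" "e / 2" 0] e good_dual[OF good_hh] by auto
  then show False using stay[of k] unfolding fu[OF good_hh] eq by linarith
qed

end

theorem weakly_compact_imp_uniformly_integrable:
  assumes "compactin (weak_topology Y) K" "K \<subseteq> Y" "W \<subseteq> K"
    and "\<And>y. y \<in> W \<Longrightarrow> (LINT t|I01. \<bar>T y t\<bar>) \<le> R" and "0 < e"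
  shows "\<exists>n::nat. \<forall>y\<in>W. (LINT t|I01. indicator {t \<in> {0..1}. real n < \<bar>T y t\<bar>} t * \<bar>T y t\<bar>) \<le> e"
proof (rule ccontr)
  assume "\<not> ?thesis"
  then have "\<exists>y\<in>W. e < (LINT t|I01. indicator {t \<in> {0..1}. real n < \<bar>T y t\<bar>} t * \<bar>T y t\<bar>)" for n :: nat
    by (auto simp: not_le)
  with assms show False by (rule not_ui_False)
qed

end

subsection \<open>Factorisation through the Haar tree space\<close>

definition haar_norm :: "(nat \<Rightarrow> real) \<Rightarrow> real" where
  "haar_norm x = (LINT t|I01. \<bar>pair (\<lambda>k. haar k t) x\<bar>)"

lemma haar_norm_eq:
  "(\<And>k. n \<le> k \<Longrightarrow> x k = 0) \<Longrightarrow> haar_norm x = (LINT t|I01. \<bar>\<Sum>k<n. x k * haar k t\<bar>)"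
  by (simp add: haar_norm_def pair_eq[of n] mult.commute)

lemma integrable_pair_haar: "x \<in> c00 \<Longrightarrow> integrable I01 (\<lambda>t. pair (\<lambda>k. haar k t) x)"
proof -
  assume "x \<in> c00"
  then obtain n where "\<forall>k\<ge>n. x k = 0" by (rule c00E)
  then show ?thesis using integrable_haar_sum[where a = x and N = n] by (simp add: pair_eq[of n] mult.commute)
qed

interpretation haar_tree: tree_norm haar_norm
proof
  show "seminorm00 haar_norm"
    unfolding seminorm00_def
  proof (intro conjI ballI allI)
    fix x y :: "nat \<Rightarrow> real" assume xy: "x \<in> c00" "y \<in> c00"
    have "haar_norm (\<lambda>k. x k + y k) \<le> (LINT t|I01. \<bar>pair (\<lambda>k. haar k t) x\<bar> + \<bar>pair (\<lambda>k. haar k t) y\<bar>)"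
      unfolding haar_norm_def using integrable_pair_haar xy
      by (intro integral_mono integrable_abs Bochner_Integration.integrable_add)
        (auto simp: pair_add intro: abs_triangle_ineq)
    then show "haar_norm (\<lambda>k. x k + y k) \<le> haar_norm x + haar_norm y"
      using integrable_pair_haar xy by (simp add: haar_norm_def)
  qed (simp add: haar_norm_def pair_scale abs_mult)
next
  fix x :: "nat \<Rightarrow> real" assume "x \<in> c00"
  then obtain n where "\<forall>k\<ge>n. x k = 0" by (rule c00E)
  then show "haar_norm x \<le> l2 x"
    using haar_sum_L1_le_l2[of x n] by (simp add: haar_norm_eq[of n] l2_eq[of n])
next
  show "0 < haar_norm (unit_seq k)" for k
    using haar_L1_pos by (simp add: haar_norm_def)
qed

section \<open>Sequences placed along a branch of the tree\<close>

locale branch =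
  fixes b :: "nat \<Rightarrow> nat"
  assumes b_0: "b 0 = 0" and parent_b: "parent (b (Suc k)) = b k" and b_Suc_pos: "0 < b (Suc k)"
begin

lemma lev_b [simp]: "lev (b k) = k"
  by (induction k) (simp_all add: b_0 lev_pos[OF b_Suc_pos] parent_b)

lemma b_less: "b k < b (Suc k)"
  using parent_less[OF b_Suc_pos, of k] by (simp add: parent_b)

lemma strict_mono_b: "strict_mono b"
  by (simp add: strict_mono_Suc_iff b_less)

lemma le_b: "k \<le> b k"
  by (rule strict_mono_imp_increasing[OF strict_mono_b])

lemma anc_b: "k \<le> j \<Longrightarrow> anc (b j) k = b k"
proof (induction j)
  case (Suc j)
  then show ?case using anc_parent[of k "b (Suc j)"] by (cases "k = Suc j") (auto simp: parent_b)
qed simp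

definition along :: "(nat \<Rightarrow> 'a::zero) \<Rightarrow> nat \<Rightarrow> 'a" where
  "along c v = (if v = b (lev v) then c (lev v) else 0)"

lemma along_b [simp]: "along c (b k) = c k"
  by (simp add: along_def)

lemma sum_along:
  fixes g :: "nat \<Rightarrow> real"
  assumes "\<And>v. v \<noteq> b (lev v) \<Longrightarrow> g v = 0"
  shows "(\<Sum>v<b M. g v) = (\<Sum>k<M. g (b k))"
proof -
  have "(\<Sum>k<M. g (b k)) = (\<Sum>v\<in>b ` {..<M}. g v)"
    using strict_mono_imp_inj_on[OF strict_mono_b, of "{..<M}"] by (simp add: sum.reindex)
  also have "\<dots> = (\<Sum>v<b M. g v)"
  proof (rule sum.mono_neutral_left)
    show "b ` {..<M} \<subseteq> {..<b M}" using strict_mono_b by (auto simp: strict_mono_less)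
    show "\<forall>v\<in>{..<b M} - b ` {..<M}. g v = 0"
    proof
      fix v assume v: "v \<in> {..<b M} - b ` {..<M}"
      have "v \<noteq> b (lev v)"
      proof
        assume eq: "v = b (lev v)"
        then have "b (lev v) < b M" using v by simp
        then have "lev v < M" using strict_mono_b by (simp add: strict_mono_less)
        then show False using v eq by blast
      qed
      then show "g v = 0" by (rule assms)
    qed
  qed simp
  finally show ?thesis by simp
qed

text \<open>A segment meets the branch in an initial piece.\<close>

lemma segment_along:
  assumes v: "v \<in> desc w" "w = b (lev w)"
  shows "\<exists>j. segment (trunc N (along c)) w v = (\<lambda>k. if lev w \<le> k \<and> k < j then c k else (0::real))"
proof -
  define on where "on k \<longleftrightarrow> k \<le> lev v \<and> anc v k = b k \<and> b k < N" for k
  have down: "on i" if "on k" "i \<le> k" for i k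
    using that anc_anc[of i k v] anc_b[of i k] strict_mono_leD[OF strict_mono_b, of i k] by (auto simp: on_def)
  define j where "j = (LEAST k. \<not> on k)"
  have "\<not> on (Suc (lev v))" by (simp add: on_def)
  then have j: "\<not> on j" unfolding j_def by (rule LeastI)
  have on_iff: "on k \<longleftrightarrow> k < j" for k
    using down[of k j] j not_less_Least[of k "\<lambda>k. \<not> on k"] unfolding j_def[symmetric]
    by (cases "k < j") auto
  have "segment (trunc N (along c)) w v k = (if lev w \<le> k \<and> on k then c k else 0)" for k
    by (auto simp: segment_def trunc_def along_def on_def lev_anc)
  then show ?thesis by (auto simp: on_iff fun_eq_iff)
qed

text \<open>The ancestors of a node of the branch lie on the branch, so the subtree at a node off
  the branch misses it.\<close>

lemma q_along_off:
  assumes "w \<noteq> b (lev w)" shows "haar_tree.q w (trunc N (along c)) = 0"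
proof -
  have "segment (trunc N (along c)) w v = (\<lambda>_. 0)" if v: "v \<in> desc w" for v
  proof
    fix k
    show "segment (trunc N (along c)) w v k = 0"
    proof (cases "lev w \<le> k \<and> k \<le> lev v")
      case True
      have "anc v k \<noteq> b k"
      proof
        assume "anc v k = b k"
        then have "anc v (lev w) = b (lev w)" using True anc_anc[of "lev w" k v] anc_b[of "lev w" k] by simp
        then show False using v assms by (simp add: desc_def)
      qed
      then show ?thesis using True by (simp add: segment_def trunc_def along_def lev_anc)
    qed (auto simp: segment_def)
  qed
  then have "haar_tree.q w (trunc N (along c)) \<le> 0"
    by (intro haar_tree.q_least) (simp add: seminorm00_zero[OF haar_tree.seminorm_\<beta>])
  then show ?thesis using haar_tree.q_nonneg[OF c00_trunc, of w N "along c"] by simp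
qed

text \<open>On the branch a segment is the difference of two Haar partial sums of \<open>f\<close>,
  each of which is a contraction in \<open>L1\<close>.\<close>

lemma q_along_le:
  assumes f: "integrable I01 f"
  shows "haar_tree.q w (trunc N (along (haar_coef f))) \<le> 2 * (LINT t|I01. \<bar>f t\<bar>)"
proof (cases "w = b (lev w)")
  case True
  show ?thesis
  proof (rule haar_tree.q_least)
    fix v assume "v \<in> desc w"
    then obtain j where seg: "segment (trunc N (along (haar_coef f))) w v
        = (\<lambda>k. if lev w \<le> k \<and> k < j then haar_coef f k else 0)"
      using segment_along[OF _ True] by blast
    let ?P = "\<lambda>j t. \<Sum>k<j. haar_coef f k * haar k t"
    have "haar_norm (segment (trunc N (along (haar_coef f))) w v)
        \<le> haar_norm (trunc j (haar_coef f)) + haar_norm (trunc (lev w) (haar_coef f))"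
    proof (cases "lev w \<le> j")
      case True
      then have "(\<lambda>k. if lev w \<le> k \<and> k < j then haar_coef f k else 0)
          = (\<lambda>k. trunc j (haar_coef f) k - trunc (lev w) (haar_coef f) k)"
        by (auto simp: trunc_def)
      then show ?thesis unfolding seg
        using seminorm00_diff[OF haar_tree.seminorm_\<beta> c00_trunc c00_trunc] by simp
    next
      case False
      then have "segment (trunc N (along (haar_coef f))) w v = (\<lambda>_. 0)" unfolding seg by auto
      then show ?thesis
        using haar_tree.\<beta>_nonneg[OF c00_trunc] by (simp add: seminorm00_zero[OF haar_tree.seminorm_\<beta>])
    qed
    also have "\<dots> \<le> (LINT t|I01. \<bar>f t\<bar>) + (LINT t|I01. \<bar>f t\<bar>)"
    proof (rule add_mono)
      show "haar_norm (trunc i (haar_coef f)) \<le> (LINT t|I01. \<bar>f t\<bar>)" for i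
        using haar_projection_L1[OF f, of i] by (simp add: haar_norm_def pair_trunc mult.commute)
      then show "haar_norm (trunc (lev w) (haar_coef f)) \<le> (LINT t|I01. \<bar>f t\<bar>)" .
    qed
    finally show "haar_norm (segment (trunc N (along (haar_coef f))) w v) \<le> 2 * (LINT t|I01. \<bar>f t\<bar>)"
      by simp
  qed
next
  case False
  have "0 \<le> (LINT t|I01. \<bar>f t\<bar>)" by (rule integral_nonneg_AE) simp
  then show ?thesis using q_along_off[OF False] by simp
qed

lemma haar_coef_add:
  "integrable I01 f \<Longrightarrow> integrable I01 g \<Longrightarrow> haar_coef (\<lambda>t. f t + g t) k = haar_coef f k + haar_coef g k"
  by (simp add: haar_coef_def distrib_right integrable_haar_mult)

text \<open>The interpolation norm is tested with the decomposition into the coefficients of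
  \<open>u\<close>, controlled by Bessel's inequality, and those of \<open>w\<close>, controlled in
  \<open>L1\<close>.\<close>

lemma N_along_le:
  assumes u: "u \<in> borel_measurable I01" "\<And>t. t \<in> {0..1} \<Longrightarrow> \<bar>u t\<bar> \<le> M" and w: "integrable I01 w"
  shows "haar_tree.N (b n) (trunc N (along (haar_coef (\<lambda>t. u t + w t))))
    \<le> M / (real (label (b n)) + 1) + 2 ^ n * (2 * (LINT t|I01. \<bar>w t\<bar>))"
proof -
  have ui: "integrable I01 u" by (rule integrable_I01_bounded[OF u])
  let ?u = "trunc N (along (haar_coef u))" and ?w = "trunc N (along (haar_coef w))"
  let ?x = "trunc N (along (haar_coef (\<lambda>t. u t + w t)))"
  have diff: "(\<lambda>k. ?x k - ?u k) = ?w"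
    by (auto simp: trunc_def along_def haar_coef_add[OF ui w])
  have "l2 ?u \<le> M"
  proof (rule power2_le_imp_le)
    have "(l2 ?u)\<^sup>2 = (\<Sum>v<b N. (?u v)\<^sup>2)"
      using le_b[of N] by (intro l2_sq) (simp add: trunc_def)
    also have "\<dots> = (\<Sum>k<N. (?u (b k))\<^sup>2)"
      by (rule sum_along) (simp add: trunc_def along_def)
    also have "\<dots> \<le> (\<Sum>k<N. (haar_coef u k)\<^sup>2)"
      by (intro sum_mono) (simp add: trunc_def)
    also have "\<dots> \<le> M\<^sup>2" by (rule haar_bessel[OF u])
    finally show "(l2 ?u)\<^sup>2 \<le> M\<^sup>2" .
    show "0 \<le> M" using u(2)[of 0] by simp
  qed
  then have "l2 ?u / (real (label (b n)) + 1) \<le> M / (real (label (b n)) + 1)"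
    by (intro divide_right_mono) auto
  moreover have "2 ^ n * haar_tree.q (b n) ?w \<le> 2 ^ n * (2 * (LINT t|I01. \<bar>w t\<bar>))"
    by (intro mult_left_mono q_along_le[OF w]) simp
  ultimately show ?thesis
    using haar_tree.N_upper[OF c00_trunc c00_trunc, of "b n" N "along (haar_coef (\<lambda>t. u t + w t))" N "along (haar_coef u)"]
    unfolding diff lev_b by (meson add_mono order_trans)
qed

text \<open>If the labels of the branch grow fast enough to witness the uniform integrability of \<open>f\<close>,
  then the terms \<open>nu\<close> decay geometrically along it.\<close>

lemma p_along_le:
  assumes f: "integrable I01 f" and R: "(LINT t|I01. \<bar>f t\<bar>) \<le> R"
    and ui: "\<And>n. (LINT t|I01. indicator {t \<in> {0..1}. real (m n) < \<bar>f t\<bar>} t * \<bar>f t\<bar>) \<le> (1/4) ^ n"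
    and label: "\<And>n. 0 < n \<Longrightarrow> label (b n) = m n * 2 ^ n"
  shows "haar_tree.p (trunc N (along (haar_coef f))) \<le> 2 * (3 + 4 * R)"
proof -
  let ?x = "trunc N (along (haar_coef f))"
  have "0 \<le> (LINT t|I01. \<bar>f t\<bar>)" by (rule integral_nonneg_AE) simp
  then have R0: "0 \<le> R" using R by linarith
  have q: "haar_tree.q w ?x \<le> 2 * R" for w using q_along_le[OF f, of w N] R by simp
  \<comment> \<open>At the root, whose label is not at disposal, only \<open>nu \<le> 2 * q\<close>
    and \<open>q \<le> 2 * R\<close> are used; this is the origin of \<open>4 * R\<close>. Elsewhere
    the Hilbert part gives \<open>1 / 2 ^ n\<close> and the \<open>L1\<close> part
    \<open>2 / 2 ^ n\<close>, together the constant 3.\<close>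
  have nu: "haar_tree.nu ?x (b n) \<le> (3 + 4 * R) / 2 ^ n" for n
  proof (cases "n = 0")
    case True
    have "haar_tree.nu ?x (b n) \<le> 2 * haar_tree.q (b n) ?x"
      using haar_tree.nu_le_q[OF c00_trunc, of N "along (haar_coef f)" "b n"] True by simp
    then show ?thesis using q[of "b n"] True by simp
  next
    case False
    define A where "A = {t \<in> {0..1}. real (m n) < \<bar>f t\<bar>}"
    have A: "A \<in> sets I01"
    proof -
      have "{t \<in> space I01. real (m n) < \<bar>f t\<bar>} \<in> sets I01"
        using borel_measurable_integrable[OF f] by measurable
      then show ?thesis by (simp add: A_def)
    qed
    \<comment> \<open>The function is replaced by 0 where it exceeds \<open>m n\<close> in absolute
      value; \<open>w\<close> is the part removed, of \<open>L1\<close> norm at most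
      \<open>1 / 4 ^ n\<close>.\<close>
    define u where "u t = f t - indicator A t * f t" for t
    define w where "w t = indicator A t * f t" for t
    have w: "integrable I01 w"
      unfolding w_def[abs_def] using integrable_I01_mult_bounded[OF f, of "indicator A" 1] A
      by (simp add: mult.commute indicator_def)
    have u: "u \<in> borel_measurable I01"
      using borel_measurable_integrable[OF f] borel_measurable_integrable[OF w] unfolding u_def w_def by simp
    have ub: "\<bar>u t\<bar> \<le> real (m n)" if "t \<in> {0..1}" for t
      using that by (auto simp: u_def A_def indicator_def)
    have "(LINT t|I01. \<bar>w t\<bar>) \<le> (1/4) ^ n"
      using ui[of n] unfolding A_def[symmetric] by (simp add: w_def abs_mult)
    have "haar_tree.N (b n) ?x \<le> real (m n) / (real (label (b n)) + 1) + 2 ^ n * (2 * (LINT t|I01. \<bar>w t\<bar>))"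
      using N_along_le[OF u ub w, of n N] by (simp add: u_def w_def)
    also have "real (m n) / (real (label (b n)) + 1) \<le> 1 / 2 ^ n"
    proof -
      have "real (m n) * 2 ^ n \<le> real (label (b n)) + 1" using label[of n] False by simp
      moreover have "x / d \<le> 1 / y" if "x * y \<le> d" "0 < d" "0 < y" for x y d :: real
        using that by (simp add: divide_simps)
      ultimately show ?thesis by simp
    qed
    also have "2 ^ n * (2 * (LINT t|I01. \<bar>w t\<bar>)) \<le> 2 ^ n * (2 * (1/4) ^ n)"
      using \<open>(LINT t|I01. \<bar>w t\<bar>) \<le> (1/4) ^ n\<close> by (intro mult_left_mono) auto
    also have "2 ^ n * (2 * (1/4) ^ n) = (2::real) / 2 ^ n"
    proof -
      have "(4::real) ^ n = 2 ^ n * 2 ^ n" by (simp flip: power_mult_distrib)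
      then show ?thesis by (simp add: power_one_over)
    qed
    finally have "haar_tree.N (b n) ?x \<le> 3 / 2 ^ n" by (simp flip: add_divide_distrib)
    moreover have "haar_tree.q (b n) ?x / 2 ^ n \<le> 4 * R / 2 ^ n"
      using q[of "b n"] R0 by (intro divide_right_mono) auto
    ultimately show ?thesis unfolding haar_tree.nu_def by (simp add: add_divide_distrib)
  qed
  have "haar_tree.p ?x \<le> (\<Sum>v<b N. \<bar>haar_tree.nu ?x v\<bar>)"
    unfolding haar_tree.p_def
    using le_b[of N] by (intro l2_le_sum_abs haar_tree.nu_eq_0) (simp add: trunc_def)
  also have "\<dots> = (\<Sum>k<N. \<bar>haar_tree.nu ?x (b k)\<bar>)"
  proof (rule sum_along)
    show "\<bar>haar_tree.nu ?x v\<bar> = 0" if "v \<noteq> b (lev v)" for v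
      using haar_tree.nu_le_q[OF c00_trunc, of N "along (haar_coef f)" v]
        haar_tree.nu_nonneg[OF c00_trunc, of N "along (haar_coef f)" v] q_along_off[OF that, of N "haar_coef f"] by simp
  qed
  also have "\<dots> \<le> (\<Sum>k<N. (3 + 4 * R) * (1/2) ^ k)"
  proof (rule sum_mono)
    fix k
    have "(3 + 4 * R) / 2 ^ k = (3 + 4 * R) * (1/2) ^ k" by (simp add: power_one_over)
    then show "\<bar>haar_tree.nu ?x (b k)\<bar> \<le> (3 + 4 * R) * (1/2) ^ k"
      using nu[of k] abs_of_nonneg[OF haar_tree.nu_nonneg[OF c00_trunc, of N "along (haar_coef f)" "b k"]] by simp
  qed
  also have "\<dots> = (3 + 4 * R) * (\<Sum>k<N. (1/2) ^ k)" by (simp add: sum_distrib_left)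
  also have "(\<Sum>k<N. (1/2::real) ^ k) \<le> 2"
  proof -
    have "(\<Sum>k<N. (1/2::real) ^ k) = 2 - 2 * (1/2) ^ N" by (induction N) auto
    then show ?thesis by simp
  qed
  finally show ?thesis using R0 by (simp add: mult_left_mono mult.commute)
qed

end

section \<open>Factoring a weakly compact operator\<close>

lemma dual_fdiff:
  assumes "X \<in> SB" "\<phi> \<in> dual X" "f \<in> X" "g \<in> X"
  shows "\<phi> (fdiff f g) = \<phi> f - \<phi> g"
proof -
  have "fdiff f g = fadd f (fscale (- 1) g)" by (simp add: fdiff_def fadd_def fscale_def)
  moreover have "\<phi> (fadd f (fscale (- 1) g)) = \<phi> f + \<phi> (fscale (- 1) g)"
    using assms(2,3) SB_scale[OF assms(1,4)] unfolding dual_def by blast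
  moreover have "\<phi> (fscale (- 1) g) = - 1 * \<phi> g"
    using assms(2,4) unfolding dual_def by blast
  ultimately show ?thesis by simp
qed

lemma dual_continuous:
  assumes X: "X \<in> SB" and \<phi>: "\<phi> \<in> dual X" and s: "\<And>n. s n \<in> X" "f \<in> X" "cd_converges s f"
  shows "(\<lambda>n. \<phi> (s n)) \<longlonglongrightarrow> \<phi> f"
proof -
  obtain K where K: "\<And>x. x \<in> X \<Longrightarrow> \<bar>\<phi> x\<bar> \<le> K * supnorm x" using \<phi> unfolding dual_def by blast
  show ?thesis
  proof (rule LIM_zero_cancel, rule tendsto_rabs_zero_cancel, rule nonneg_null_squeeze)
    show "(\<lambda>n. K * supnorm (fdiff (s n) f)) \<longlonglongrightarrow> 0"
      using tendsto_mult[OF tendsto_const s(3)[unfolded cd_converges_def], of K] by simp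
    show "\<bar>\<phi> (s n) - \<phi> f\<bar> \<le> K * supnorm (fdiff (s n) f)" for n
      using K[OF SB_diff[OF X s(1,2)]] dual_fdiff[OF X \<phi> s(1,2)] by simp
  qed simp
qed

context L1_isomorphism
begin

lemma T_sum:
  assumes "finite I" "\<And>i. i \<in> I \<Longrightarrow> f i \<in> Y"
  shows "AE t in I01. T (\<lambda>s. \<Sum>i\<in>I. a i * f i s) t = (\<Sum>i\<in>I. a i * T (f i) t)"
  using assms
proof (induction I rule: finite_induct)
  case empty
  have "fscale 0 (\<lambda>_. 0) = (\<lambda>_. 0)" by (simp add: fscale_def)
  then show ?case using T_scale[OF SB_zero[OF Y], of 0] by simp
next
  case (insert i I)
  have Y': "fscale (a i) (f i) \<in> Y" "(\<lambda>s. \<Sum>i\<in>I. a i * f i s) \<in> Y"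
    using insert.prems by (auto intro: SB_scale[OF Y] SB_sum[OF Y])
  have "(\<lambda>s. \<Sum>i\<in>insert i I. a i * f i s) = fadd (fscale (a i) (f i)) (\<lambda>s. \<Sum>i\<in>I. a i * f i s)"
    using insert.hyps by (simp add: fadd_def fscale_def)
  moreover have "AE t in I01. T (\<lambda>s. \<Sum>i\<in>I. a i * f i s) t = (\<Sum>i\<in>I. a i * T (f i) t)"
    using insert by blast
  moreover have "AE t in I01. T (fscale (a i) (f i)) t = a i * T (f i) t"
    using insert.prems by (intro T_scale) simp
  ultimately show ?case using T_add[OF Y'] insert.hyps by auto
qed

lemma haar_coef_T_add:
  "y \<in> Y \<Longrightarrow> z \<in> Y \<Longrightarrow> haar_coef (T (fadd y z)) k = haar_coef (T y) k + haar_coef (T z) k"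
  unfolding haar_coef_def by (rule integral_T_add[OF measurable_haar abs_haar_le])

lemma haar_coef_T_scale: "y \<in> Y \<Longrightarrow> haar_coef (T (fscale a y)) k = a * haar_coef (T y) k"
  unfolding haar_coef_def by (rule integral_T_scale[OF measurable_haar abs_haar_le])

text \<open>\<open>B\<close> places the Haar coefficients of \<open>T (A x)\<close> on the branch
  whose labels suit the image of the unit ball. The second operator, called \<open>D\<close> in the
  proof, sends the basis vectors on the branch to preimages of the Haar functions and all others to
  0; it is bounded because the norm at the root dominates the \<open>L1\<close> norm along every
  path. The composition is identified by testing with dyadic indicators, for which the partial sums
  are eventually exact.\<close>

theorem weakly_compact_op_factors:
  assumes X: "X \<in> SB" and A: "bounded_op X Y A" and wc: "weakly_compact_op X Y A"
  shows "\<exists>B C. bounded_op X haar_tree.realization B \<and> bounded_op haar_tree.realization Y C \<and>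
    (\<forall>x\<in>X. A x = C (B x))"
proof -
  have AY: "A x \<in> Y" if "x \<in> X" for x using A that by (simp add: bounded_op_def)
  have A_add: "A (fadd x x') = fadd (A x) (A x')" if "x \<in> X" "x' \<in> X" for x x'
    using A that by (simp add: bounded_op_def)
  have A_scale: "A (fscale r x) = fscale r (A x)" if "x \<in> X" for r x
    using A that by (simp add: bounded_op_def)
  obtain K0 where K0: "\<forall>x\<in>X. supnorm (A x) \<le> K0 * supnorm x" using A unfolding bounded_op_def by blast
  define W where "W = A ` {x \<in> X. supnorm x \<le> 1}"
  define R where "R = \<bar>C\<bar> * \<bar>K0\<bar>"
  have R: "(LINT t|I01. \<bar>T y t\<bar>) \<le> R" if y: "y \<in> W" for y
  proof -
    obtain x where x: "x \<in> X" "supnorm x \<le> 1" "y = A x" using y unfolding W_def by blast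
    have s0: "0 \<le> supnorm x" using SB_CD[OF X x(1)] by (rule supnorm_nonneg)
    have "supnorm y \<le> K0 * supnorm x" using K0 x by simp
    also have "\<dots> \<le> \<bar>K0\<bar> * 1" using x(2) s0 by (intro mult_mono) auto
    finally have "supnorm y \<le> \<bar>K0\<bar>" by simp
    moreover have "0 \<le> supnorm y" using SB_CD[OF Y AY[OF x(1)]] x(3) by (simp add: supnorm_nonneg)
    ultimately have "C * supnorm y \<le> R" unfolding R_def by (intro mult_mono) auto
    then show ?thesis using T_upper[OF AY[OF x(1)]] x(3) by simp
  qed
  obtain K where K: "K \<subseteq> Y" "compactin (weak_topology Y) K" "W \<subseteq> K"
    using wc unfolding weakly_compact_op_def W_def by blast
  have "\<forall>n. \<exists>m::nat. \<forall>y\<in>W. (LINT t|I01. indicator {t \<in> {0..1}. real m < \<bar>T y t\<bar>} t * \<bar>T y t\<bar>) \<le> (1/4) ^ n"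
    by (intro allI weakly_compact_imp_uniformly_integrable[OF K(2,1,3) R]) auto
  from choice[OF this] obtain m :: "nat \<Rightarrow> nat" where m:
    "\<forall>n. \<forall>y\<in>W. (LINT t|I01. indicator {t \<in> {0..1}. real (m n) < \<bar>T y t\<bar>} t * \<bar>T y t\<bar>) \<le> (1/4) ^ n" by blast
  define b where "b = rec_nat 0 (\<lambda>k v. child v (m (Suc k) * 2 ^ Suc k))"
  have b0: "b 0 = 0" and bS: "b (Suc k) = child (b k) (m (Suc k) * 2 ^ Suc k)" for k
    by (simp_all add: b_def)
  interpret branch b
    by unfold_locales (simp_all add: b0 bS child_pos)
  have label: "label (b n) = m n * 2 ^ n" if "0 < n" for n
    using that by (cases n) (simp_all add: bS)
  define \<alpha> where "\<alpha> x = along (haar_coef (T (A x)))" for x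
  have \<alpha>_scale: "\<alpha> (fscale r x) = (\<lambda>k. r * \<alpha> x k)" if "x \<in> X" for r x
    using that AY by (auto simp: \<alpha>_def along_def A_scale haar_coef_T_scale)
  have "haar_tree.p (trunc N (\<alpha> x)) \<le> (2 * (3 + 4 * R)) * supnorm x" if x: "x \<in> X" for x N
  proof (cases "supnorm x = 0")
    case True
    then have "x = (\<lambda>_. 0)" using supnorm_eq_0[OF SB_CD[OF X x]] by simp
    then have "fscale 0 x = x" by (simp add: fscale_def)
    then have "\<alpha> x = (\<lambda>_. 0)" using \<alpha>_scale[OF x, of 0] by simp
    then have "trunc N (\<alpha> x) = (\<lambda>_. 0)" by (auto simp: trunc_def)
    then show ?thesis using True seminorm00_zero[OF haar_tree.seminorm_p] by simp
  next
    case False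
    then have s: "0 < supnorm x" using supnorm_nonneg[OF SB_CD[OF X x]] by simp
    define x' where "x' = fscale (1 / supnorm x) x"
    have x': "x' \<in> X" unfolding x'_def by (rule SB_scale[OF X x])
    have "supnorm x' = 1"
      using supnorm_scale[OF SB_CD[OF X x], of "1 / supnorm x"] s by (simp add: x'_def fscale_def)
    then have W': "A x' \<in> W" using x' by (auto simp: W_def)
    have "x = fscale (supnorm x) x'" using s by (simp add: x'_def fscale_def)
    then have "trunc N (\<alpha> x) = (\<lambda>k. supnorm x * trunc N (\<alpha> x') k)"
      using \<alpha>_scale[OF x', of "supnorm x"] by (simp add: trunc_scale[symmetric])
    then have "haar_tree.p (trunc N (\<alpha> x)) = supnorm x * haar_tree.p (trunc N (\<alpha> x'))"
      using seminorm00_scale[OF haar_tree.seminorm_p c00_trunc, of "supnorm x" N "\<alpha> x'"] s by simp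
    also have "haar_tree.p (trunc N (\<alpha> x')) \<le> 2 * (3 + 4 * R)"
      unfolding \<alpha>_def using m W' by (intro p_along_le[OF integrable_T[OF AY[OF x']] R[OF W'] _ label]) auto
    finally show ?thesis using s by (simp add: mult.commute)
  qed
  moreover have "\<alpha> (fadd x x') k = \<alpha> x k + \<alpha> x' k" if "x \<in> X" "x' \<in> X" for x x' k
    using that AY by (simp add: \<alpha>_def along_def A_add haar_coef_T_add)
  moreover have "\<alpha> (fscale r x) k = r * \<alpha> x k" if "x \<in> X" for r x k
    using \<alpha>_scale[OF that, of r] by simp
  ultimately have "\<exists>B. bounded_op X haar_tree.realization B \<and> (\<forall>x\<in>X. haar_tree.coef (B x) = \<alpha> x)"
    using haar_tree.ex_bounded_op_into[OF X] by blast
  then obtain B where B: "bounded_op X haar_tree.realization B" "\<And>x. x \<in> X \<Longrightarrow> haar_tree.coef (B x) = \<alpha> x"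
    by blast
  have "\<forall>k. \<exists>y\<in>Y. AE t in I01. T y t = haar k t" using T_onto integrable_haar by blast
  then obtain y where y: "\<And>k. y k \<in> Y" "\<And>k. AE t in I01. T (y k) t = haar k t" by metis
  define y' where "y' v = (if v = b (lev v) then y (lev v) else (\<lambda>_. 0))" for v
  have y': "y' v \<in> Y" for v using y(1) SB_zero[OF Y] by (simp add: y'_def)
  have pair_y': "(\<lambda>t. pair (\<lambda>v. y' v t) (trunc (b M) x)) = (\<lambda>t. \<Sum>k<M. x (b k) * y k t)" for M x
  proof
    fix t
    have "(\<Sum>v<b M. y' v t * x v) = (\<Sum>k<M. y' (b k) t * x (b k))"
      by (rule sum_along) (simp add: y'_def)
    then show "pair (\<lambda>v. y' v t) (trunc (b M) x) = (\<Sum>k<M. x (b k) * y k t)"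
      by (simp add: pair_trunc y'_def mult.commute)
  qed
  have T_sum_y: "AE t in I01. T (\<lambda>t. \<Sum>k<M. c k * y k t) t = (\<Sum>k<M. c k * haar k t)" for M c
  proof -
    have "AE t in I01. \<forall>k\<in>{..<M}. T (y k) t = haar k t" using y(2) by (intro AE_finite_allI) auto
    moreover have "AE t in I01. T (\<lambda>t. \<Sum>k<M. c k * y k t) t = (\<Sum>k<M. c k * T (y k) t)"
      by (rule T_sum) (auto simp: y(1))
    ultimately show ?thesis by eventually_elim simp
  qed
  have "supnorm (\<lambda>t. pair (\<lambda>v. y' v t) x) \<le> (1 / c) * haar_tree.p x" if x: "x \<in> c00" for x
  proof -
    obtain n where n: "\<And>M. n \<le> M \<Longrightarrow> trunc M x = x" using c00_trunc_eq[OF x] by blast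
    \<comment> \<open>The segment from the root to \<open>b n\<close> has entries at the levels from
      0 to \<open>n\<close>, hence \<open>Suc n\<close> of them.\<close>
    define M where "M = Suc n"
    have "trunc (b M) x = x" using n le_b[of M] by (simp add: M_def)
    then have z: "(\<lambda>t. pair (\<lambda>v. y' v t) x) = (\<lambda>t. \<Sum>k<M. x (b k) * y k t)"
      using pair_y'[of M x] by simp
    have zY: "(\<lambda>t. \<Sum>k<M. x (b k) * y k t) \<in> Y" using y(1) by (intro SB_sum[OF Y])
    have "c * supnorm (\<lambda>t. \<Sum>k<M. x (b k) * y k t) \<le> (LINT t|I01. \<bar>T (\<lambda>t. \<Sum>k<M. x (b k) * y k t) t\<bar>)"
      by (rule T_lower[OF zY])
    also have "\<dots> = (LINT t|I01. \<bar>\<Sum>k<M. x (b k) * haar k t\<bar>)"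
      using T_sum_y[of "\<lambda>k. x (b k)" M] borel_measurable_integrable[OF integrable_T[OF zY]] measurable_haar_sum
      by (intro integral_cong_AE) auto
    also have "\<dots> = haar_norm (segment x 0 (b n))"
    proof -
      have "haar_norm (segment x 0 (b n)) = (LINT t|I01. \<bar>\<Sum>k<M. segment x 0 (b n) k * haar k t\<bar>)"
        by (rule haar_norm_eq) (simp add: segment_def M_def)
      also have "\<dots> = (LINT t|I01. \<bar>\<Sum>k<M. x (b k) * haar k t\<bar>)"
        by (simp add: segment_def M_def anc_b less_Suc_eq_le)
      finally show ?thesis by simp
    qed
    also have "\<dots> \<le> haar_tree.q 0 x"
      by (rule haar_tree.q_upper[OF x]) (simp add: desc_def anc_b b_0)
    also have "\<dots> \<le> 2 ^ lev 0 * haar_tree.nu x 0" by (rule haar_tree.q_le_nu[OF x])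
    also have "\<dots> \<le> haar_tree.p x" using haar_tree.nu_le_p[OF x, of 0] by simp
    finally show ?thesis unfolding z using c by (simp add: field_simps)
  qed
  from haar_tree.ex_bounded_op_from[OF Y y' this] obtain D where D: "bounded_op haar_tree.realization Y D"
    "\<And>z. z \<in> haar_tree.realization \<Longrightarrow>
      cd_converges (\<lambda>N t. pair (\<lambda>v. y' v t) (trunc N (haar_tree.coef z))) (D z)"
    by blast
  have "A x = D (B x)" if x: "x \<in> X" for x
  proof -
    define f where "f = T (A x)"
    have f: "integrable I01 f" unfolding f_def by (rule integrable_T[OF AY[OF x]])
    have Bx: "B x \<in> haar_tree.realization" using B(1) x by (simp add: bounded_op_def)
    have DY: "D (B x) \<in> Y" using D(1) Bx by (simp add: bounded_op_def)
    define s where "s M = (\<lambda>t. \<Sum>k<M. haar_coef f k * y k t)" for M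
    have sY: "s M \<in> Y" for M unfolding s_def using y(1) by (intro SB_sum[OF Y])
    have "cd_converges (\<lambda>M t. pair (\<lambda>v. y' v t) (trunc (b M) (\<alpha> x))) (D (B x))"
      using cd_converges_subseq[OF D(2)[OF Bx] strict_mono_b] B(2)[OF x] by simp
    then have lim: "cd_converges s (D (B x))"
      unfolding pair_y' by (simp add: s_def[abs_def] \<alpha>_def f_def)
    define d where "d = fdiff (A x) (D (B x))"
    have dY: "d \<in> Y" unfolding d_def by (rule SB_diff[OF Y AY[OF x] DY])
    \<comment> \<open>Against a dyadic indicator of level \<open>n\<close>, the integrals of the
      partial sums equal that of \<open>T (A x)\<close> from index \<open>2 ^ n\<close> on, while
      continuity of the functional makes them tend to that of \<open>T (D (B x))\<close>.\<close>
    have "(LINT t|I01. indicator {t. idx n t = i} t * T d t) = 0" for n i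
    proof -
      define h where "h t = (indicator {t. idx n t = i} t :: real)" for t
      have h: "h \<in> borel_measurable I01" "\<And>t. t \<in> {0..1} \<Longrightarrow> \<bar>h t\<bar> \<le> 1"
        using measurable_indicator_idx[of "\<lambda>j. j = i" n] by (simp_all add: h_def[abs_def] indicator_def)
      have \<phi>: "T_functional h \<in> dual Y" by (rule T_functional_dual[OF h])
      have "T_functional h (s M) = T_functional h (A x)" if "2 ^ n \<le> M" for M
      proof -
        have "T_functional h (s M) = (LINT t|I01. T (s M) t * h t)" using sY by (simp add: T_functional_def)
        also have "\<dots> = (LINT t|I01. h t * (\<Sum>k<M. haar_coef f k * haar k t))"
          using T_sum_y[of "haar_coef f" M] integrable_T_mult[OF h sY, of M]
            integrable_I01_mult_bounded[OF integrable_haar_sum h, of "haar_coef f" M]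
          unfolding s_def by (intro integral_cong_AE) (auto simp: mult.commute)
        also have "\<dots> = (LINT t|I01. h t * f t)"
          unfolding h_def by (rule haar_projection_dyadic[OF f that])
        finally show ?thesis using AY[OF x] by (simp add: T_functional_def f_def mult.commute)
      qed
      then have "(\<lambda>M. T_functional h (s M)) \<longlonglongrightarrow> T_functional h (A x)"
        by (intro tendsto_eventually eventually_sequentiallyI[of "2 ^ n"])
      then have "T_functional h (D (B x)) = T_functional h (A x)"
        using dual_continuous[OF Y \<phi> sY DY lim] LIMSEQ_unique by blast
      then have "T_functional h d = 0"
        unfolding d_def using dual_fdiff[OF Y \<phi> AY[OF x] DY] by simp
      then show ?thesis using dY by (simp add: T_functional_def h_def mult.commute)
    qed
    then have "AE t in I01. T d t = 0" by (rule AE_eq_0_if_dyadic[OF integrable_T[OF dY]])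
    then have "(LINT t|I01. \<bar>T d t\<bar>) = (LINT t|I01. 0)"
      using integrable_T[OF dY] by (intro integral_cong_AE) auto
    then have "c * supnorm d \<le> 0" using T_lower[OF dY] by simp
    then have "d = (\<lambda>_. 0)"
      using c supnorm_eq_0[OF SB_CD[OF Y dY]] by (simp add: mult_le_0_iff)
    then show ?thesis by (auto simp: d_def fdiff_def fun_eq_iff)
  qed
  with B(1) D(1) show ?thesis by blast
qed

end

section \<open>From coded triples to operators\<close>

lemma isomorphic_L1_imp_L1_isomorphism:
  assumes "Y \<in> SB" "isomorphic_L1 Y"
  shows "\<exists>T c C. L1_isomorphism Y T c C"
proof -
  have int: "set_integrable lborel {0..1} f \<longleftrightarrow> integrable I01 f" for f :: "real \<Rightarrow> real"
    by (simp add: set_integrable_def integrable_restrict_space)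
  have val: "(LBINT t:{0..1}. f t) = (LINT t|I01. f t)" for f :: "real \<Rightarrow> real"
    by (simp add: set_lebesgue_integral_def integral_restrict_space)
  have ae: "(AE t in lborel. t \<in> {0..1} \<longrightarrow> P t) \<longleftrightarrow> (AE t in I01. P t)" for P :: "real \<Rightarrow> bool"
    by (subst AE_restrict_space_iff) auto
  obtain T c C where T: "0 < c"
    "\<forall>y\<in>Y. integrable I01 (T y) \<and> c * supnorm y \<le> (LINT t|I01. \<bar>T y t\<bar>) \<and>
       (LINT t|I01. \<bar>T y t\<bar>) \<le> C * supnorm y"
    "\<forall>y\<in>Y. \<forall>z\<in>Y. AE t in I01. T (fadd y z) t = T y t + T z t"
    "\<forall>a. \<forall>y\<in>Y. AE t in I01. T (fscale a y) t = a * T y t"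
    "\<forall>f. integrable I01 f \<longrightarrow> (\<exists>y\<in>Y. AE t in I01. T y t = f t)"
    using assms(2) unfolding isomorphic_L1_def int val ae by (elim exE conjE)
  have "L1_isomorphism Y T c C"
    by (rule L1_isomorphism.intro) (use assms(1) T in blast)+
  then show ?thesis by blast
qed

text \<open>Membership in \<open>W_SB_L1\<close> grants weak compactness to some operator with the
  given code, whereas the claim concerns every operator with this code; by density two such
  operators agree on \<open>X\<close>.\<close>

lemma bounded_op_eq_on_dense:
  assumes "bounded_op X Y A" "bounded_op X Y A'" and X: "X \<in> SB" and Y: "Y \<in> SB"
    and D: "\<And>n. d n \<in> X" "\<And>x e. x \<in> X \<Longrightarrow> 0 < e \<Longrightarrow> \<exists>n. supnorm (fdiff (d n) x) < e"
    and eq: "\<And>n. A (d n) = A' (d n)" and x: "x \<in> X"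
  shows "A x = A' x"
proof -
  have diff: "\<exists>K. \<forall>x\<in>X. \<forall>x'\<in>X. supnorm (fdiff (F x) (F x')) \<le> K * supnorm (fdiff x x')"
    if F: "bounded_op X Y F" for F
  proof -
    obtain K where K: "\<forall>x\<in>X. supnorm (F x) \<le> K * supnorm x" using F unfolding bounded_op_def by blast
    have "supnorm (fdiff (F x) (F x')) \<le> K * supnorm (fdiff x x')" if "x \<in> X" "x' \<in> X" for x x'
    proof -
      have "F (fdiff x x') = fdiff (F x) (F x')"
      proof -
        have e: "fdiff u v = fadd u (fscale (- 1) v)" for u v by (simp add: fdiff_def fadd_def fscale_def)
        show ?thesis unfolding e using F that SB_scale[OF X that(2)] by (simp add: bounded_op_def)
      qed
      then show ?thesis using K SB_diff[OF X that] by fastforce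
    qed
    then show ?thesis by blast
  qed
  obtain K where K: "\<forall>x\<in>X. \<forall>x'\<in>X. supnorm (fdiff (A x) (A x')) \<le> K * supnorm (fdiff x x')"
    using diff[OF assms(1)] by blast
  obtain K' where K': "\<forall>x\<in>X. \<forall>x'\<in>X. supnorm (fdiff (A' x) (A' x')) \<le> K' * supnorm (fdiff x x')"
    using diff[OF assms(2)] by blast
  have AY: "A x \<in> Y" "A' x \<in> Y" if "x \<in> X" for x using assms(1,2) that by (simp_all add: bounded_op_def)
  have CD: "A x \<in> CD" "A' x \<in> CD" if "x \<in> X" for x using AY[OF that] SB_CD[OF Y] by auto
  have "supnorm (fdiff (A x) (A' x)) \<le> 0"
  proof (rule field_le_epsilon)
    fix e :: real assume e: "0 < e"
    define k where "k = \<bar>K\<bar> + \<bar>K'\<bar> + 1"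
    have "0 < e / k" using e by (simp add: k_def)
    then obtain n where n: "supnorm (fdiff (d n) x) < e / k" using D(2)[OF x] by blast
    have s0: "0 \<le> supnorm (fdiff (d n) x)" using SB_CD[OF X SB_diff[OF X D(1) x]] by (rule supnorm_nonneg)
    have "supnorm (fdiff (A x) (A' x)) \<le> supnorm (fdiff (A (d n)) (A x)) + supnorm (fdiff (A' (d n)) (A' x))"
      using supnorm_diff_triangle[OF CD(1)[OF x] CD(1)[OF D(1)] CD(2)[OF x], of n]
      by (simp add: eq supnorm_minus_commute[of "A x"])
    also have "\<dots> \<le> K * supnorm (fdiff (d n) x) + K' * supnorm (fdiff (d n) x)"
      using K K' D(1) x by (intro add_mono) auto
    also have "\<dots> \<le> k * supnorm (fdiff (d n) x)"
      using s0 unfolding k_def distrib_right[symmetric] by (intro mult_right_mono) auto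
    also have "\<dots> \<le> k * (e / k)" using n by (intro mult_left_mono) (auto simp: k_def)
    also have "\<dots> = e" by (simp add: k_def)
    finally show "supnorm (fdiff (A x) (A' x)) \<le> 0 + e" by simp
  qed
  then have "fdiff (A x) (A' x) = (\<lambda>_. 0)" using CD[OF x] by (intro supnorm_eq_0) auto
  then show ?thesis by (auto simp: fdiff_def fun_eq_iff)
qed

theorem theorem1p5:
  fixes d :: "nat \<Rightarrow> cfun set \<Rightarrow> cfun"
  assumes "admissible_coding d"
  shows "\<exists>Z\<in>SB. reflexive_space Z \<and> has_schauder_basis Z \<and>
    (\<forall>X Y Ahat A. (X, Y, Ahat) \<in> W_SB_L1 d \<and> codes d X Y Ahat A \<longrightarrow>
       (\<exists>B C. bounded_op X Z B \<and> bounded_op Z Y C \<and> (\<forall>x\<in>X. A x = C (B x))))"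
proof (intro bexI[of _ haar_tree.realization] conjI allI impI)
  fix X Y Ahat A assume H: "(X, Y, Ahat) \<in> W_SB_L1 d \<and> codes d X Y Ahat A"
  then have X: "X \<in> SB" and Y: "Y \<in> SB" "isomorphic_L1 Y" and A: "codes d X Y Ahat A"
    by (auto simp: W_SB_L1_def Lcal_def)
  obtain A' where A': "codes d X Y Ahat A'" "weakly_compact_op X Y A'"
    using H by (auto simp: W_SB_L1_def)
  have dense: "d n X \<in> X" "x \<in> X \<Longrightarrow> 0 < e \<Longrightarrow> \<exists>n. supnorm (fdiff (d n X) x) < e" for n x e
    using assms X by (auto simp: admissible_coding_def)
  have eq: "A x = A' x" if "x \<in> X" for x
    using A A'(1) unfolding codes_def
    by (intro bounded_op_eq_on_dense[of X Y A A' "\<lambda>n. d n X", OF _ _ X Y(1) dense _ that]) auto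
  obtain T c C where "L1_isomorphism Y T c C"
    using isomorphic_L1_imp_L1_isomorphism[OF Y] by blast
  then interpret L1_isomorphism Y T c C .
  have "\<exists>B C. bounded_op X haar_tree.realization B \<and> bounded_op haar_tree.realization Y C \<and>
      (\<forall>x\<in>X. A' x = C (B x))"
    using A' by (intro weakly_compact_op_factors[OF X]) (auto simp: codes_def)
  then show "\<exists>B C. bounded_op X haar_tree.realization B \<and> bounded_op haar_tree.realization Y C \<and>
      (\<forall>x\<in>X. A x = C (B x))"
    using eq by metis
qed (fact haar_tree.reflexive haar_tree.schauder_basis haar_tree.realization_SB)+

end
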